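(* For every constant $\epsilon>0$, there exists an instance of the multiway cut problem (for some number $k$ of terminals) such that the integrality gap of the CKR relaxation for that instance is at least $1.20016-\epsilon$.
   Context: Multiway cut: given an undirected graph $G=(V,E)$ with edge weights $w:E\to\mathbb{R}_{\ge 0}$ and terminals $t_1,\dots,t_k\in V$, find a partition of $V$ into $k$ parts each containing exactly one terminal minimizing the total weight of edges whose endpoints lie in different parts; its optimum value is the integral optimum. Let $\Delta_k=\{x\in[0,1]^k:\sum_{i=1}^k x_i=1\}$ and let $e^i\in\{0,1\}^k$ be the $i$-th unit vector. The CKR relaxation is the linear program: minimize $\frac12\sum_{e=\{u,v\}\in E} w(e)\|x^u-x^v\|_1$ subject to $x^u\in\Delta_k$ for all $u\in V$ and $x^{t_i}=e^i$ for all $i\in[k]$. The integrality gap of an instance is the ratio of the integral optimum value to the optimum value of the CKR relaxation. *)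

theory Defs
  imports Complex_Main "HOL-Library.Disjoint_Sets"
begin

text \<open>Edges are two-element vertex sets, and weights are only constrained on edges.  Terminals are
  \<open>t 1, \<dots>, t k\<close>; they have to be distinct, since otherwise no partition into \<open>k\<close> parts with exactly
  one terminal each exists.\<close>

definition multiway_cut_instance ::
  "'v set \<Rightarrow> 'v set set \<Rightarrow> ('v set \<Rightarrow> real) \<Rightarrow> nat \<Rightarrow> (nat \<Rightarrow> 'v) \<Rightarrow> bool" where
  "multiway_cut_instance V E w k t \<longleftrightarrow>
     finite V \<and>
     (\<forall>e\<in>E. e \<subseteq> V \<and> card e = 2) \<and>
     (\<forall>e\<in>E. 0 \<le> w e) \<and>
     1 \<le> k \<and>
     t ` {1..k} \<subseteq> V \<and>
     inj_on t {1..k}"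

definition multiway_cut :: "'v set \<Rightarrow> nat \<Rightarrow> (nat \<Rightarrow> 'v) \<Rightarrow> 'v set set \<Rightarrow> bool" where
  "multiway_cut V k t P \<longleftrightarrow>
     partition_on V P \<and> card P = k \<and> (\<forall>A\<in>P. \<exists>!s. s \<in> A \<inter> t ` {1..k})"

definition cut_edges :: "'v set set \<Rightarrow> 'v set set \<Rightarrow> 'v set set" where
  "cut_edges E P = {e \<in> E. \<exists>u v. e = {u, v} \<and> (\<exists>A\<in>P. \<exists>B\<in>P. A \<noteq> B \<and> u \<in> A \<and> v \<in> B)}"

definition cut_weight :: "'v set set \<Rightarrow> ('v set \<Rightarrow> real) \<Rightarrow> 'v set set \<Rightarrow> real" where
  "cut_weight E w P = (\<Sum>e\<in>cut_edges E P. w e)"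

definition integral_opt ::
  "'v set \<Rightarrow> 'v set set \<Rightarrow> ('v set \<Rightarrow> real) \<Rightarrow> nat \<Rightarrow> (nat \<Rightarrow> 'v) \<Rightarrow> real" where
  "integral_opt V E w k t = Inf (cut_weight E w ` {P. multiway_cut V k t P})"

text \<open>A vector of \<open>\<real>\<^sup>k\<close> is a function \<open>nat \<Rightarrow> real\<close> of which only the values on \<open>{1..k}\<close>
  matter.\<close>

definition simplex :: "nat \<Rightarrow> (nat \<Rightarrow> real) set" where
  "simplex k = {x. (\<forall>i\<in>{1..k}. x i \<in> {0..1}) \<and> (\<Sum>i=1..k. x i) = 1}"

definition unit_vec :: "nat \<Rightarrow> nat \<Rightarrow> real" where
  "unit_vec i = (\<lambda>j. if j = i then 1 else 0)"

definition l1_dist :: "nat \<Rightarrow> (nat \<Rightarrow> real) \<Rightarrow> (nat \<Rightarrow> real) \<Rightarrow> real" where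
  "l1_dist k x y = (\<Sum>i=1..k. \<bar>x i - y i\<bar>)"

text \<open>The description picks out the common value of \<open>l1_dist\<close> for the two orderings of the
  endpoints of \<open>e\<close>; see \<open>edge_length_insert\<close> below.\<close>

definition edge_length :: "nat \<Rightarrow> ('v \<Rightarrow> nat \<Rightarrow> real) \<Rightarrow> 'v set \<Rightarrow> real" where
  "edge_length k x e = (THE d. \<exists>u v. e = {u, v} \<and> d = l1_dist k (x u) (x v))"

definition ckr_feasible :: "'v set \<Rightarrow> nat \<Rightarrow> (nat \<Rightarrow> 'v) \<Rightarrow> ('v \<Rightarrow> nat \<Rightarrow> real) \<Rightarrow> bool" where
  "ckr_feasible V k t x \<longleftrightarrow>
     (\<forall>u\<in>V. x u \<in> simplex k) \<and>
     (\<forall>i\<in>{1..k}. \<forall>j\<in>{1..k}. x (t i) j = unit_vec i j)"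

definition ckr_value :: "'v set set \<Rightarrow> ('v set \<Rightarrow> real) \<Rightarrow> nat \<Rightarrow> ('v \<Rightarrow> nat \<Rightarrow> real) \<Rightarrow> real" where
  "ckr_value E w k x = 1/2 * (\<Sum>e\<in>E. w e * edge_length k x e)"

definition ckr_opt ::
  "'v set \<Rightarrow> 'v set set \<Rightarrow> ('v set \<Rightarrow> real) \<Rightarrow> nat \<Rightarrow> (nat \<Rightarrow> 'v) \<Rightarrow> real" where
  "ckr_opt V E w k t = Inf (ckr_value E w k ` {x. ckr_feasible V k t x})"

text \<open>The quotient is only meaningful when \<open>ckr_opt\<close> is positive.\<close>

definition integrality_gap ::
  "'v set \<Rightarrow> 'v set set \<Rightarrow> ('v set \<Rightarrow> real) \<Rightarrow> nat \<Rightarrow> (nat \<Rightarrow> 'v) \<Rightarrow> real" where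
  "integrality_gap V E w k t = integral_opt V E w k t / ckr_opt V E w k t"

lemma edge_length_insert: "edge_length k x {u, v} = l1_dist k (x u) (x v)"
  unfolding edge_length_def
proof (rule the_equality)
  have sym: "l1_dist k a b = l1_dist k b a" for a b
    by (simp add: l1_dist_def abs_minus_commute)
  show "d = l1_dist k (x u) (x v)" if "\<exists>u' v'. {u, v} = {u', v'} \<and> d = l1_dist k (x u') (x v')" for d
    using that by (metis sym doubleton_eq_iff)
qed blast

text \<open>Both infima range over nonempty sets of reals that are bounded below by 0, so they are the
  true optimum values.\<close>

lemma multiway_cut_exists:
  assumes "multiway_cut_instance V E w k t"
  shows "\<exists>P. multiway_cut V k t P"
proof -
  have k: "1 \<le> k" and tV: "t ` {1..k} \<subseteq> V" and inj: "inj_on t {1..k}"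
    using assms by (auto simp: multiway_cut_instance_def)
  define A where "A i = (if i = 1 then V - t ` {2..k} else {t i})" for i
  have inj': "t i = t j \<longleftrightarrow> i = j" if "i \<in> {1..k}" "j \<in> {1..k}" for i j
    using inj_on_eq_iff[OF inj that] .
  have tA: "t i \<in> A j \<longleftrightarrow> i = j" if "i \<in> {1..k}" "j \<in> {1..k}" for i j
  proof (cases "j = 1")
    case True
    have "t i \<in> t ` {2..k} \<longleftrightarrow> i \<noteq> 1"
    proof
      assume "t i \<in> t ` {2..k}"
      then obtain l where "l \<in> {2..k}" "t i = t l" by blast
      with inj'[of i l] that show "i \<noteq> 1" by simp
    next
      assume "i \<noteq> 1"
      with that show "t i \<in> t ` {2..k}" by (intro imageI) simp
    qed
    moreover have "t i \<in> V" using that tV by blast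
    ultimately show ?thesis using True by (simp add: A_def)
  next
    case False
    with inj'[OF that] show ?thesis by (simp add: A_def)
  qed
  have injA: "inj_on A {1..k}"
    by (rule inj_onI) (use tA in blast)
  have disj: "A i \<inter> A j = {}" if "i \<in> {1..k}" "j \<in> {1..k}" "i \<noteq> j" for i j
    using that inj'[OF that(1,2)] by (auto simp: A_def)
  have un: "\<Union> (A ` {1..k}) = V"
  proof (intro equalityI subsetI)
    fix v assume v: "v \<in> V"
    show "v \<in> \<Union> (A ` {1..k})"
    proof (cases "v \<in> t ` {2..k}")
      case True
      then obtain i where "i \<in> {2..k}" "v = t i" by blast
      then show ?thesis by (intro UN_I[of i]) (auto simp: A_def)
    next
      case False
      with v k show ?thesis by (intro UN_I[of 1]) (auto simp: A_def)
    qed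
  qed (use tV in \<open>auto simp: A_def split: if_splits\<close>)
  have "partition_on V (A ` {1..k})"
  proof (rule partition_onI)
    show "disjnt p q" if "p \<in> A ` {1..k}" "q \<in> A ` {1..k}" "p \<noteq> q" for p q
      using that disj unfolding disjnt_def by blast
    show "{} \<notin> A ` {1..k}"
      using tA by fastforce
  qed (use un in auto)
  moreover have "card (A ` {1..k}) = k"
    using injA by (simp add: card_image)
  moreover have "\<exists>!s. s \<in> B \<inter> t ` {1..k}" if B: "B \<in> A ` {1..k}" for B
  proof -
    obtain j where j: "j \<in> {1..k}" "B = A j" using B by blast
    show ?thesis
      by (rule ex1I[of _ "t j"]) (use j tA in auto)
  qed
  ultimately show ?thesis unfolding multiway_cut_def by blast
qed

lemma cut_weight_nonneg:
  assumes "multiway_cut_instance V E w k t"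
  shows "0 \<le> cut_weight E w P"
  using assms unfolding cut_weight_def
  by (intro sum_nonneg) (auto simp: multiway_cut_instance_def cut_edges_def)

lemma ckr_feasible_exists:
  assumes "multiway_cut_instance V E w k t"
  shows "\<exists>x. ckr_feasible V k t x"
proof -
  have k: "1 \<le> k" and inj: "inj_on t {1..k}"
    using assms by (auto simp: multiway_cut_instance_def)
  define f where "f u = (if u \<in> t ` {1..k} then the_inv_into {1..k} t u else 1)" for u
  have f: "f u \<in> {1..k}" for u
    using k the_inv_into_into[OF inj, of u "{1..k}"] by (simp add: f_def)
  have ft: "f (t i) = i" if "i \<in> {1..k}" for i
    using that the_inv_into_f_f[OF inj that] by (simp add: f_def)
  have "unit_vec i \<in> simplex k" if "i \<in> {1..k}" for i
    using that by (simp add: simplex_def unit_vec_def)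
  then have "ckr_feasible V k t (\<lambda>u. unit_vec (f u))"
    using f ft by (simp add: ckr_feasible_def)
  then show ?thesis by blast
qed

lemma ckr_value_nonneg:
  assumes "multiway_cut_instance V E w k t"
  shows "0 \<le> ckr_value E w k x"
proof -
  have "0 \<le> edge_length k x e" if "e \<in> E" for e
  proof -
    have "card e = 2" using assms that by (simp add: multiway_cut_instance_def)
    then obtain u v where "e = {u, v}" by (auto simp: card_2_iff)
    then show ?thesis by (simp add: edge_length_insert l1_dist_def sum_nonneg)
  qed
  with assms show ?thesis
    unfolding ckr_value_def by (auto simp: multiway_cut_instance_def intro!: sum_nonneg)
qed

end

theory Submission imports Defs begin

text \<open>The instance is a sum of copies of one weighted grid, one on each 4-element set \<open>S\<close> of the \<open>K\<close> terminals: the points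
  of \<open>\<nat>\<^sup>S\<close> with sum \<open>n\<close>, where edges on the triangular faces carry most of the weight and the tetrahedral grid a small uniform
  one.  The points themselves, divided by \<open>n\<close>, are a cheap fractional solution.  For \<open>K\<close> much larger than \<open>n\<close>, a multiway cut
  labels the points of almost every \<open>S\<close> by a terminal in their support or by one outside \<open>S\<close> (label 0), so only such
  labellings have to be bounded from below.

  On a triangle, give weight 1 to the edges on the lines \<open>x\<^sub>k = c\<close>, \<open>c < 2n/3\<close>, and weight \<open>n/3 - d\<close> to the edge of a side at
  distance \<open>d < n/3\<close> from a corner.  Relabelling each corner triangle \<open>x\<^sub>i \<ge> 2n/3\<close> by \<open>i\<close> does not increase the cut, and
  then a shift argument finds at least \<open>n\<close> cells that are not monochromatic, each with two cut edges.  This alone gives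
  the ratio 6/5.  Further gain comes from the tetrahedron: a labelling cuts three edges in at least as many
  tetrahedral cells as there are cells on a face not labelled 0 entirely.  This favours labellings with many zeros on the
  faces; but if zeros reach all three sides, these are cut twice, which is charged by a uniform weight on the sides.
  Cuts that cross the sides close to the corners are made slightly more expensive in return for the cells
  they keep away from 0, and otherwise zeros cause a surplus in the main term that grows linearly with their number.\<close>

section \<open>Cuts along a line\<close>

text \<open>In the fractional solution every edge has l1 distance \<open>2/n\<close>, so its value
  is the total weight divided by \<open>n\<close>, and the proof compares total weights with
  cheapest labellings. For the triangle alone, with \<open>n = 9 N\<close>, the total is
  \<open>270 N^2\<close> to leading order and a labelling costs at least \<open>36 N\<close>, hence
  6/5. The obstacle to adding the tetrahedron is that its bound drops by a fixed amount for every
  zero cell of the face. So the triangle has to return at least this loss whenever zeros appear, and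
  how it can do so depends on how many of its sides are free of zeros; this gives the four cases of
  \<open>tri_bound_aux\<close>. The graph itself cannot forbid labels outside the support of a
  point. Instead, copies on different \<open>S\<close> share the points of their common faces, so
  that a label at a point spoils only those \<open>S\<close> that contain this label. The factor 9
  makes \<open>n/9\<close>, \<open>n/3\<close> and \<open>2n/3\<close> integers.\<close>

definition wcuts :: "(nat \<Rightarrow> nat) \<Rightarrow> (nat \<Rightarrow> 'a) \<Rightarrow> nat \<Rightarrow> nat" where
  "wcuts g s L = (\<Sum>t<L. g t * of_bool (s t \<noteq> s (Suc t)))"

abbreviation cuts :: "(nat \<Rightarrow> 'a) \<Rightarrow> nat \<Rightarrow> nat" where
  "cuts \<equiv> wcuts (\<lambda>_. 1)"

lemma wcuts_cong:
  assumes "\<And>t. t < L \<Longrightarrow> g t = g' t" "\<And>t. t \<le> L \<Longrightarrow> s t = s' t"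
  shows "wcuts g s L = wcuts g' s' L"
  unfolding wcuts_def using assms by (intro sum.cong) auto

lemma wcuts_add: "wcuts g s (a + b) = wcuts g s a + wcuts (\<lambda>t. g (a + t)) (\<lambda>t. s (a + t)) b"
  by (induction b) (auto simp: wcuts_def)

lemma wcuts_rev: "wcuts g s L = wcuts (\<lambda>t. g (L - Suc t)) (\<lambda>t. s (L - t)) L"
proof -
  have "wcuts g s L = (\<Sum>t<L. g (L - Suc t) * of_bool (s (L - Suc t) \<noteq> s (Suc (L - Suc t))))"
    unfolding wcuts_def by (rule sum.nat_diff_reindex [symmetric])
  also have "\<dots> = wcuts (\<lambda>t. g (L - Suc t)) (\<lambda>t. s (L - t)) L"
    unfolding wcuts_def by (intro sum.cong) (auto simp: Suc_diff_Suc)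
  finally show ?thesis .
qed

lemma cuts_pos:
  assumes "s 0 \<noteq> s L"
  shows "1 \<le> cuts s L"
proof (rule ccontr)
  assume "\<not> ?thesis"
  then have "cuts s L = 0" by simp
  then have z: "of_bool (s t \<noteq> s (Suc t)) = (0::nat)" if "t < L" for t
    using that unfolding wcuts_def by (metis (no_types, lifting) finite_lessThan lessThan_iff mult_1 sum_eq_0_iff)
  have "t \<le> L \<Longrightarrow> s t = s 0" for t
  proof (induction t)
    case (Suc t)
    with z[of t] show ?case by (metis Suc_leD Suc_le_lessD of_bool_eq_0_iff)
  qed simp
  from this[of L] assms show False by simp
qed

lemma cuts_two:
  assumes "s 0 \<noteq> s t" "s t \<noteq> s L" "t \<le> L"
  shows "2 \<le> cuts s L"
proof -
  have "cuts s L = cuts s t + cuts (\<lambda>u. s (t + u)) (L - t)"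
    using wcuts_add[of "\<lambda>_. 1" s t "L - t"] assms by simp
  with cuts_pos[of s t] cuts_pos[of "\<lambda>u. s (t + u)" "L - t"] assms show ?thesis by simp
qed

text \<open>A new cut before \<open>q\<close> means \<open>s (q - 1) \<noteq> v\<close>. Either
  \<open>s\<close> changes between \<open>q - 1\<close> and \<open>L\<close>, and the filling
  removes such a cut, or \<open>s L\<close> equals \<open>s (q - 1)\<close> and thus differs from
  \<open>v\<close>.\<close>

lemma cuts_fill:
  assumes "1 \<le> q" "q \<le> L"
  shows "cuts (\<lambda>t. if q \<le> t then v else s t) L \<le> cuts s L + of_bool (s L \<noteq> v)"
proof -
  let ?s = "\<lambda>t. if q \<le> t then v else s t"
  have split: "cuts f L = cuts f (q - 1) + (of_bool (f (q - 1) \<noteq> f q) + cuts (\<lambda>t. f (q + t)) (L - q))"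
    for f :: "nat \<Rightarrow> 'a"
    using wcuts_add[of "\<lambda>_. 1" f "q - 1" "Suc (L - q)"] assms
      wcuts_add[of "\<lambda>_. 1" "\<lambda>t. f (q - 1 + t)" 1 "L - q"]
    by (simp add: wcuts_def)
  have q: "(of_bool (?s (q - 1) \<noteq> ?s q) :: nat) = of_bool (s (q - 1) \<noteq> v)"
    using assms by (cases q) auto
  have 1: "cuts ?s (q - 1) = cuts s (q - 1)"
    using assms by (intro wcuts_cong) auto
  have 2: "cuts (\<lambda>t. ?s (q + t)) (L - q) = 0"
    by (simp add: wcuts_def)
  have 3: "of_bool (s (q - 1) \<noteq> v) \<le> of_bool (s (q - 1) \<noteq> s q) + cuts (\<lambda>t. s (q + t)) (L - q)
      + (of_bool (s L \<noteq> v) :: nat)"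
    using cuts_pos[of "\<lambda>t. s (q + t)" "L - q"] assms by (auto simp: of_bool_def split: if_splits)
  show ?thesis
    unfolding split[of ?s] split[of s] 1 2 using 3 q by linarith
qed

text \<open>The first cut pays for everything: if it is at \<open>t\<close>, all changed positions
  lie in \<open>{t + 1..m}\<close>, which has \<open>m - t\<close> elements. This is why the sides
  carry the taper \<open>m - t\<close>.\<close>

lemma card_changed_le_wcuts:
  assumes "m \<le> L" "s 0 = v"
  shows "card {c. c \<le> m \<and> s c \<noteq> v} \<le> wcuts (\<lambda>t. m - t) s L"
proof (cases "{c. c \<le> m \<and> s c \<noteq> v} = {}")
  case False
  define c where "c = (LEAST c. s c \<noteq> v)"
  obtain c1 where c1: "c1 \<le> m" "s c1 \<noteq> v" using False by blast
  have sc: "s c \<noteq> v" unfolding c_def using c1 by (rule_tac LeastI)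
  have least: "s d = v" if "d < c" for d using not_less_Least that unfolding c_def by blast
  have "c \<le> c1" unfolding c_def by (rule Least_le) (rule c1)
  then have cm: "c \<le> m" using c1 by simp
  have c0: "0 < c" using sc assms(2) by (cases c) auto
  have "{c. c \<le> m \<and> s c \<noteq> v} \<subseteq> {c..m}" using least by (force simp: not_less[symmetric])
  then have "card {c. c \<le> m \<and> s c \<noteq> v} \<le> card {c..m}" by (intro card_mono) auto
  also have "\<dots> = (m - (c - 1)) * of_bool (s (c - 1) \<noteq> s (Suc (c - 1)))"
    using least[of "c - 1"] sc c0 cm by simp
  also have "\<dots> \<le> wcuts (\<lambda>t. m - t) s L"
    unfolding wcuts_def using c0 cm assms by (intro member_le_sum) auto
  finally show ?thesis .
next
  case True
  show ?thesis unfolding True by simp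
qed

text \<open>If \<open>v\<close> is left for the first time after position \<open>d\<close>, the
  positions up to \<open>d\<close> have collected \<open>2 + 4 + ... + 2 * d \<ge> d^2\<close>, and
  the cut costs the missing \<open>N^2 - d^2\<close>. In \<open>corner_gain\<close> the linear
  rewards are converted into cut lines or nonzero cells.\<close>

lemma half_corner_gain:
  assumes "N \<le> L" "s 0 = v"
  shows "N\<^sup>2 \<le> wcuts (\<lambda>t. N\<^sup>2 - t\<^sup>2) s L + (\<Sum>k=1..N. 2 * k * of_bool (s k = v))"
proof -
  have gauss: "(\<Sum>k=1..d. 2 * k) = d * Suc d" for d :: nat
    by (induction d) auto
  show ?thesis
  proof (cases "\<forall>k\<le>N. s k = v")
    case True
    then have "(\<Sum>k=1..N. 2 * k * of_bool (s k = v)) = (\<Sum>k=1..N. 2 * k)"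
      by (intro sum.cong) auto
    then have "N * Suc N = (\<Sum>k=1..N. 2 * k * of_bool (s k = v))" using gauss[of N] by argo
    then show ?thesis unfolding power2_eq_square by (metis le_add2 mult_Suc_right trans_le_add2)
  next
    case False
    define c where "c = (LEAST c. s c \<noteq> v)"
    obtain c1 where c1: "c1 \<le> N" "s c1 \<noteq> v" using False by blast
    have sc: "s c \<noteq> v" unfolding c_def using c1 by (rule_tac LeastI)
    have least: "s d = v" if "d < c" for d using not_less_Least that unfolding c_def by blast
    have "c \<le> c1" unfolding c_def by (rule Least_le) (rule c1)
    then have cm: "c \<le> N" using c1 by simp
    have c0: "0 < c" using sc assms(2) by (cases c) auto
    define d where "d = c - 1"
    have dN: "d < N" "c = Suc d" using c0 cm by (auto simp: d_def)
    have "(\<Sum>k=1..d. 2 * k) = (\<Sum>k=1..d. 2 * k * of_bool (s k = v))"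
      using least dN by (intro sum.cong) auto
    also have "\<dots> \<le> (\<Sum>k=1..N. 2 * k * of_bool (s k = v))"
      using dN by (intro sum_mono2) auto
    finally have 1: "d * Suc d \<le> (\<Sum>k=1..N. 2 * k * of_bool (s k = v))" unfolding gauss .
    have "N\<^sup>2 - d\<^sup>2 = (N\<^sup>2 - d\<^sup>2) * of_bool (s d \<noteq> s (Suc d))"
      using least[of d] sc dN by simp
    also have "\<dots> \<le> wcuts (\<lambda>t. N\<^sup>2 - t\<^sup>2) s L"
      unfolding wcuts_def using dN assms by (intro member_le_sum) auto
    finally have 2: "N\<^sup>2 - d\<^sup>2 \<le> wcuts (\<lambda>t. N\<^sup>2 - t\<^sup>2) s L" .
    have "d\<^sup>2 \<le> d * Suc d" by (simp add: power2_eq_square)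
    with 1 2 show ?thesis by linarith
  qed
qed

section \<open>Lattice simplices\<close>

text \<open>As the functions vanish outside \<open>S\<close>, a face of the simplex is literally a
  subset, and simplices on different sets share the points of their common face.\<close>

definition lat :: "nat set \<Rightarrow> nat \<Rightarrow> (nat \<Rightarrow> nat) set" where
  "lat S n = {x. (\<forall>l. l \<notin> S \<longrightarrow> x l = 0) \<and> sum x S = n}"

abbreviation up :: "nat \<Rightarrow> (nat \<Rightarrow> nat) \<Rightarrow> nat \<Rightarrow> nat" where
  "up i y \<equiv> y(i := Suc (y i))"

definition vert :: "nat \<Rightarrow> nat \<Rightarrow> nat \<Rightarrow> nat" where
  "vert n i = (\<lambda>l. if l = i then n else 0)"

lemma sum_upd:
  fixes y :: "nat \<Rightarrow> nat"
  assumes "finite S" "i \<in> S"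
  shows "sum (y(i := v)) S + y i = sum y S + v"
proof -
  have "sum (y(i := v)) (S - {i}) = sum y (S - {i})" by (intro sum.cong) auto
  then show ?thesis using assms by (simp add: sum.remove[of S i])
qed

lemma finite_lat: 
  assumes "finite S"
  shows "finite (lat S n)"
proof (rule finite_subset)
  show "lat S n \<subseteq> {x. \<forall>l. (l \<in> S \<longrightarrow> x l \<in> {..n}) \<and> (l \<notin> S \<longrightarrow> x l = 0)}"
    using assms member_le_sum[of _ S] by (fastforce simp: lat_def)
  show "finite \<dots>" using assms by (intro finite_set_of_finite_funs) auto
qed

lemma lat_le: "x \<in> lat S n \<Longrightarrow> finite S \<Longrightarrow> x l \<le> n"
  using member_le_sum[of l S x] by (cases "l \<in> S") (auto simp: lat_def)

lemma up_lat: "y \<in> lat S n \<Longrightarrow> finite S \<Longrightarrow> i \<in> S \<Longrightarrow> up i y \<in> lat S (Suc n)"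
  using sum_upd[of S i y "Suc (y i)"] by (auto simp: lat_def)

lemma down_lat:
  assumes "y \<in> lat S (Suc n)" "finite S" "i \<in> S" "0 < y i"
  shows "y(i := y i - 1) \<in> lat S n"
  using sum_upd[of S i y "y i - 1"] assms by (auto simp: lat_def)

lemma vert_lat: "finite S \<Longrightarrow> i \<in> S \<Longrightarrow> vert n i \<in> lat S n"
  by (simp add: lat_def vert_def)

lemma lat_insert_zero:
  assumes "finite S" "h \<notin> S"
  shows "{x \<in> lat (insert h S) n. x h = 0} = lat S n"
  using assms unfolding lat_def by (auto cong: sum.cong) metis+

lemma lat_mono: "S \<subseteq> S' \<Longrightarrow> finite S' \<Longrightarrow> lat S n \<subseteq> lat S' n"
proof
  fix x assume a: "S \<subseteq> S'" "finite S'" "x \<in> lat S n"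
  then have "sum x S = sum x S'" by (intro sum.mono_neutral_left) (auto simp: lat_def)
  with a show "x \<in> lat S' n" by (auto simp: lat_def)
qed

lemma card_lat_Suc:
  assumes "finite S" "h \<notin> S"
  shows "card (lat (insert h S) (Suc n)) = card (lat (insert h S) n) + card (lat S (Suc n))"
proof -
  let ?S = "insert h S"
  have fin: "finite ?S" using assms by simp
  have "lat ?S (Suc n) = up h ` lat ?S n \<union> {x \<in> lat ?S (Suc n). x h = 0}"
  proof (intro equalityI subsetI)
    fix x assume x: "x \<in> lat ?S (Suc n)"
    show "x \<in> up h ` lat ?S n \<union> {x \<in> lat ?S (Suc n). x h = 0}"
    proof (cases "x h = 0")
      case False
      then have "x = up h (x(h := x h - 1))" by (auto simp: fun_eq_iff)
      moreover have "x(h := x h - 1) \<in> lat ?S n"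
        using down_lat[OF x fin] False by simp
      ultimately show ?thesis by blast
    qed (use x in simp)
  qed (use up_lat[OF _ fin] in auto)
  moreover have "inj_on (up h) (lat ?S n)"
  proof (rule inj_onI)
    fix x y :: "nat \<Rightarrow> nat" assume "up h x = up h y"
    then have "up h x l = up h y l" for l by simp
    then show "x = y" by (metis ext fun_upd_apply nat.inject)
  qed
  moreover have "up h ` lat ?S n \<inter> lat S (Suc n) = {}"
    using assms by (auto simp: lat_def)
  ultimately show ?thesis
    using assms by (simp add: lat_insert_zero card_Un_disjoint card_image finite_lat)
qed

lemma card_lat_zero: "finite S \<Longrightarrow> card (lat S 0) = 1"
proof -
  assume "finite S"
  then have "lat S 0 = {\<lambda>_. 0}" by (auto simp: lat_def fun_eq_iff)
  then show ?thesis by simp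
qed

lemma card_lat1: "card (lat {i} n) = 1"
proof -
  have "lat {i} n = {vert n i}" by (auto simp: lat_def fun_eq_iff vert_def)
  then show ?thesis by simp
qed

lemma card_lat2: "i \<noteq> j \<Longrightarrow> card (lat {i, j} n) = n + 1"
  by (induction n) (simp_all add: card_lat_zero card_lat_Suc card_lat1)

lemma card_lat3: "distinct [i, j, k] \<Longrightarrow> 2 * card (lat {i, j, k} n) = (n + 1) * (n + 2)"
proof (induction n)
  case (Suc n)
  then have "card (lat {i, j, k} (Suc n)) = card (lat {i, j, k} n) + card (lat {j, k} (Suc n))"
    by (intro card_lat_Suc) auto
  with Suc show ?case by (simp add: card_lat2)
qed (simp add: card_lat_zero)

lemma card_lat4: "distinct [i, j, k, h] \<Longrightarrow> 6 * card (lat {i, j, k, h} n) = (n + 1) * (n + 2) * (n + 3)"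
proof (induction n)
  case (Suc n)
  have "2 * card (lat {j, k, h} (Suc n)) = (Suc n + 1) * (Suc n + 2)"
    using Suc.prems by (intro card_lat3) auto
  moreover have "card (lat {i, j, k, h} (Suc n)) = card (lat {i, j, k, h} n) + card (lat {j, k, h} (Suc n))"
    using Suc.prems by (intro card_lat_Suc) auto
  ultimately show ?case using Suc by (simp add: algebra_simps)
qed (simp add: card_lat_zero)

section \<open>Labelled cells and the shift argument\<close>

text \<open>A cell is encoded by a point \<open>y\<close> one level lower: its vertices are the
  points \<open>up i y\<close>.\<close>

definition monochromatic :: "((nat \<Rightarrow> nat) \<Rightarrow> nat) \<Rightarrow> nat set \<Rightarrow> (nat \<Rightarrow> nat) \<Rightarrow> bool" where
  "monochromatic P S y \<longleftrightarrow> (\<exists>l. \<forall>i\<in>S. P (up i y) = l)"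

definition zero_cell :: "((nat \<Rightarrow> nat) \<Rightarrow> nat) \<Rightarrow> nat set \<Rightarrow> (nat \<Rightarrow> nat) \<Rightarrow> bool" where
  "zero_cell P S y \<longleftrightarrow> (\<forall>i\<in>S. P (up i y) = 0)"

text \<open>Label \<open>0\<close> stands for all labels that are not corners of the simplex \<open>S\<close>, so a cut whose labels on \<open>S\<close>
  always lie in the support of the point becomes a labelling of this kind.\<close>

definition nonopp :: "((nat \<Rightarrow> nat) \<Rightarrow> nat) \<Rightarrow> nat set \<Rightarrow> nat \<Rightarrow> bool" where
  "nonopp P S n \<longleftrightarrow> finite S \<and> 0 \<notin> S \<and> (\<forall>x\<in>lat S n. P x = 0 \<or> P x \<in> S \<and> 0 < x (P x)) \<and>
     (\<forall>i\<in>S. P (vert n i) = i)"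

text \<open>A shift argument in the spirit of Mirzakhani and Vondrak: a monochromatic cell \<open>y\<close> with label \<open>l \<in>
    S\<close> is moved to
  \<open>y - e\<^sub>l\<close>, one with label 0 to \<open>y - e\<^bsub>dir y\<^esub>\<close>.  Two cells \<open>z + e\<^sub>i\<close> and \<open>z + e\<^sub>j\<close> share the vertex
  \<open>z + e\<^sub>i + e\<^sub>j\<close>, hence have the same label; so the map is injective if \<open>dir\<close> agrees on touching zero cells.
  \<open>B\<close> collects the cells that cannot be moved and \<open>U\<close> consists of points that are missed.\<close>

lemma nonmono_count:
  assumes P: "nonopp P S (n + 2)" and S2: "2 \<le> card S"
    and dS: "\<And>y. dir y \<in> S"
    and B: "\<And>y. y \<in> lat S (n + 1) \<Longrightarrow> zero_cell P S y \<Longrightarrow> y (dir y) = 0 \<Longrightarrow> y \<in> B" and "finite B"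
    and adj: "\<And>z i j. \<lbrakk>z \<in> lat S n; i \<in> S; j \<in> S; zero_cell P S (up i z); zero_cell P S (up j z)\<rbrakk>
                \<Longrightarrow> dir (up i z) = dir (up j z)"
    and U: "U \<subseteq> lat S n"
           "\<And>z i. \<lbrakk>z \<in> U; i \<in> S; monochromatic P S (up i z)\<rbrakk> \<Longrightarrow> P (up i (up i z)) \<noteq> i \<and>
                (zero_cell P S (up i z) \<longrightarrow> dir (up i z) \<noteq> i)"
  shows "card (lat S (n + 1)) + card U \<le> card {y \<in> lat S (n + 1). \<not> monochromatic P S y} + card (lat S n) + card B"
proof -
  have fin: "finite S" and S0: "0 \<notin> S"
    and lab: "\<And>x. x \<in> lat S (n + 2) \<Longrightarrow> P x = 0 \<or> P x \<in> S \<and> 0 < x (P x)"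
    using P by (auto simp: nonopp_def)
  define M where "M = {y \<in> lat S (n + 1). monochromatic P S y}"
  define d where "d y = (if zero_cell P S y then dir y else P (up (SOME i. i \<in> S) y))" for y
  have Sne: "(SOME i. i \<in> S) \<in> S" using S2 by (metis card.empty not_numeral_le_zero some_in_eq)
  have dM: "P (up i y) = P (up j y)" if "y \<in> M" "i \<in> S" "j \<in> S" for y i j
    using that by (auto simp: M_def monochromatic_def)
  have d1: "d y = P (up i y) \<and> d y \<in> S \<and> 0 < y (d y)"
    if y: "y \<in> M" "\<not> zero_cell P S y" and i: "i \<in> S" for y i
  proof -
    let ?s = "SOME i. i \<in> S"
    have ds: "d y = P (up ?s y)" using y by (simp add: d_def)
    have eq: "d y = P (up j y)" if "j \<in> S" for j using dM[OF y(1) Sne that] ds by simp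
    have nz: "d y \<noteq> 0" using y(2) eq by (auto simp: zero_cell_def)
    have yl: "y \<in> lat S (n + 1)" using y by (simp add: M_def)
    have upl: "up j y \<in> lat S (n + 2)" if "j \<in> S" for j
      using up_lat[OF yl fin that] by simp
    have dS': "d y \<in> S" using lab[OF upl[OF i]] eq[OF i] nz by auto
    \<comment> \<open>A direction other than the label is needed: \<open>nonopp\<close> makes the
      coordinate \<open>d y\<close> positive at \<open>up j y\<close>, where it agrees with that of
      \<open>y\<close>.\<close>
    obtain j where j: "j \<in> S" "j \<noteq> d y"
    proof -
      have "\<not> S \<subseteq> {d y}" using S2 card_mono[of "{d y}" S] by auto
      then show thesis using that by blast
    qed
    have "0 < (up j y) (d y)" using lab[OF upl[OF j(1)]] eq[OF j(1)] nz by auto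
    then show ?thesis using j eq[OF i] dS' by simp
  qed
  have dd: "d y \<in> S" if "y \<in> M" for y
  proof (cases "zero_cell P S y")
    case False then show ?thesis using d1[OF that False Sne] by blast
  qed (simp add: d_def dS)
  have pos: "0 < y (d y)" if "y \<in> M - B" for y
  proof (cases "zero_cell P S y")
    case True then show ?thesis using B[of y] that by (auto simp: d_def M_def)
  next
    case False then show ?thesis using d1[of y, OF _ False Sne] that by blast
  qed
  define g where "g y = y(d y := y (d y) - 1)" for y :: "nat \<Rightarrow> nat"
  have gl: "g y \<in> lat S n" if "y \<in> M - B" for y
    unfolding g_def using that pos[OF that] dd[of y] by (intro down_lat fin) (auto simp: M_def)
  have ug: "up (d y) (g y) = y" if "y \<in> M - B" for y
    using pos[OF that] by (auto simp: g_def fun_eq_iff)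
  have inj: "inj_on g (M - B)"
  proof (rule inj_onI)
    fix y y' assume y: "y \<in> M - B" and y': "y' \<in> M - B" and eq: "g y = g y'"
    define z where "z = g y"
    have yz: "y = up (d y) z" "y' = up (d y') z" using ug[OF y] ug[OF y'] eq by (auto simp: z_def)
    have zl: "z \<in> lat S n" using gl[OF y] by (simp add: z_def)
    have "d y = d y'"
    proof (rule ccontr)
      assume ne: "d y \<noteq> d y'"
      have comm: "up (d y') y = up (d y) y'"
      proof -
        have "up (d y') (up a z) = up a (up (d y') z)" if "a \<noteq> d y'" for a
          using that by (simp add: fun_upd_twist)
        from this[OF ne] yz show ?thesis by metis
      qed
      have yM: "y \<in> M" "y' \<in> M" using y y' by auto
      have zz: "zero_cell P S y \<longleftrightarrow> zero_cell P S y'"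
        using dM[OF yM(1)] dM[OF yM(2)] comm dd[OF yM(1)] dd[OF yM(2)] by (metis zero_cell_def)
      show False
      proof (cases "zero_cell P S y")
        case True
        then have "dir y = dir y'"
          using adj[OF zl dd[OF yM(1)] dd[OF yM(2)]] yz zz by simp
        with ne True zz show False by (simp add: d_def)
      next
        case False
        then have "d y = P (up (d y') y)" "d y' = P (up (d y) y')"
          using d1 dd yM zz by blast+
        with comm ne show False by metis
      qed
    qed
    then show "y = y'" using yz by simp
  qed
  have avoid: "g y \<notin> U" if y: "y \<in> M - B" for y
  proof
    assume gU: "g y \<in> U"
    have yM: "y \<in> M" using y by simp
    have "monochromatic P S (up (d y) (g y))" using yM by (simp only: ug[OF y]) (simp add: M_def)
    from U(2)[OF gU dd[OF yM] this]
    have "P (up (d y) y) \<noteq> d y" "zero_cell P S y \<longrightarrow> dir y \<noteq> d y"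
      unfolding ug[OF y] by blast+
    moreover have "zero_cell P S y \<Longrightarrow> dir y = d y" by (simp add: d_def)
    ultimately show False using d1[OF yM _ dd[OF yM]] by metis
  qed
  have finM: "finite M" using finite_lat[OF fin] by (simp add: M_def)
  have "card M \<le> card (M - B) + card B"
    using \<open>finite B\<close> finM
        by (metis card_Un_le card_mono finite_Un finite_Diff Un_Diff_cancel2 Un_upper1 order_trans)
  also have "card (M - B) = card (g ` (M - B))" by (simp add: card_image inj)
  also have "\<dots> \<le> card (lat S n - U)"
    using gl avoid by (intro card_mono) (auto simp: finite_lat fin)
  also have "\<dots> = card (lat S n) - card U"
    using U(1) finite_lat[OF fin] by (meson card_Diff_subset finite_subset)
  finally have "card M + card U \<le> card (lat S n) + card B"
    using card_mono[OF finite_lat[OF fin] U(1)] by linarith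
  moreover have "card (lat S (n + 1)) = card M + card {y \<in> lat S (n + 1). \<not> monochromatic P S y}"
  proof -
    have "lat S (n + 1) = M \<union> {y \<in> lat S (n + 1). \<not> monochromatic P S y}" by (auto simp: M_def)
    then show ?thesis using finite_lat[OF fin, of "n+1"] finM
      by (metis (no_types, lifting) M_def card_Un_disjoint disjoint_iff finite_Un mem_Collect_eq)
  qed
  ultimately show ?thesis by linarith
qed

section \<open>Edge weights on a triangle\<close>

definition pt :: "nat \<Rightarrow> nat \<Rightarrow> nat \<Rightarrow> nat \<Rightarrow> nat \<Rightarrow> nat \<Rightarrow> nat \<Rightarrow> nat" where
  "pt i j k a b c = (\<lambda>l. if l = i then a else if l = j then b else if l = k then c else 0)"

text \<open>The parameter \<open>t\<close> is the distance from the side opposite to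
  \<open>i\<close>; for \<open>c = 0\<close> the line is the side from corner \<open>j\<close> to
  corner \<open>i\<close>.\<close>

definition line :: "((nat \<Rightarrow> nat) \<Rightarrow> nat) \<Rightarrow> nat \<Rightarrow> nat \<Rightarrow> nat \<Rightarrow> nat \<Rightarrow> nat \<Rightarrow> nat \<Rightarrow> nat" where
  "line P i j k n c t = P (pt i j k t (n - c - t) c)"

text \<open>The edges are \<open>{y + e\<^sub>p, y + e\<^sub>q}\<close>, and the sum runs over ordered pairs: every edge is counted twice.\<close>

definition weighted_cut :: "(nat \<Rightarrow> nat \<Rightarrow> 'a::semiring_1) \<Rightarrow> nat set \<Rightarrow> nat \<Rightarrow> ((nat \<Rightarrow> nat) \<Rightarrow> nat) \<Rightarrow> 'a" where
  "weighted_cut w S n P = (\<Sum>y\<in>lat S n. \<Sum>p\<in>S. \<Sum>q\<in>S - {p}. w (y p) (y q) * of_bool (P (up p y) \<noteq> P (up q y)))"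

definition direction_cuts :: "(nat \<Rightarrow> nat \<Rightarrow> nat) \<Rightarrow> nat \<Rightarrow> ((nat \<Rightarrow> nat) \<Rightarrow> nat) \<Rightarrow> nat \<Rightarrow> nat \<Rightarrow> nat \<Rightarrow> nat" where
  "direction_cuts w n P i j k = (\<Sum>c<Suc n. \<Sum>t<Suc n - c. w t (n - c - t) *
      of_bool (line P i j k (Suc n) c t \<noteq> line P i j k (Suc n) c (Suc t)))"

text \<open>These lines cut off the corner \<open>k\<close>, not \<open>i\<close>. The weight
  \<open>2 * s\<close> at distance \<open>s\<close> matches the reward in
  \<open>half_corner_gain\<close>.\<close>

definition corner_cuts :: "nat \<Rightarrow> nat \<Rightarrow> ((nat \<Rightarrow> nat) \<Rightarrow> nat) \<Rightarrow> nat \<Rightarrow> nat \<Rightarrow> nat \<Rightarrow> nat" where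
  "corner_cuts N n P i j k = (\<Sum>s=1..N. 2 * s * cuts (line P i j k n (n - s)) s)"

lemma pt_perm:
  "i \<noteq> j \<Longrightarrow> pt j i k b a c = pt i j k a b c"
  "j \<noteq> k \<Longrightarrow> pt i k j a c b = pt i j k a b c"
  by (auto simp: pt_def fun_eq_iff)

lemma pt_cyc: "distinct [i, j, k] \<Longrightarrow> pt j k i b c a = pt i j k a b c"
  by (auto simp: pt_def fun_eq_iff)

lemma pt_apply:
  assumes "distinct [i, j, k]"
  shows "pt i j k a b c i = a" "pt i j k a b c j = b" "pt i j k a b c k = c"
  using assms by (auto simp: pt_def)

lemma pt_upd:
  assumes "distinct [i, j, k]"
  shows "(pt i j k a b c)(i := v) = pt i j k v b c" "(pt i j k a b c)(j := v) = pt i j k a v c"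
    "(pt i j k a b c)(k := v) = pt i j k a b v"
  using assms by (auto simp: pt_def fun_eq_iff)

lemma vert_pt: "distinct [i, j, k] \<Longrightarrow> vert n i = pt i j k n 0 0"
  by (auto simp: pt_def vert_def fun_eq_iff)

lemma pt_lat: "distinct [i, j, k] \<Longrightarrow> pt i j k a b c \<in> lat {i, j, k} n \<longleftrightarrow> a + b + c = n"
  by (auto simp: lat_def pt_def)

lemma lat3_eq_pt:
  assumes "x \<in> lat {i, j, k} n" "distinct [i, j, k]"
  shows "x = pt i j k (x i) (x j) (x k) \<and> x i + x j + x k = n"
  using assms by (auto simp: lat_def pt_def fun_eq_iff)

lemma sum_lat3:
  assumes "distinct [i, j, k]"
  shows "(\<Sum>y\<in>lat {i, j, k} n. g y) = (\<Sum>c<Suc n. \<Sum>t<Suc n - c. g (pt i j k t (n - c - t) c))"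
proof -
  have "(\<Sum>y\<in>lat {i, j, k} n. g y)
      = (\<Sum>(c, t)\<in>(SIGMA c:{..<Suc n}. {..<Suc n - c}). g (pt i j k t (n - c - t) c))"
  proof (rule sum.reindex_bij_witness[where i = "\<lambda>(c, t). pt i j k t (n - c - t) c" and j = "\<lambda>y. (y k, y i)"])
    fix y assume "y \<in> lat {i, j, k} n"
    from lat3_eq_pt[OF this assms] have y: "y = pt i j k (y i) (y j) (y k)" "y i + y j + y k = n" by auto
    then have "y j = n - y k - y i" by simp
    with y show "(case (y k, y i) of (c, t) \<Rightarrow> pt i j k t (n - c - t) c) = y"
      by simp
    then show "(case (y k, y i) of (c, t) \<Rightarrow> g (pt i j k t (n - c - t) c)) = g y"
      by simp
    show "(y k, y i) \<in> (SIGMA c:{..<Suc n}. {..<Suc n - c})" using y(2) by auto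
  next
    fix p assume p: "p \<in> (SIGMA c:{..<Suc n}. {..<Suc n - c})"
    then show "(case p of (c, t) \<Rightarrow> pt i j k t (n - c - t) c) \<in> lat {i, j, k} n"
      using pt_lat[OF assms] by (auto split: prod.splits)
    show "(((case p of (c, t) \<Rightarrow> pt i j k t (n - c - t) c) k), ((case p of (c, t)
        \<Rightarrow> pt i j k t (n - c - t) c) i)) = p"
      using assms by (auto simp: pt_apply split: prod.splits)
  qed
  then show ?thesis by (simp add: sum.Sigma del: sum.lessThan_Suc)
qed

lemma sum_pairs3:
  fixes T :: "nat \<Rightarrow> nat \<Rightarrow> 'a::comm_monoid_add"
  assumes "distinct [i, j, k]"
  shows "(\<Sum>p\<in>{i, j, k}. \<Sum>q\<in>{i, j, k} - {p}. T p q)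
    = T i j + T i k + (T j i + T j k + (T k i + T k j))"
proof -
  have "{i, j, k} - {i} = {j, k}" "{i, j, k} - {j} = {i, k}" "{i, j, k} - {k} = {i, j}" using assms by auto
  then show ?thesis using assms by simp
qed

text \<open>Both ends of an edge have the same third coordinate, so the edges of one direction split
  into parallel lines. The factor 2 comes from the two orders of each pair.\<close>

lemma weighted_cut_lines:
  fixes w :: "nat \<Rightarrow> nat \<Rightarrow> nat"
  assumes d: "distinct [i, j, k]" and sym: "\<And>a b. w a b = w b a"
  shows "weighted_cut w {i, j, k} n P = 2 * (direction_cuts w n P i j k + direction_cuts w n P j k i
      + direction_cuts w n P k i j)"
proof -
  let ?D = "direction_cuts w n P"
  define T where "T p q y = w (y p) (y q) * of_bool (P (up p y) \<noteq> P (up q y))" for p q and y :: "nat \<Rightarrow> nat"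
  have Tsym: "T p q y = T q p y" for p q y
    using sym[of "y p" "y q"] by (simp add: T_def eq_commute)
  have D: "(\<Sum>y\<in>lat {a, b, c} n. T a b y) = ?D a b c" if "distinct [a, b, c]" for a b c
    unfolding sum_lat3[OF that] direction_cuts_def
  proof (intro sum.cong refl, goal_cases)
    case (1 e t)
    have "Suc (n - e - t) = Suc n - e - t" "n - e - t = Suc n - e - Suc t" using 1 by auto
    then show ?case unfolding T_def line_def using that by (simp add: pt_apply pt_upd eq_commute)
  qed
  have "weighted_cut w {i, j, k} n P = (\<Sum>y\<in>lat {i, j, k} n. 2 * (T i j y + T j k y + T k i y))"
    unfolding weighted_cut_def
  proof (intro sum.cong refl)
    fix y
    show "(\<Sum>p\<in>{i, j, k}. \<Sum>q\<in>{i, j, k} - {p}. w (y p) (y q) * of_bool (P (up p y) \<noteq> P (up q y)))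
       = 2 * (T i j y + T j k y + T k i y)"
      unfolding T_def[symmetric] sum_pairs3[OF d] using Tsym[of j i y] Tsym[of k i y] Tsym[of k j y] by simp
  qed
  also have "\<dots> = 2 * ((\<Sum>y\<in>lat {i, j, k} n. T i j y) + (\<Sum>y\<in>lat {i, j, k} n. T j k y)
      + (\<Sum>y\<in>lat {i, j, k} n. T k i y))"
    by (simp add: sum.distrib sum_distrib_left)
  also have "(\<Sum>y\<in>lat {i, j, k} n. T j k y) = ?D j k i"
    using D[of j k i] d by (simp add: insert_commute)
  also have "(\<Sum>y\<in>lat {i, j, k} n. T k i y) = ?D k i j"
    using D[of k i j] d by (simp add: insert_commute)
  also have "(\<Sum>y\<in>lat {i, j, k} n. T i j y) = ?D i j k"
    using D[OF d] .
  finally show ?thesis .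
qed

text \<open>For an edge in direction \<open>i, j\<close> of the cell \<open>y\<close>, the third coordinate is recovered as \<open>n - y i - y
    j\<close>; it is 0 on the
  side \<open>ij\<close>, where \<open>y j\<close> and \<open>y i\<close> are the distances of the edge from the corners \<open>i\<close> and \<open>j\<close>.\<close>

definition line_weight :: "nat \<Rightarrow> nat \<Rightarrow> nat \<Rightarrow> nat \<Rightarrow> nat" where
  "line_weight q n a b = of_bool (n - a - b < q)"

definition side_weight :: "(nat \<Rightarrow> nat) \<Rightarrow> nat \<Rightarrow> nat \<Rightarrow> nat \<Rightarrow> nat" where
  "side_weight g n a b = of_bool (n - a - b = 0) * (g a + g b)"

text \<open>Cells have coordinate sum \<open>n\<close> but points \<open>Suc n\<close>, so the
  distance of the edge's line from its corner is \<open>Suc n - (n - a - b)\<close>.\<close>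

definition corner_weight :: "nat \<Rightarrow> nat \<Rightarrow> nat \<Rightarrow> nat \<Rightarrow> nat" where
  "corner_weight N n a b = of_bool (Suc n - N \<le> n - a - b) * (2 * (Suc n - (n - a - b)))"

lemma line_swap:
  assumes "i \<noteq> j" "t \<le> n - c"
  shows "line P j i k n c t = line P i j k n c (n - c - t)"
proof -
  have "n - c - (n - c - t) = t" using assms(2) by simp
  then show ?thesis unfolding line_def using pt_perm(1)[OF assms(1)] by simp
qed

lemma wcuts_line_swap:
  assumes "i \<noteq> j"
  shows "wcuts g (line P j i k n c) (n - c) = wcuts (\<lambda>t. g (n - c - Suc t)) (line P i j k n c) (n - c)"
  by (subst wcuts_rev) (intro wcuts_cong, auto simp: line_swap[OF assms])

definition line_cuts :: "nat \<Rightarrow> nat \<Rightarrow> ((nat \<Rightarrow> nat) \<Rightarrow> nat) \<Rightarrow> nat \<Rightarrow> nat \<Rightarrow> nat \<Rightarrow> nat" where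
  "line_cuts q n P i j k = (\<Sum>c<q. cuts (line P i j k n c) (n - c) + cuts (line P j k i n c) (n - c)
     + cuts (line P k i j n c) (n - c))"

text \<open>Both sides at the corner \<open>i\<close> are read starting from \<open>i\<close>, so
  the argument of \<open>g\<close> is the distance from this corner.\<close>

definition side_cuts_from :: "(nat \<Rightarrow> nat) \<Rightarrow> nat \<Rightarrow> ((nat \<Rightarrow> nat) \<Rightarrow> nat) \<Rightarrow> nat \<Rightarrow> nat \<Rightarrow> nat \<Rightarrow> nat" where
  "side_cuts_from g n P i j k = wcuts g (line P j i k n 0) n + wcuts g (line P k i j n 0) n"

lemma weighted_cut_line_weight:
  assumes d: "distinct [i, j, k]" and q: "q \<le> Suc n"
  shows "weighted_cut (line_weight q n) {i, j, k} n P = 2 * line_cuts q (Suc n) P i j k"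
proof -
  have *: "direction_cuts (line_weight q n) n P i j k
      = (\<Sum>c<q. cuts (line P i j k (Suc n) c) (Suc n - c))" for i j k
  proof -
    have "direction_cuts (line_weight q n) n P i j k
      = (\<Sum>c<Suc n. if c < q then cuts (line P i j k (Suc n) c) (Suc n - c) else 0)"
      unfolding direction_cuts_def
    proof (rule sum.cong[OF refl])
      fix c assume c: "c \<in> {..<Suc n}"
      have "line_weight q n t (n - c - t) = of_bool (c < q)" if "t < Suc n - c" for t
      proof -
        have "n - t - (n - c - t) = c" using that by auto
        then show ?thesis by (simp add: line_weight_def)
      qed
      then show "(\<Sum>t<Suc n - c. line_weight q n t (n - c - t) * of_bool (line P i j k (Suc n) c t
          \<noteq> line P i j k (Suc n) c (Suc t)))
        = (if c < q then cuts (line P i j k (Suc n) c) (Suc n - c) else 0)"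
        unfolding wcuts_def
            by (cases "c < q") (simp_all del: sum_mult_of_bool_eq sum_of_bool_mult_eq sum_of_bool_eq)
    qed
    also have "\<dots> = (\<Sum>c<q. cuts (line P i j k (Suc n) c) (Suc n - c))"
      using q by (subst sum.inter_filter[symmetric]) (auto intro!: sum.cong)
    finally show ?thesis .
  qed
  show ?thesis
    unfolding line_cuts_def sum.distrib
    by (subst weighted_cut_lines[OF d]) (simp_all only: *, simp add: line_weight_def add.commute)
qed

text \<open>The summands \<open>g a\<close> and \<open>g b\<close> measure from the two ends of a
  side. Reading one of them backwards lets every corner collect its own two sides.\<close>

lemma weighted_cut_side_weight:
  assumes d: "distinct [i, j, k]"
  shows "weighted_cut (side_weight g n) {i, j, k} n P
    = 2 * (side_cuts_from g (Suc n) P i j k + side_cuts_from g (Suc n) P j k i + side_cuts_from g (Suc n) P k i j)"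
proof -
  have *: "direction_cuts (side_weight g n) n P i j k
      = wcuts g (line P i j k (Suc n) 0) (Suc n) + wcuts g (line P j i k (Suc n) 0) (Suc n)" if "i \<noteq> j" for i j k
  proof -
    have "direction_cuts (side_weight g n) n P i j k
      = (\<Sum>c<Suc n. if c = 0 then wcuts (\<lambda>t. g t + g (n - t)) (line P i j k (Suc n) 0) (Suc n) else 0)"
      unfolding direction_cuts_def
    proof (rule sum.cong[OF refl])
      fix c assume c: "c \<in> {..<Suc n}"
      have "side_weight g n t (n - c - t) = of_bool (c = 0) * (g t + g (n - t))" if "t < Suc n - c" for t
      proof -
        have "n - t - (n - c - t) = c" using that by auto
        then show ?thesis by (cases "c = 0") (simp_all add: side_weight_def)
      qed
      then show "(\<Sum>t<Suc n - c. side_weight g n t (n - c - t) * of_bool (line P i j k (Suc n) c t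
          \<noteq> line P i j k (Suc n) c (Suc t)))
        = (if c = 0 then wcuts (\<lambda>t. g t + g (n - t)) (line P i j k (Suc n) 0) (Suc n) else 0)"
        unfolding wcuts_def
            by (cases "c = 0") (simp_all del: sum_mult_of_bool_eq sum_of_bool_mult_eq sum_of_bool_eq)
    qed
    also have "\<dots> = wcuts (\<lambda>t. g t + g (n - t)) (line P i j k (Suc n) 0) (Suc n)"
      by (simp add: sum.delta)
    also have "\<dots> = wcuts g (line P i j k (Suc n) 0) (Suc n)
        + wcuts (\<lambda>t. g (n - t)) (line P i j k (Suc n) 0) (Suc n)"
      unfolding wcuts_def sum.distrib[symmetric] by (intro sum.cong) (auto simp: algebra_simps)
    also have "wcuts (\<lambda>t. g (n - t)) (line P i j k (Suc n) 0) (Suc n) = wcuts g (line P j i k (Suc n) 0) (Suc n)"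
      using wcuts_line_swap[OF that, of g P k "Suc n" 0] by simp
    finally show ?thesis .
  qed
  have ne: "i \<noteq> j" "j \<noteq> k" "k \<noteq> i" using d by auto
  show ?thesis
    unfolding side_cuts_from_def
    by (subst weighted_cut_lines[OF d]) (simp_all only: *[OF ne(1)] *[OF ne(2)] *[OF ne(3)], simp_all
        add: side_weight_def diff_commute add_ac)
qed

lemma weighted_cut_corner_weight:
  assumes d: "distinct [i, j, k]" and N: "N \<le> Suc n"
  shows "weighted_cut (corner_weight N n) {i, j, k} n P
    = 2 * (corner_cuts N (Suc n) P i j k + corner_cuts N (Suc n) P j k i + corner_cuts N (Suc n) P k i j)"
proof -
  have *: "direction_cuts (corner_weight N n) n P i j k
      = corner_cuts N (Suc n) P i j k" for i j k
  proof -
    have "direction_cuts (corner_weight N n) n P i j k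
      = (\<Sum>c<Suc n. if Suc n - N \<le> c then 2 * (Suc n - c) * cuts (line P i j k (Suc n) c) (Suc n - c) else 0)"
      unfolding direction_cuts_def
    proof (rule sum.cong[OF refl])
      fix c assume c: "c \<in> {..<Suc n}"
      have "corner_weight N n t (n - c - t) = of_bool (Suc n - N \<le> c) * (2 * (Suc n - c))" if "t < Suc n - c" for t
      proof -
        have "n - t - (n - c - t) = c" using that by auto
        then show ?thesis by (simp add: corner_weight_def)
      qed
      then show "(\<Sum>t<Suc n - c. corner_weight N n t (n - c - t) * of_bool (line P i j k (Suc n) c t
          \<noteq> line P i j k (Suc n) c (Suc t)))
        = (if Suc n - N \<le> c then 2 * (Suc n - c) * cuts (line P i j k (Suc n) c) (Suc n - c) else 0)"
        unfolding wcuts_def sum_distrib_left by (cases "Suc n - N \<le> c") (auto intro!: sum.cong)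
    qed
    also have "\<dots> = (\<Sum>c\<in>{c \<in> {..<Suc n}. Suc n - N
        \<le> c}. 2 * (Suc n - c) * cuts (line P i j k (Suc n) c) (Suc n - c))"
      by (subst sum.inter_filter) auto
    also have "\<dots> = corner_cuts N (Suc n) P i j k"
      unfolding corner_cuts_def
      by (rule sum.reindex_bij_witness[where i = "\<lambda>s. Suc n - s" and j = "\<lambda>c. Suc n - c"]) (use N in auto)
    finally show ?thesis .
  qed
  show ?thesis
    by (subst weighted_cut_lines[OF d]) (simp_all only: *, simp add: corner_weight_def diff_commute add.commute)
qed

section \<open>Filling the corners of a triangle\<close>

text \<open>All zero cells are moved in direction \<open>i\<close>.  In a row \<open>y k
    = c\<close>, the last zero cell before the first cell that is not
  one yields a point that is missed by the shift.\<close>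

lemma nonmono_rows:
  assumes P: "nonopp P {i, j, k} (n + 2)" and d: "distinct [i, j, k]"
    and C: "\<And>c. c \<in> C \<Longrightarrow> \<exists>y\<in>lat {i, j, k} (n + 1). zero_cell P {i, j, k} y \<and> y k = c"
    and ends: "\<And>c. c \<in> C \<Longrightarrow> \<not> zero_cell P {i, j, k} (pt i j k (n + 1 - c) 0 c)"
  shows "n + 2 + card C \<le> card {y \<in> lat {i, j, k} (n + 1). \<not> monochromatic P {i, j, k} y}
           + card {y \<in> lat {i, j, k} (n + 1). zero_cell P {i, j, k} y \<and> y i = 0}"
proof -
  let ?R = "{i, j, k}"
  define row where "row c t = pt i j k t (n + 1 - c - t) c" for c t
  have ex: "\<exists>t. c + t \<le> n \<and> zero_cell P ?R (row c t) \<and> \<not> zero_cell P ?R (row c (Suc t))" if c: "c \<in> C" for c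
  proof -
    obtain y where y: "y \<in> lat ?R (n + 1)" "zero_cell P ?R y" "y k = c" using C[OF c] by blast
    have yp: "y = pt i j k (y i) (y j) (y k)" "y i + y j + y k = n + 1"
      using lat3_eq_pt[OF y(1) d] by auto
    have "y j = n + 1 - c - y i" using yp(2) y(3) by simp
    then have row0: "row c (y i) = y" using yp(1) y(3) by (simp add: row_def)
    have cl: "c + y i \<le> n + 1" using yp(2) y(3) by simp
    have no: "\<not> zero_cell P ?R (row c (n + 1 - c))" using ends[OF c] by (simp add: row_def)
    show ?thesis
    proof (rule ccontr)
      assume "\<not> ?thesis"
      then have step: "zero_cell P ?R (row c (Suc t))" if "c + t \<le> n" "zero_cell P ?R (row c t)" for t
        using that by blast
      have "c + y i + s \<le> n + 1 \<Longrightarrow> zero_cell P ?R (row c (y i + s))" for s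
      proof (induction s)
        case 0 then show ?case using row0 y(2) by simp
      next
        case (Suc s) then show ?case using step[of "y i + s"] by simp
      qed
      from this[of "n + 1 - c - y i"] have "zero_cell P ?R (row c (n + 1 - c))" using cl by simp
      with no show False ..
    qed
  qed
  define T where "T c = (SOME t. c + t \<le> n \<and> zero_cell P ?R (row c t) \<and> \<not> zero_cell P ?R (row c (Suc t)))" for c
  have T: "c + T c \<le> n" "zero_cell P ?R (row c (T c))" "\<not> zero_cell P ?R (row c (Suc (T c)))" if "c \<in> C" for c
    using someI_ex[OF ex[OF that]] unfolding T_def by blast+
  define z where "z c = pt i j k (T c) (n - c - T c) c" for c
  have zl: "z c \<in> lat ?R n" if "c \<in> C" for c
    using T(1)[OF that] by (simp add: z_def pt_lat[OF d])
  have zj: "up j (z c) = row c (T c)" "up i (z c) = row c (Suc (T c))" if "c \<in> C" for c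
  proof -
    have "Suc (n - c - T c) = n + 1 - c - T c" "n - c - T c = n + 1 - c - Suc (T c)" using T(1)[OF that] by auto
    then show "up j (z c) = row c (T c)" "up i (z c) = row c (Suc (T c))"
      unfolding z_def row_def using d by (simp_all only: pt_apply[OF d] pt_upd[OF d])
  qed
  have "inj_on z C"
    by (rule inj_onI) (metis z_def pt_apply(3)[OF d])
  then have cU: "card (z ` C) = card C" by (rule card_image)
  have main: "card (lat ?R (n + 1)) + card (z ` C) \<le> card {y \<in> lat ?R (n + 1). \<not> monochromatic P ?R y}
      + card (lat ?R n)
      + card {y \<in> lat ?R (n + 1). zero_cell P ?R y \<and> y i = 0}"
  proof (rule nonmono_count[where dir = "\<lambda>_. i"])
    show "P (up p (up p u)) \<noteq> p \<and> (zero_cell P ?R (up p u) \<longrightarrow> i \<noteq> p)"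
      if u: "u \<in> z ` C" and p: "p \<in> ?R" and m: "monochromatic P ?R (up p u)" for u p
    proof -
      obtain c where c: "c \<in> C" "u = z c" using u by blast
      have zm: "zero_cell P ?R (up j u)" using T(2) zj(1) c by simp
      \<comment> \<open>The zero cell \<open>up j u\<close> shares this vertex with
        \<open>up p u\<close>. Hence \<open>up p u\<close>, being monochromatic, is a zero cell as
        well, whereas \<open>up i u\<close> is not; so \<open>p \<noteq> i\<close>.\<close>
      have "P (up p (up j u)) = 0" using zm p by (simp only: zero_cell_def)
      moreover have "up p (up j u) = up j (up p u)" by (cases "p = j") (auto simp: fun_upd_twist)
      moreover have "P (up p (up p u)) = P (up j (up p u))" using m p by (auto simp: monochromatic_def)
      moreover have "p \<noteq> 0" using P p by (auto simp: nonopp_def)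
      ultimately show ?thesis using T(3) zj(2) c by auto
    qed
  qed (use P d zl finite_lat in auto)
  have "card (lat ?R (n + 1)) = card (lat ?R n) + card (lat {j, k} (Suc n))"
    using d by (simp add: card_lat_Suc)
  also have "card (lat {j, k} (Suc n)) = n + 2" using d by (simp add: card_lat2)
  finally show ?thesis using main cU by linarith
qed

definition filled :: "nat \<Rightarrow> ((nat \<Rightarrow> nat) \<Rightarrow> nat) \<Rightarrow> nat set \<Rightarrow> nat \<Rightarrow> bool" where
  "filled q P S n \<longleftrightarrow> (\<forall>x\<in>lat S n. \<forall>i\<in>S. q \<le> x i \<longrightarrow> P x = i)"

lemma filled_not_zero_cell:
  assumes "filled q P S (Suc n)" "0 \<notin> S" "finite S" "y \<in> lat S n" "i \<in> S" "q \<le> Suc (y i)"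
  shows "\<not> zero_cell P S y"
proof
  assume "zero_cell P S y"
  then have "P (up i y) = 0" using assms by (simp add: zero_cell_def)
  moreover have "P (up i y) = i" using assms up_lat[of y S n i] by (auto simp: filled_def)
  ultimately show False using assms by auto
qed

text \<open>If all rows \<open>y c
    = r\<close> with \<open>r < m\<close> contain a zero cell, these rows make up for the at most \<open>m\<close> zero cells on a side.
  Otherwise rows without zero cells, one in each direction, separate the zero cells into classes that
      avoid a side.\<close>

lemma nonmono_filled:
  assumes P: "nonopp P {i, j, k} (3 * m)" and d: "distinct [i, j, k]" and m: "1 \<le> m"
    and fl: "filled (2 * m) P {i, j, k} (3 * m)"
  shows "3 * m \<le> card {y \<in> lat {i, j, k} (3 * m - 1). \<not> monochromatic P {i, j, k} y}"
proof -
  let ?R = "{i, j, k}"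
  define n where "n = 3 * m - 2"
  have n: "3 * m = n + 2" "3 * m - 1 = n + 1" using m by (auto simp: n_def)
  have R0: "0 \<notin> ?R" using P unfolding nonopp_def by blast
  have P': "nonopp P ?R (n + 2)" using P n by simp
  have fl': "filled (2 * m) P ?R (Suc (n + 1))" using fl n by simp
  have nz: "\<not> zero_cell P ?R y" if "y \<in> lat ?R (n + 1)" "p \<in> ?R" "2 * m \<le> Suc (y p)" for y p
    using filled_not_zero_cell[OF fl' R0 _ that(1,2,3)] by simp
  define Z where "Z = {y \<in> lat ?R (n + 1). zero_cell P ?R y}"
  have A: "n + 2 \<le> card {y \<in> lat ?R (n + 1). \<not> monochromatic P ?R y}"
    if dd: "distinct [a, b, c]" and R: "?R = {a, b, c}" and rows: "\<forall>r<m. \<exists>y\<in>Z. y c = r" for a b c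
  proof -
    have "n + 2 + card {..<m} \<le> card {y \<in> lat {a, b, c} (n + 1). \<not> monochromatic P {a, b, c} y}
           + card {y \<in> lat {a, b, c} (n + 1). zero_cell P {a, b, c} y \<and> y a = 0}"
    proof (rule nonmono_rows[OF _ dd])
      fix r assume r: "r \<in> {..<m}"
      show "\<not> zero_cell P {a, b, c} (pt a b c (n + 1 - r) 0 r)"
        unfolding R[symmetric]
      proof (rule nz)
        show "pt a b c (n + 1 - r) 0 r \<in> lat ?R (n + 1)" using r n pt_lat[OF dd] unfolding R by auto
        show "a \<in> ?R" unfolding R by simp
        show "2 * m \<le> Suc (pt a b c (n + 1 - r) 0 r a)" using r n by (simp add: pt_apply[OF dd])
      qed
    qed (use P' rows R Z_def in auto)
    \<comment> \<open>On this side the other two coordinates are both below \<open>2 * m - 1\<close>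
      and add up to \<open>3 * m - 1\<close>, which leaves at most \<open>m\<close> cells.\<close>
    moreover have "card {y \<in> lat {a, b, c} (n + 1). zero_cell P {a, b, c} y \<and> y a = 0} \<le> card {m..<2*m}"
    proof (rule card_inj_on_le[of "\<lambda>y. y b"])
      show "inj_on (\<lambda>y. y b) {y \<in> lat {a, b, c} (n + 1). zero_cell P {a, b, c} y \<and> y a = 0}"
      proof (rule inj_onI)
        fix x y assume "x \<in> {y \<in> lat {a, b, c} (n + 1). zero_cell P {a, b, c} y \<and> y a = 0}"
          "y \<in> {y \<in> lat {a, b, c} (n + 1). zero_cell P {a, b, c} y \<and> y a = 0}" "x b = y b"
        then have xy: "x \<in> lat {a, b, c} (n + 1)" "y \<in> lat {a, b, c} (n + 1)" "x a = 0" "y a = 0" "x b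
            = y b" by auto
        with lat3_eq_pt[OF xy(1) dd] lat3_eq_pt[OF xy(2) dd] have "x c = y c" by linarith
        with xy lat3_eq_pt[OF xy(1) dd] lat3_eq_pt[OF xy(2) dd] show "x = y" by metis
      qed
      show "(\<lambda>y. y b) ` {y \<in> lat {a, b, c} (n + 1). zero_cell P {a, b, c} y \<and> y a = 0} \<subseteq> {m..<2 * m}"
      proof
        fix t assume "t \<in> (\<lambda>y. y b) ` {y \<in> lat {a, b, c} (n + 1). zero_cell P {a, b, c} y \<and> y a = 0}"
        then obtain y where y: "y \<in> lat ?R (n + 1)" "zero_cell P ?R y" "y a = 0" "t = y b" using R by auto
        have "\<not> 2 * m \<le> Suc (y b)" using nz[OF y(1), of b] y(2) R by blast
        moreover have "\<not> 2 * m \<le> Suc (y c)" using nz[OF y(1), of c] y(2) R by blast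
        moreover have "y a + y b + y c = n + 1" using lat3_eq_pt[OF _ dd, of y] y(1) R by simp
        ultimately show "t \<in> {m..<2 * m}" using y n by auto
      qed
    qed simp
    ultimately show ?thesis by (simp add: R)
  qed
  show ?thesis
  proof (cases "(\<forall>r<m. \<exists>y\<in>Z. y i = r) \<or> (\<forall>r<m. \<exists>y\<in>Z. y j = r) \<or> (\<forall>r<m. \<exists>y\<in>Z. y k = r)")
    case True
    then show ?thesis
      using A[of j k i] A[of k i j] A[of i j k] d n by (auto simp: insert_commute)
  next
    case False
    then obtain ri rj rk where r: "ri < m" "rj < m" "rk < m"
      and no: "\<And>y. y \<in> Z \<Longrightarrow> y i \<noteq> ri \<and> y j \<noteq> rj \<and> y k \<noteq> rk" by metis
    \<comment> \<open>Coordinates of touching zero cells differ by at most 1 and never equal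
      \<open>ri\<close> or \<open>rj\<close>, so they stay on the same side of these values and
      \<open>dir\<close> agrees. If \<open>i\<close> and \<open>j\<close> are both rejected, then
      \<open>y i\<close> and \<open>y j\<close> are below \<open>m\<close>, which forces
      \<open>0 < y k\<close>.\<close>
    define dir where "dir y = (if ri < y i then i else if rj < y j then j else k)" for y
    have "card (lat ?R (n + 1)) + card ({} :: (nat \<Rightarrow> nat) set)
        \<le> card {y \<in> lat ?R (n + 1). \<not> monochromatic P ?R y} + card (lat ?R n) + card ({} :: (nat \<Rightarrow> nat) set)"
    proof (rule nonmono_count[where dir = dir])
      show "y \<in> {}" if y: "y \<in> lat ?R (n + 1)" "zero_cell P ?R y" "y (dir y) = 0" for y
      proof -
        have "y i + y j + y k = n + 1" using lat3_eq_pt[OF y(1) d] by simp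
        then show ?thesis using y(3) r n by (auto simp: dir_def split: if_splits)
      qed
      show "dir (up p z) = dir (up q z)"
        if z: "z \<in> lat ?R n" "p \<in> ?R" "q \<in> ?R" "zero_cell P ?R (up p z)" "zero_cell P ?R (up q z)" for z p q
      proof -
        have near: "z l \<le> up r z l \<and> up r z l \<le> Suc (z l)" for l r by simp
        have "up p z \<in> Z" "up q z \<in> Z" using z up_lat[OF z(1)] by (auto simp: Z_def)
        from no[OF this(1)] no[OF this(2)]
        have "ri < up p z i \<longleftrightarrow> ri < up q z i" "rj < up p z j \<longleftrightarrow> rj < up q z j"
          using near[where l = i and r = p] near[where l = i and r = q]
            near[where l = j and r = p] near[where l = j and r = q] by linarith+
        then show ?thesis by (simp only: dir_def)
      qed
      show "dir y \<in> ?R" for y by (simp add: dir_def)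
    qed (use P' d in auto)
    moreover have "card (lat ?R (n + 1)) = card (lat ?R n) + card (lat {j, k} (Suc n))"
      using d by (simp add: card_lat_Suc)
    moreover have "card (lat {j, k} (Suc n)) = n + 2" using d by (simp add: card_lat2)
    ultimately show ?thesis using n by simp
  qed
qed

section \<open>Relabelling the corner triangles\<close>

definition fill :: "nat \<Rightarrow> nat \<Rightarrow> ((nat \<Rightarrow> nat) \<Rightarrow> nat) \<Rightarrow> (nat \<Rightarrow> nat) \<Rightarrow> nat" where
  "fill q i P x = (if q \<le> x i then i else P x)"

text \<open>On each line that leaves the corner triangle at a point of the side not labelled \<open>i\<close>, filling may
    create one new cut.
  The number of such lines is at most the weight \<open>m - t\<close> of the first cut edge on this side.\<close>

lemma fill_lines:
  assumes d: "distinct [i, a, b]" and m: "1 \<le> m" and Pi: "P (vert (3 * m) i) = i"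
  shows "(\<Sum>c<2*m. cuts (line (fill (2 * m) i P) i a b (3 * m) c) (3 * m - c))
     \<le> (\<Sum>c<2*m. cuts (line P i a b (3 * m) c) (3 * m - c)) + wcuts (\<lambda>t. m - t) (line P b i a (3 * m) 0) (3 * m)"
proof -
  let ?q = "2 * m" and ?n = "3 * m"
  have dd: "distinct [b, i, a]" using d by auto
  \<comment> \<open>The line \<open>x b = c\<close> ends on the side between \<open>i\<close> and
    \<open>b\<close>, at distance \<open>c\<close> from the corner \<open>i\<close>.\<close>
  have e: "line P i a b ?n c (?n - c) = line P b i a ?n 0 c" for c
    using pt_cyc[OF dd, of "?n - c" 0 c] by (simp add: line_def)
  have l: "line (fill ?q i P) i a b ?n c = (\<lambda>t. if ?q \<le> t then i else line P i a b ?n c t)" for c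
    by (auto simp: fun_eq_iff line_def fill_def pt_apply[OF d])
  \<comment> \<open>This line has length \<open>3 * m - c\<close> and therefore meets the corner
    triangle \<open>2 * m \<le> x i\<close> only for \<open>c \<le> m\<close>.\<close>
  have "cuts (line (fill ?q i P) i a b ?n c) (?n - c)
      \<le> cuts (line P i a b ?n c) (?n - c) + of_bool (c \<le> m \<and> line P b i a ?n 0 c \<noteq> i)" for c
  proof (cases "c \<le> m")
    case True
    then show ?thesis using cuts_fill[of ?q "?n - c" i "line P i a b ?n c"] m unfolding l e by simp
  next
    case False
    then have "cuts (line (fill ?q i P) i a b ?n c) (?n - c) = cuts (line P i a b ?n c) (?n - c)"
    proof (intro wcuts_cong)
      fix t assume "t \<le> ?n - c"
      with False m have "t < ?q" by linarith
      then show "line (fill ?q i P) i a b ?n c t = line P i a b ?n c t" by (simp add: l)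
    qed simp
    then show ?thesis by simp
  qed
  then have "(\<Sum>c<?q. cuts (line (fill ?q i P) i a b ?n c) (?n - c))
     \<le> (\<Sum>c<?q. cuts (line P i a b ?n c) (?n - c) + of_bool (c \<le> m \<and> line P b i a ?n 0 c \<noteq> i))"
    by (intro sum_mono)
  also have "\<dots> = (\<Sum>c<?q. cuts (line P i a b ?n c) (?n - c)) + card ({..<?q} \<inter> {c. c \<le> m
      \<and> line P b i a ?n 0 c \<noteq> i})"
    by (simp add: sum.distrib)
  also have "card ({..<?q} \<inter> {c. c \<le> m \<and> line P b i a ?n 0 c \<noteq> i}) \<le> card {c. c \<le> m \<and> line P b i a ?n 0 c \<noteq> i}"
    by (intro card_mono) auto
  also have "\<dots> \<le> wcuts (\<lambda>t. m - t) (line P b i a ?n 0) ?n"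
  proof (rule card_changed_le_wcuts)
    show "line P b i a ?n 0 0 = i"
      using Pi vert_pt[of i a b ?n] d pt_cyc[OF dd, of ?n 0 0] by (simp add: line_def)
  qed simp
  finally show ?thesis by simp
qed

text \<open>Lines with constant \<open>x i < 2 * m\<close> miss the corner triangle. The two other
  families enter it once, and \<open>fill_lines\<close> charges each to the side on which its lines
  end.\<close>

lemma fill_line_cuts:
  assumes d: "distinct [i, j, k]" and m: "1 \<le> m" and Pi: "P (vert (3 * m) i) = i"
  shows "line_cuts (2 * m) (3 * m) (fill (2 * m) i P) i j k
     \<le> line_cuts (2 * m) (3 * m) P i j k + side_cuts_from (\<lambda>t. m - t) (3 * m) P i j k"
proof -
  let ?q = "2 * m" and ?n = "3 * m"
  have 1: "cuts (line (fill ?q i P) j k i ?n c) (?n - c) = cuts (line P j k i ?n c) (?n - c)" if "c < ?q" for c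
    using that d by (intro wcuts_cong) (auto simp: line_def fill_def pt_def)
  have 2: "cuts (line P' k i j ?n c) (?n - c) = cuts (line P' i k j ?n c) (?n - c)" for P' c
    using d by (subst wcuts_line_swap) auto
  have d': "distinct [i, k, j]" using d by auto
  have "line_cuts ?q ?n (fill ?q i P) i j k = (\<Sum>c<?q. cuts (line (fill ?q i P) i j k ?n c) (?n - c))
     + (\<Sum>c<?q. cuts (line P j k i ?n c) (?n - c)) + (\<Sum>c<?q. cuts (line (fill ?q i P) i k j ?n c) (?n - c))"
    unfolding line_cuts_def sum.distrib 2 using 1 by simp
  also have "\<dots> \<le> line_cuts ?q ?n P i j k + side_cuts_from (\<lambda>t. m - t) ?n P i j k"
    unfolding line_cuts_def sum.distrib 2 side_cuts_from_def
    using fill_lines[OF d m, of P, OF Pi] fill_lines[OF d' m, of P, OF Pi] by linarith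
  finally show ?thesis .
qed

text \<open>The weight \<open>m - t\<close> only sees points within distance \<open>m\<close> of the
  corner \<open>i\<close>; their other coordinates are below \<open>2 * m\<close>, so filling
  another corner leaves them alone.\<close>

lemma side_cuts_from_fill:
  assumes d: "distinct [i, j, k]" and m: "1 \<le> m" and a: "a \<in> {j, k}"
  shows "side_cuts_from (\<lambda>t. m - t) (3 * m) (fill (2 * m) a P) i j k = side_cuts_from (\<lambda>t. m - t) (3 * m) P i j k"
proof -
  have "wcuts (\<lambda>t. m - t) (line (fill (2 * m) a P) b i c (3 * m) 0) (3 * m)
      = wcuts (\<lambda>t. m - t) (line P b i c (3 * m) 0) (3 * m)" if b: "b \<noteq> i" for b c
    unfolding wcuts_def
  proof (intro sum.cong refl)
    fix t assume "t \<in> {..<3 * m}"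
    have "line (fill (2 * m) a P) b i c (3 * m) 0 t = line P b i c (3 * m) 0 t" if "t \<le> m" for t
      using that a d m b by (auto simp: line_def fill_def pt_def)
    from this[of t] this[of "Suc t"]
    show "(m - t) * of_bool (line (fill (2 * m) a P) b i c (3 * m) 0 t
        \<noteq> line (fill (2 * m) a P) b i c (3 * m) 0 (Suc t))
      = (m - t) * of_bool (line P b i c (3 * m) 0 t \<noteq> line P b i c (3 * m) 0 (Suc t))"
      by (cases "t < m") auto
  qed
  then show ?thesis using d by (simp add: side_cuts_from_def)
qed

definition fill3 :: "nat \<Rightarrow> nat \<Rightarrow> nat \<Rightarrow> nat \<Rightarrow> ((nat \<Rightarrow> nat) \<Rightarrow> nat) \<Rightarrow> (nat \<Rightarrow> nat) \<Rightarrow> nat" where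
  "fill3 q i j k P = fill q i (fill q j (fill q k P))"

lemma line_cuts_cyc: "line_cuts q n P j k i = line_cuts q n P i j k"
  by (simp add: line_cuts_def add_ac)

lemma vert_fill: "1 \<le> m \<Longrightarrow> i \<noteq> a \<Longrightarrow> fill (2 * m) a P (vert n i) = P (vert n i)"
  by (simp add: fill_def vert_def)

text \<open>The corners are filled one after the other. Each pays with the side cuts near itself,
  which by \<open>side_cuts_from_fill\<close> the earlier fillings have not altered.\<close>

lemma fill3_line_cuts:
  assumes d: "distinct [i, j, k]" and m: "1 \<le> m" and P: "nonopp P {i, j, k} (3 * m)"
  shows "line_cuts (2 * m) (3 * m) (fill3 (2 * m) i j k P) i j k \<le> line_cuts (2 * m) (3 * m) P i j k
    + side_cuts_from (\<lambda>t. m - t) (3 * m) P i j k + side_cuts_from (\<lambda>t. m - t) (3 * m) P j k i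
        + side_cuts_from (\<lambda>t. m - t) (3 * m) P k i j"
proof -
  have Pv: "P (vert (3 * m) i) = i" "P (vert (3 * m) j) = j" "P (vert (3 * m) k) = k"
    using P by (auto simp: nonopp_def)
  have d1: "distinct [j, k, i]" "distinct [k, i, j]" using d by auto
  let ?P1 = "fill (2 * m) k P" and ?P2 = "fill (2 * m) j (fill (2 * m) k P)"
  have "line_cuts (2 * m) (3 * m) (fill (2 * m) i ?P2) i j k \<le> line_cuts (2 * m) (3 * m) ?P2 i j k
      + side_cuts_from (\<lambda>t. m - t) (3 * m) ?P2 i j k"
    using d m Pv by (intro fill_line_cuts) (auto simp: vert_fill)
  moreover have "side_cuts_from (\<lambda>t. m - t) (3 * m) ?P2 i j k = side_cuts_from (\<lambda>t. m - t) (3 * m) P i j k"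
    using side_cuts_from_fill[OF d m] by simp
  moreover have "line_cuts (2 * m) (3 * m) ?P2 j k i \<le> line_cuts (2 * m) (3 * m) ?P1 j k i
      + side_cuts_from (\<lambda>t. m - t) (3 * m) ?P1 j k i"
    using d1 m Pv d by (intro fill_line_cuts) (auto simp: vert_fill)
  moreover have "side_cuts_from (\<lambda>t. m - t) (3 * m) ?P1 j k i = side_cuts_from (\<lambda>t. m - t) (3 * m) P j k i"
    using side_cuts_from_fill[OF d1(1) m] by simp
  moreover have "line_cuts (2 * m) (3 * m) ?P1 k i j \<le> line_cuts (2 * m) (3 * m) P k i j
      + side_cuts_from (\<lambda>t. m - t) (3 * m) P k i j"
    using d1 m Pv by (intro fill_line_cuts) auto
  ultimately show ?thesis
    unfolding fill3_def using line_cuts_cyc[of "2*m" "3*m" _ j k i] line_cuts_cyc[of "2*m" "3*m" _ k i j] by simp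
qed

lemma fill3_eq:
  assumes "x \<in> lat {i, j, k} (3 * m)" "distinct [i, j, k]" "1 \<le> m"
  shows "2 * m \<le> x i \<Longrightarrow> fill3 (2 * m) i j k P x = i" "2 * m \<le> x j \<Longrightarrow> fill3 (2 * m) i j k P x = j"
    "2 * m \<le> x k \<Longrightarrow> fill3 (2 * m) i j k P x = k"
    "x i < 2 * m \<Longrightarrow> x j < 2 * m \<Longrightarrow> x k < 2 * m \<Longrightarrow> fill3 (2 * m) i j k P x = P x"
  using lat3_eq_pt[OF assms(1,2)] assms(3) by (auto simp: fill3_def fill_def)

lemma fill3_filled:
  assumes "distinct [i, j, k]" "1 \<le> m"
  shows "filled (2 * m) (fill3 (2 * m) i j k P) {i, j, k} (3 * m)"
  unfolding filled_def using fill3_eq[OF _ assms] by blast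

lemma fill3_zero:
  assumes "x \<in> lat {i, j, k} (3 * m)" "distinct [i, j, k]" "1 \<le> m" "fill3 (2 * m) i j k P x = 0" "0 \<notin> {i, j, k}"
  shows "P x = 0 \<and> x i < 2 * m \<and> x j < 2 * m \<and> x k < 2 * m"
  using fill3_eq[OF assms(1-3), of P] assms(4,5) by (metis insertI1 insertI2 not_le)

lemma fill3_nonopp:
  assumes d: "distinct [i, j, k]" and m: "1 \<le> m" and P: "nonopp P {i, j, k} (3 * m)"
  shows "nonopp (fill3 (2 * m) i j k P) {i, j, k} (3 * m)"
proof -
  let ?Q = "fill3 (2 * m) i j k P"
  have "?Q x = 0 \<or> ?Q x \<in> {i, j, k} \<and> 0 < x (?Q x)" if x: "x \<in> lat {i, j, k} (3 * m)" for x
  proof (cases "x i < 2 * m \<and> x j < 2 * m \<and> x k < 2 * m")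
    case True
    then show ?thesis using fill3_eq(4)[OF x d m] P x by (auto simp: nonopp_def)
  next
    case False
    then consider "2 * m \<le> x i" | "2 * m \<le> x j" | "2 * m \<le> x k" by linarith
    then show ?thesis
      using m by cases (simp_all add: fill3_eq[OF x d m])
  qed
  moreover have "?Q (vert (3 * m) p) = p" if "p \<in> {i, j, k}" for p
  proof -
    have "vert (3 * m) p \<in> lat {i, j, k} (3 * m)" using that by (intro vert_lat) auto
    from fill3_eq(1-3)[OF this d m, of P] that show ?thesis by (auto simp: vert_def)
  qed
  ultimately show ?thesis using P unfolding nonopp_def by blast
qed

text \<open>A cell with a coordinate of at least \<open>2 * m\<close> is monochromatic in a filled
  labelling. So all three edges of any other-coloured cell have line weight 1, and at least two of
  them are cut, each counted in both orders.\<close>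

lemma fill3_nonmono_cost:
  assumes d: "distinct [i, j, k]" and m: "1 \<le> m" and P: "filled (2 * m) P {i, j, k} (3 * m)"
  shows "4 * card {y \<in> lat {i, j, k} (3 * m - 1). \<not> monochromatic P {i, j, k} y}
    \<le> weighted_cut (line_weight (2 * m) (3 * m - 1)) {i, j, k} (3 * m - 1) P"
proof -
  let ?R = "{i, j, k}" and ?n = "3 * m - 1"
  define f where "f y = (\<Sum>p\<in>?R. \<Sum>q\<in>?R - {p}. line_weight (2 * m) ?n (y p) (y q) * of_bool (P (up p y)
      \<noteq> P (up q y)))" for y
  have "4 \<le> f y" if y: "y \<in> lat ?R ?n" "\<not> monochromatic P ?R y" for y
  proof -
    have s: "y i + y j + y k = ?n" using lat3_eq_pt[OF y(1) d] by simp
    have lt: "y p < 2 * m" if p: "p \<in> ?R" for p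
    proof (rule ccontr)
      assume "\<not> ?thesis"
      then have "P (up q y) = p" if "q \<in> ?R" for q
      proof -
        have "up q y \<in> lat ?R (3 * m)" using up_lat[OF y(1) _ that] m by simp
        moreover have "2 * m \<le> up q y p" using \<open>\<not> y p < 2 * m\<close> by (cases "p = q") simp_all
        ultimately show ?thesis using P p unfolding filled_def by blast
      qed
      with y(2) show False by (auto simp: monochromatic_def)
    qed
    have w: "line_weight (2 * m) ?n (y i) (y j) = 1" "line_weight (2 * m) ?n (y j) (y i) = 1"
        "line_weight (2 * m) ?n (y i) (y k) = 1"
      "line_weight (2 * m) ?n (y k) (y i) = 1" "line_weight (2 * m) ?n (y j) (y k) = 1"
          "line_weight (2 * m) ?n (y k) (y j) = 1"
      using lt[of i] lt[of j] lt[of k] s by (auto simp: line_weight_def)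
    have "P (up i y) \<noteq> P (up j y) \<or> P (up i y) \<noteq> P (up k y)"
      using y(2) by (auto simp: monochromatic_def)
    then show ?thesis unfolding f_def sum_pairs3[OF d] w by (auto simp: of_bool_def)
  qed
  then have "4 * card {y \<in> lat ?R ?n. \<not> monochromatic P ?R y} \<le> (\<Sum>y\<in>{y \<in> lat ?R ?n. \<not> monochromatic P ?R y}. f y)"
    using sum_bounded_below[of "{y \<in> lat ?R ?n. \<not> monochromatic P ?R y}" 4 f] by (simp add: mult.commute)
  also have "\<dots> \<le> (\<Sum>y\<in>lat ?R ?n. f y)"
    by (intro sum_mono2) (auto simp: finite_lat)
  finally show ?thesis by (simp add: weighted_cut_def f_def)
qed

section \<open>Zero cells and free sides\<close>

lemma card_Un4_le: "card (A \<union> (B \<union> (C \<union> D))) \<le> card A + (card B + (card C + card D))"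
  using card_Un_le[of A "B \<union> (C \<union> D)"] card_Un_le[of B "C \<union> D"] card_Un_le[of C D] by linarith

lemma card_lat_shift:
  assumes "finite S" "p \<in> S"
  shows "card {y \<in> lat S (n + a). a \<le> y p} = card (lat S n)"
proof (rule bij_betw_same_card[symmetric])
  show "bij_betw (\<lambda>y. y(p := y p + a)) (lat S n) {y \<in> lat S (n + a). a \<le> y p}"
  proof (rule bij_betwI[where g = "\<lambda>y. y(p := y p - a)"])
    show "(\<lambda>y. y(p := y p + a)) \<in> lat S n \<rightarrow> {y \<in> lat S (n + a). a \<le> y p}"
    proof
      fix y assume "y \<in> lat S n"
      then show "y(p := y p + a) \<in> {y \<in> lat S (n + a). a \<le> y p}"
        using sum_upd[OF assms, of y "y p + a"] assms by (auto simp: lat_def)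
    qed
    show "(\<lambda>y. y(p := y p - a)) \<in> {y \<in> lat S (n + a). a \<le> y p} \<rightarrow> lat S n"
    proof
      fix y assume "y \<in> {y \<in> lat S (n + a). a \<le> y p}"
      then show "y(p := y p - a) \<in> lat S n"
        using sum_upd[OF assms, of y "y p - a"] assms by (auto simp: lat_def)
    qed
  qed (auto simp: fun_eq_iff)
qed

lemma card_row_le:
  assumes d: "distinct [i, j, k]" and "finite H"
  shows "card {y \<in> lat {i, j, k} n. y k \<in> H} \<le> Suc n * card H"
proof -
  have "card {y \<in> lat {i, j, k} n. y k \<in> H} \<le> card (H \<times> {..n})"
  proof (rule card_inj_on_le[of "\<lambda>y. (y k, y i)"])
    show "inj_on (\<lambda>y. (y k, y i)) {y \<in> lat {i, j, k} n. y k \<in> H}"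
    proof (rule inj_onI)
      fix x y assume "x \<in> {y \<in> lat {i, j, k} n. y k \<in> H}" "y \<in> {y \<in> lat {i, j, k} n. y k \<in> H}"
          "(x k, x i) = (y k, y i)"
      then have xy: "x \<in> lat {i, j, k} n" "y \<in> lat {i, j, k} n" "x k = y k" "x i = y i" by auto
      with lat3_eq_pt[OF xy(1) d] lat3_eq_pt[OF xy(2) d] have "x j = y j" by linarith
      with xy lat3_eq_pt[OF xy(1) d] lat3_eq_pt[OF xy(2) d] show "x = y" by metis
    qed
    show "(\<lambda>y. (y k, y i)) ` {y \<in> lat {i, j, k} n. y k \<in> H} \<subseteq> H \<times> {..n}"
      using lat_le[of _ "{i, j, k}" n i] by auto
  qed (use assms in simp)
  then show ?thesis using assms by (simp add: card_cartesian_product mult.commute)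
qed

definition side_free :: "((nat \<Rightarrow> nat) \<Rightarrow> nat) \<Rightarrow> nat set \<Rightarrow> nat \<Rightarrow> nat \<Rightarrow> bool" where
  "side_free P S n i \<longleftrightarrow> (\<forall>x\<in>lat S n. x i = 0 \<longrightarrow> P x \<noteq> 0)"

lemma side_free_not_zero_cell:
  assumes "side_free P {i, j, k} (Suc n) p" "distinct [i, j, k]" "y \<in> lat {i, j, k} n" "y p = 0" "p \<in> {i, j, k}"
  shows "\<not> zero_cell P {i, j, k} y"
proof
  assume z: "zero_cell P {i, j, k} y"
  obtain r where r: "r \<in> {i, j, k}" "r \<noteq> p" using assms(2) by auto
  then have "up r y \<in> lat {i, j, k} (Suc n)" using up_lat[OF assms(3)] by simp
  with assms(1,4) r z show False by (auto simp: side_free_def zero_cell_def)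
qed

lemma side_free_fill3:
  assumes "distinct [i, j, k]" "1 \<le> m" "0 \<notin> {i, j, k}" "side_free P {i, j, k} (3 * m) p"
  shows "side_free (fill3 (2 * m) i j k P) {i, j, k} (3 * m) p"
  using assms(4) fill3_zero[OF _ assms(1,2) _ assms(3)] unfolding side_free_def by blast

text \<open>Zero cells are shifted in direction \<open>i\<close>. None is stuck because the side
  \<open>y i = 0\<close> is free, and each row ends at the other free side in a cell that is not
  zero. So every row with a zero cell is a pure gain in \<open>nonmono_rows\<close>.\<close>

lemma nonmono_two_free_sides:
  assumes P: "nonopp P {i, j, k} (3 * m)" and d: "distinct [i, j, k]" and m: "1 \<le> m"
    and free: "side_free P {i, j, k} (3 * m) i" "side_free P {i, j, k} (3 * m) j"
  shows "3 * m + card ((\<lambda>y. y k) ` {y \<in> lat {i, j, k} (3 * m - 1). zero_cell P {i, j, k} y})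
    \<le> card {y \<in> lat {i, j, k} (3 * m - 1). \<not> monochromatic P {i, j, k} y}"
proof -
  define n where "n = 3 * m - 2"
  have n: "3 * m = n + 2" "3 * m - 1 = n + 1" using m by (auto simp: n_def)
  let ?C = "(\<lambda>y. y k) ` {y \<in> lat {i, j, k} (n + 1). zero_cell P {i, j, k} y}"
  have free': "side_free P {i, j, k} (Suc (n + 1)) i" "side_free P {i, j, k} (Suc (n + 1)) j"
      using free n by simp_all
  have "{y \<in> lat {i, j, k} (n + 1). zero_cell P {i, j, k} y \<and> y i = 0} = {}"
    using side_free_not_zero_cell[OF free'(1) d] by auto
  then have "card {y \<in> lat {i, j, k} (n + 1). zero_cell P {i, j, k} y \<and> y i = 0} = 0" by (simp only: card.empty)
  moreover have "n + 2 + card ?C \<le> card {y \<in> lat {i, j, k} (n + 1). \<not> monochromatic P {i, j, k} y}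
           + card {y \<in> lat {i, j, k} (n + 1). zero_cell P {i, j, k} y \<and> y i = 0}"
  proof (rule nonmono_rows[OF _ d])
    show "\<not> zero_cell P {i, j, k} (pt i j k (n + 1 - c) 0 c)" if "c \<in> ?C" for c
    proof (rule side_free_not_zero_cell[OF free'(2) d])
      show "pt i j k (n + 1 - c) 0 c \<in> lat {i, j, k} (n + 1)"
        using that lat_le[of _ "{i, j, k}" "n + 1" k] by (auto simp: pt_lat[OF d])
    qed (use d in \<open>auto simp: pt_apply\<close>)
  qed (use P n in auto)
  ultimately show ?thesis unfolding n(2) unfolding n(1) by linarith
qed

text \<open>Now the row \<open>y k = c\<close> has to end in the filled corner of \<open>i\<close>.
  This needs \<open>c < m\<close>, for then its last cell has
  \<open>y i = 3 * m - 1 - c \<ge> 2 * m\<close>.\<close>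

lemma nonmono_one_free_side:
  assumes P: "nonopp P {i, j, k} (3 * m)" and d: "distinct [i, j, k]" and m: "1 \<le> m"
    and fl: "filled (2 * m) P {i, j, k} (3 * m)" and free: "side_free P {i, j, k} (3 * m) i"
  shows "3 * m + card ((\<lambda>y. y k) ` {y \<in> lat {i, j, k} (3 * m - 1). zero_cell P {i, j, k} y \<and> y k < m})
    \<le> card {y \<in> lat {i, j, k} (3 * m - 1). \<not> monochromatic P {i, j, k} y}"
proof -
  define n where "n = 3 * m - 2"
  have n: "3 * m = n + 2" "3 * m - 1 = n + 1" using m by (auto simp: n_def)
  let ?C = "(\<lambda>y. y k) ` {y \<in> lat {i, j, k} (n + 1). zero_cell P {i, j, k} y \<and> y k < m}"
  have free': "side_free P {i, j, k} (Suc (n + 1)) i" and fl': "filled (2 * m) P {i, j, k} (Suc (n + 1))"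
    using free fl n by simp_all
  have "{y \<in> lat {i, j, k} (n + 1). zero_cell P {i, j, k} y \<and> y i = 0} = {}"
    using side_free_not_zero_cell[OF free' d] by auto
  then have "card {y \<in> lat {i, j, k} (n + 1). zero_cell P {i, j, k} y \<and> y i = 0} = 0" by (simp only: card.empty)
  moreover have "n + 2 + card ?C \<le> card {y \<in> lat {i, j, k} (n + 1). \<not> monochromatic P {i, j, k} y}
           + card {y \<in> lat {i, j, k} (n + 1). zero_cell P {i, j, k} y \<and> y i = 0}"
  proof (rule nonmono_rows[OF _ d])
    show "\<not> zero_cell P {i, j, k} (pt i j k (n + 1 - c) 0 c)" if "c \<in> ?C" for c
    proof (rule filled_not_zero_cell[OF fl'])
      have "c < m" using that by auto
      then show "pt i j k (n + 1 - c) 0 c \<in> lat {i, j, k} (n + 1)"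
        "2 * m \<le> Suc (pt i j k (n + 1 - c) 0 c i)"
        using n by (auto simp: pt_lat[OF d] pt_apply[OF d])
      show "0 \<notin> {i, j, k}" using P by (simp add: nonopp_def)
    qed auto
  qed (use P n in auto)
  ultimately show ?thesis unfolding n(2) unfolding n(1) by linarith
qed

section \<open>Cells outside the corner triangles\<close>

definition hexcells :: "nat \<Rightarrow> nat set \<Rightarrow> (nat \<Rightarrow> nat) set" where
  "hexcells m S = {y \<in> lat S (3 * m - 1). \<forall>p\<in>S. y p < 2 * m}"

text \<open>Of \<open>3 * m * (3 * m + 1) / 2\<close> cells, three corner triangles with
  \<open>m * (m + 1) / 2\<close> cells each are removed.\<close>

lemma card_hexcells:
  assumes d: "distinct [i, j, k]" and m: "1 \<le> m"
  shows "3 * m\<^sup>2 \<le> card (hexcells m {i, j, k})"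
proof -
  let ?R = "{i, j, k}" and ?n = "3 * m - 1"
  define A where "A p = {y \<in> lat ?R ?n. 2 * m \<le> y p}" for p
  have fin: "finite (lat ?R ?n)" by (simp add: finite_lat)
  have A: "2 * card (A p) = m * (m + 1)" if "p \<in> ?R" for p
  proof -
    have e: "?n = (m - 1) + 2 * m" using m by simp
    have "card (A p) = card (lat ?R (m - 1))" unfolding A_def e by (rule card_lat_shift) (use that in auto)
    then show ?thesis using card_lat3[OF d, of "m - 1"] m by simp
  qed
  have "lat ?R ?n = hexcells m ?R \<union> (A i \<union> (A j \<union> A k))"
    by (auto simp: hexcells_def A_def)
  then have "card (lat ?R ?n) \<le> card (hexcells m ?R) + (card (A i) + (card (A j) + card (A k)))"
    by (metis card_Un4_le)
  moreover have "2 * card (lat ?R ?n) = 3 * m * (3 * m + 1)"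
    using card_lat3[OF d, of ?n] m by simp
  ultimately show ?thesis using A[of i] A[of j] A[of k] by (simp add: power2_eq_square algebra_simps)
qed

text \<open>Filling changes a vertex of such a cell only if a coordinate can reach
  \<open>2 * m\<close>, that is if some \<open>y p = 2 * m - 1\<close>. Each of these three rows has
  \<open>m + 1\<close> cells.\<close>

lemma card_hex_zero_cell:
  assumes d: "distinct [i, j, k]" and m: "1 \<le> m" and R0: "0 \<notin> {i, j, k}"
  shows "card {y \<in> hexcells m {i, j, k}. zero_cell P {i, j, k} y}
    \<le> card {y \<in> lat {i, j, k} (3 * m - 1). zero_cell (fill3 (2 * m) i j k P) {i, j, k} y} + 3 * (m + 1)"
proof -
  let ?R = "{i, j, k}" and ?n = "3 * m - 1"
  define B where "B p = {y \<in> lat ?R ?n. y p \<in> {2 * m - 1}}" for p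
  define Z' where "Z' = {y \<in> lat ?R ?n. zero_cell (fill3 (2 * m) i j k P) ?R y}"
  have finB: "finite Z'" "finite (B p)" for p
    by (simp_all add: Z'_def B_def finite_lat)
  have B: "card (B p) \<le> m + 1" if p: "p \<in> ?R" for p
  proof -
    have e: "?n = m + (2 * m - 1)" using m by simp
    have "B p \<subseteq> {y \<in> lat ?R ?n. 2 * m - 1 \<le> y p} - {y \<in> lat ?R ?n. 2 * m \<le> y p}" using m by (auto simp: B_def)
    then have "card (B p) \<le> card ({y \<in> lat ?R ?n. 2 * m - 1 \<le> y p} - {y \<in> lat ?R ?n. 2 * m \<le> y p})"
      by (intro card_mono) (auto simp: finite_lat)
    also have "\<dots> = card {y \<in> lat ?R ?n. 2 * m - 1 \<le> y p} - card {y \<in> lat ?R ?n. 2 * m \<le> y p}"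
      by (intro card_Diff_subset) (auto simp: finite_lat)
    also have "card {y \<in> lat ?R ?n. 2 * m - 1 \<le> y p} = card (lat ?R m)"
      unfolding e by (rule card_lat_shift) (use p in auto)
    also have "card {y \<in> lat ?R ?n. 2 * m \<le> y p} = card (lat ?R (m - 1))"
    proof -
      have e2: "?n = (m - 1) + 2 * m" using m by simp
      show ?thesis unfolding e2 by (rule card_lat_shift) (use p in auto)
    qed
    also have "card (lat ?R m) - card (lat ?R (m - 1)) = m + 1"
      using card_lat_Suc[of "{j, k}" i "m - 1"] card_lat2[of j k m] d m by simp
    finally show ?thesis .
  qed
  have "{y \<in> hexcells m ?R. zero_cell P ?R y} \<subseteq> Z' \<union> (B i \<union> (B j \<union> B k))"
  proof
    fix y assume "y \<in> {y \<in> hexcells m ?R. zero_cell P ?R y}"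
    then have y: "y \<in> lat ?R ?n" "\<And>p. p \<in> ?R \<Longrightarrow> y p < 2 * m" "zero_cell P ?R y" by (auto simp: hexcells_def)
    show "y \<in> Z' \<union> (B i \<union> (B j \<union> B k))"
    proof (cases "\<exists>p\<in>?R. y p = 2 * m - 1")
      case True
      then show ?thesis using y(1) by (auto simp: B_def)
    next
      case False
      have lt: "Suc (y p) < 2 * m" if "p \<in> ?R" for p
      proof -
        have "y p \<noteq> 2 * m - 1" using False that by blast
        then show ?thesis using y(2)[OF that] by linarith
      qed
      have zero: "fill3 (2 * m) i j k P (up p y) = 0" if p: "p \<in> ?R" for p
      proof -
        have "up p y \<in> lat ?R (3 * m)" using up_lat[OF y(1) _ p] m by simp
        moreover have "up p y q < 2 * m" if "q \<in> ?R" for q using lt[OF that] lt[OF p] by simp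
        ultimately have "fill3 (2 * m) i j k P (up p y) = P (up p y)" by (intro fill3_eq(4)[OF _ d m]) simp_all
        moreover have "P (up p y) = 0" using y(3) p unfolding zero_cell_def by (rule bspec)
        ultimately show ?thesis by (rule trans)
      qed
      have "zero_cell (fill3 (2 * m) i j k P) ?R y" unfolding zero_cell_def by (intro ballI zero)
      then show ?thesis using y(1) by (simp add: Z'_def)
    qed
  qed
  then have "card {y \<in> hexcells m ?R. zero_cell P ?R y} \<le> card (Z' \<union> (B i \<union> (B j \<union> B k)))"
    using finB by (intro card_mono) simp_all
  also have "\<dots> \<le> card Z' + (card (B i) + (card (B j) + card (B k)))"
    by (rule card_Un4_le)
  finally show ?thesis using B[of i] B[of j] B[of k] by (simp add: Z'_def)
qed

section \<open>Cuts near the corners and along the sides\<close>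

text \<open>Applying \<open>half_corner_gain\<close> to both sides at \<open>i\<close> leaves a
  reward \<open>2 * s\<close> for each end labelled \<open>i\<close> of the line
  \<open>x i = n - s\<close>. With one such end the line is cut. With two it is cut twice, or it is
  labelled \<open>i\<close> throughout, and then its \<open>s\<close> cells are nonzero and pay 4
  each.\<close>

lemma corner_gain:
  assumes d: "distinct [i, j, k]" and N: "1 \<le> N" "N \<le> n" and Pi: "P (vert n i) = i" and i0: "i \<noteq> 0"
  shows "2 * N\<^sup>2 \<le> side_cuts_from (\<lambda>t. N\<^sup>2 - t\<^sup>2) n P i j k + corner_cuts N n P j k i
     + 4 * card {y \<in> lat {i, j, k} (n - 1). n - N \<le> y i \<and> \<not> zero_cell P {i, j, k} y}"
proof -
  let ?R = "{i, j, k}"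
  have d1: "distinct [j, i, k]" "distinct [k, i, j]" "distinct [j, k, i]" using d by auto
  have v: "line P j i k n 0 0 = i" "line P k i j n 0 0 = i"
    using Pi vert_pt[OF d, of n] pt_perm(1)[of i j] d pt_cyc[OF d1(2), of n 0 0] by (auto simp: line_def)
  define E where "E s = {y \<in> lat ?R (n - 1). y i = n - s \<and> \<not> zero_cell P ?R y}" for s
  have row: "2 * s * of_bool (line P j i k n 0 s = i) + 2 * s * of_bool (line P k i j n 0 s = i)
      \<le> 2 * s * cuts (line P j k i n (n - s)) s + 4 * card (E s)" if s: "s \<in> {1..N}" for s
  proof -
    let ?L = "line P j k i n (n - s)"
    have sn: "1 \<le> s" "s \<le> n" using s N by auto
    have ends: "?L s = line P j i k n 0 s" "?L 0 = line P k i j n 0 s"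
      using sn d pt_perm(2)[of i k j s "n - s" 0] pt_cyc[OF d1(2), of "n - s" 0 s] pt_cyc[OF d, of "n - s" 0 s]
      by (auto simp: line_def) (metis pt_cyc pt_perm d1)+
    show ?thesis
    proof (cases "\<forall>t\<le>s. ?L t = i")
      case True
      have "card ((\<lambda>t. pt j k i t (s - 1 - t) (n - s)) ` {..<s}) \<le> card (E s)"
      proof (rule card_mono)
        show "finite (E s)" by (simp add: E_def finite_lat)
        show "(\<lambda>t. pt j k i t (s - 1 - t) (n - s)) ` {..<s} \<subseteq> E s"
        proof safe
          fix t assume t: "t < s"
          have "pt j k i t (s - 1 - t) (n - s) \<in> lat {j, k, i} (n - 1)"
            using t sn by (simp add: pt_lat[OF d1(3)])
          moreover have "{j, k, i} = ?R" by auto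
          moreover have "P (up j (pt j k i t (s - 1 - t) (n - s))) = i"
          proof -
            have "s - 1 - t = n - (n - s) - Suc t" using sn t by simp
            then have "P (up j (pt j k i t (s - 1 - t) (n - s))) = ?L (Suc t)"
              using d1(3) by (simp add: pt_apply pt_upd line_def)
            then show ?thesis using True t by simp
          qed
          ultimately show "pt j k i t (s - 1 - t) (n - s) \<in> E s"
            using i0 d1(3) by (auto simp: E_def zero_cell_def pt_apply)
        qed
      qed
      moreover have "inj_on (\<lambda>t. pt j k i t (s - 1 - t) (n - s)) {..<s}"
        by (rule inj_onI) (metis pt_apply(1)[OF d1(3)])
      ultimately have "s \<le> card (E s)" by (simp add: card_image)
      then show ?thesis by (simp add: of_bool_def)
    next
      case False
      then obtain t where t: "t \<le> s" "?L t \<noteq> i" by blast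
      consider "?L 0 = i" "?L s = i" | "?L 0 = i" "?L s \<noteq> i" | "?L 0 \<noteq> i" "?L s = i" | "?L 0 \<noteq> i" "?L s
          \<noteq> i" by blast
      then show ?thesis
      proof cases
        case 1
        then have "2 \<le> cuts ?L s" using t cuts_two[of ?L t s] by auto
        then have "2 * s * 2 \<le> 2 * s * cuts ?L s" by (intro mult_le_mono2)
        moreover have "2 * s * of_bool (line P j i k n 0 s = i) + 2 * s * of_bool (line P k i j n 0 s
            = i) = 2 * s * 2"
          using 1 ends by simp
        ultimately show ?thesis by linarith
      next
        case 2
        then have "1 \<le> cuts ?L s" using cuts_pos[of ?L s] by auto
        then have "2 * s * 1 \<le> 2 * s * cuts ?L s" by (intro mult_le_mono2)
        moreover have "2 * s * of_bool (line P j i k n 0 s = i) + 2 * s * of_bool (line P k i j n 0 s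
            = i) = 2 * s * 1"
          using 2 ends by simp
        ultimately show ?thesis by linarith
      next
        case 3
        then have "1 \<le> cuts ?L s" using cuts_pos[of ?L s] by auto
        then have "2 * s * 1 \<le> 2 * s * cuts ?L s" by (intro mult_le_mono2)
        moreover have "2 * s * of_bool (line P j i k n 0 s = i) + 2 * s * of_bool (line P k i j n 0 s
            = i) = 2 * s * 1"
          using 3 ends by simp
        ultimately show ?thesis by linarith
      next
        case 4
        then show ?thesis using ends by simp
      qed
    qed
  qed
  have "2 * N\<^sup>2 \<le> side_cuts_from (\<lambda>t. N\<^sup>2 - t\<^sup>2) n P i j k +
     (\<Sum>s=1..N. 2 * s * of_bool (line P j i k n 0 s = i) + 2 * s * of_bool (line P k i j n 0 s = i))"
    unfolding sum.distrib side_cuts_from_def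
    using half_corner_gain[OF N(2), of "line P j i k n 0" i, OF v(1)] half_corner_gain[OF N(2), of
        "line P k i j n 0" i, OF v(2)]
    by linarith
  also have "(\<Sum>s=1..N. 2 * s * of_bool (line P j i k n 0 s = i) + 2 * s * of_bool (line P k i j n 0 s = i))
     \<le> (\<Sum>s=1..N. 2 * s * cuts (line P j k i n (n - s)) s + 4 * card (E s))"
    by (intro sum_mono row)
  also have "\<dots> = corner_cuts N n P j k i + 4 * (\<Sum>s=1..N. card (E s))"
    by (simp add: corner_cuts_def sum.distrib sum_distrib_left)
  also have "(\<Sum>s=1..N. card (E s)) = card (\<Union>s\<in>{1..N}. E s)"
    using N by (subst card_UN_disjoint) (auto simp: E_def finite_lat)
  also have "\<dots> \<le> card {y \<in> lat ?R (n - 1). n - N \<le> y i \<and> \<not> zero_cell P ?R y}"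
    by (intro card_mono) (auto simp: E_def finite_lat)
  finally show ?thesis by simp
qed

lemma side_cuts:
  assumes d: "distinct [i, j, k]" and P: "nonopp P {i, j, k} n"
  shows "1 + of_bool (\<not> side_free P {i, j, k} n k) \<le> cuts (line P i j k n 0) n"
proof -
  have "vert n j = pt i j k 0 n 0" using d by (auto simp: vert_def pt_def fun_eq_iff)
  then have v: "line P i j k n 0 0 = j" "line P i j k n 0 n = i"
    using P vert_pt[OF d, of n] by (auto simp: line_def nonopp_def)
  show ?thesis
  proof (cases "side_free P {i, j, k} n k")
    case True
    then show ?thesis using cuts_pos[of "line P i j k n 0" n] v d by auto
  next
    case False
    then obtain x where x: "x \<in> lat {i, j, k} n" "x k = 0" "P x = 0" by (auto simp: side_free_def)
    from lat3_eq_pt[OF x(1) d] x have "x = pt i j k (x i) (n - 0 - x i) 0" "x i \<le> n" by auto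
    then have "line P i j k n 0 (x i) = 0" "x i \<le> n" using x(3) by (auto simp: line_def)
    then show ?thesis using cuts_two[of "line P i j k n 0" "x i" n] v P False by (auto simp: nonopp_def)
  qed
qed

lemma side_cuts_from_one:
  assumes d: "distinct [i, j, k]" and P: "nonopp P {i, j, k} n"
  shows "2 * (3 + of_bool (\<not> side_free P {i, j, k} n i) + of_bool (\<not> side_free P {i, j, k} n j)
    + of_bool (\<not> side_free P {i, j, k} n k))
    \<le> side_cuts_from (\<lambda>_. 1) n P i j k + side_cuts_from (\<lambda>_. 1) n P j k i + side_cuts_from (\<lambda>_. 1) n P k i j"
proof -
  have sw: "cuts (line P j i k n 0) n = cuts (line P i j k n 0) n" if "i \<noteq> j" for i j k
    using wcuts_line_swap[OF that, of "\<lambda>_. 1" P k n 0] by simp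
  have R: "{j, k, i} = {i, j, k}" "{k, i, j} = {i, j, k}" by auto
  have "1 + of_bool (\<not> side_free P {i, j, k} n k) \<le> cuts (line P i j k n 0) n"
    "1 + of_bool (\<not> side_free P {i, j, k} n i) \<le> cuts (line P j k i n 0) n"
    "1 + of_bool (\<not> side_free P {i, j, k} n j) \<le> cuts (line P k i j n 0) n"
    using side_cuts[of i j k P n] side_cuts[of j k i P n] side_cuts[of k i j P n] d P unfolding R by auto
  then show ?thesis
    using sw[of i j k] sw[of j k i] sw[of k i j] d by (simp add: side_cuts_from_def)
qed

text \<open>This holds edge by edge. A cut between two corner labels survives all three
  replacements; a cut between 0 and a corner label survives two of them and is counted once more as
  boundary of the zero region.\<close>

lemma weighted_cut_relabel:
  fixes w :: "nat \<Rightarrow> nat \<Rightarrow> nat"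
  assumes d: "distinct [i, j, k]" and P: "nonopp P {i, j, k} (Suc n)"
  shows "(\<Sum>p\<in>{i, j, k}. weighted_cut w {i, j, k} n (\<lambda>x. if P x = 0 then p else P x))
      + weighted_cut w {i, j, k} n (\<lambda>x. if P x = 0 then 0 else 1) \<le> 3 * weighted_cut w {i, j, k} n P"
proof -
  let ?R = "{i, j, k}"
  have sw: "(\<Sum>p\<in>?R. \<Sum>y\<in>L. \<Sum>r\<in>?R. \<Sum>q\<in>?R - {r}. A p y r q) = (\<Sum>y\<in>L. \<Sum>r\<in>?R. \<Sum>q\<in>?R - {r}. \<Sum>p\<in>?R. A p y r q)"
    for A :: "nat \<Rightarrow> (nat \<Rightarrow> nat) \<Rightarrow> nat \<Rightarrow> nat \<Rightarrow> nat" and L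
  proof -
    have "(\<Sum>p\<in>?R. \<Sum>y\<in>L. \<Sum>r\<in>?R. \<Sum>q\<in>?R - {r}. A p y r q) = (\<Sum>y\<in>L. \<Sum>p\<in>?R. \<Sum>r\<in>?R. \<Sum>q\<in>?R - {r}. A p y r q)"
      by (rule sum.swap)
    also have "\<dots> = (\<Sum>y\<in>L. \<Sum>r\<in>?R. \<Sum>p\<in>?R. \<Sum>q\<in>?R - {r}. A p y r q)"
      by (rule sum.cong[OF refl], rule sum.swap)
    also have "\<dots> = (\<Sum>y\<in>L. \<Sum>r\<in>?R. \<Sum>q\<in>?R - {r}. \<Sum>p\<in>?R. A p y r q)"
      by (rule sum.cong[OF refl], rule sum.cong[OF refl], rule sum.swap)
    finally show ?thesis .
  qed
  have edge: "(\<Sum>p\<in>?R. w' * of_bool ((if a = 0 then p else a) \<noteq> (if b = 0 then p else b)))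
      + w' * of_bool ((if a = 0 then 0 else 1::nat) \<noteq> (if b = 0 then 0 else 1)) \<le> 3 * (w' * of_bool (a \<noteq> b))"
    if "a = 0 \<or> a \<in> ?R" "b = 0 \<or> b \<in> ?R" for a b and w' :: nat
    using that d P unfolding nonopp_def by (auto simp: of_bool_def)
  have "(\<Sum>p\<in>?R. weighted_cut w ?R n (\<lambda>x. if P x = 0 then p else P x)) + weighted_cut w ?R n (\<lambda>x. if P x
      = 0 then 0 else 1)
    = (\<Sum>y\<in>lat ?R n. \<Sum>r\<in>?R. \<Sum>q\<in>?R - {r}.
        (\<Sum>p\<in>?R. w (y r) (y q) * of_bool ((if P (up r y) = 0 then p else P (up r y)) \<noteq> (if P (up q y)
            = 0 then p else P (up q y))))
      + w (y r) (y q) * of_bool ((if P (up r y) = 0 then 0 else 1::nat) \<noteq> (if P (up q y) = 0 then 0 else 1)))"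
    unfolding weighted_cut_def sum.distrib sw ..
  also have "\<dots> \<le> (\<Sum>y\<in>lat ?R n. \<Sum>r\<in>?R. \<Sum>q\<in>?R - {r}. 3 * (w (y r) (y q) * of_bool (P (up r y) \<noteq> P (up q y))))"
  proof (intro sum_mono edge)
    fix y r q assume y: "y \<in> lat ?R n" and r: "r \<in> ?R" and q: "q \<in> ?R - {r}"
    have "P x = 0 \<or> P x \<in> ?R" if "x \<in> lat ?R (Suc n)" for x
      using P that unfolding nonopp_def by blast
    from this[OF up_lat[OF y _ r]] this[OF up_lat[OF y, of q]] q
    show "P (up r y) = 0 \<or> P (up r y) \<in> ?R" "P (up q y) = 0 \<or> P (up q y) \<in> ?R" by auto
  qed
  also have "\<dots> = 3 * weighted_cut w ?R n P"
    by (simp only: weighted_cut_def sum_distrib_left)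
  finally show ?thesis .
qed

section \<open>Lower bounds on a triangle\<close>

text \<open>The side weight is the price of filling the corners in \<open>fill3_line_cuts\<close>;
  the line weight then counts cells that are not monochromatic.\<close>

abbreviation core_cut :: "nat \<Rightarrow> nat set \<Rightarrow> ((nat \<Rightarrow> nat) \<Rightarrow> nat) \<Rightarrow> nat" where
  "core_cut m S P \<equiv> weighted_cut (line_weight (2 * m) (3 * m - 1)) S (3 * m - 1) P
      + weighted_cut (side_weight (\<lambda>t. m - t) (3 * m - 1)) S (3 * m - 1) P"

lemma core_cut_ge_nonmono:
  assumes d: "distinct [i, j, k]" and m: "1 \<le> m" and P: "nonopp P {i, j, k} (3 * m)"
  shows "4 * card {y \<in> lat {i, j, k} (3 * m - 1). \<not> monochromatic (fill3 (2 * m) i j k P) {i, j, k} y}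
      \<le> core_cut m {i, j, k} P"
proof -
  have S: "Suc (3 * m - 1) = 3 * m" and q: "2 * m \<le> Suc (3 * m - 1)" using m by simp_all
  have "2 * line_cuts (2 * m) (3 * m) (fill3 (2 * m) i j k P) i j k \<le> core_cut m {i, j, k} P"
    using fill3_line_cuts[OF d m P]
        unfolding weighted_cut_line_weight[OF d q] weighted_cut_side_weight[OF d] S distrib_left by linarith
  moreover have "2 * line_cuts (2 * m) (3 * m) (fill3 (2 * m) i j k P) i j k
      = weighted_cut (line_weight (2 * m) (3 * m - 1)) {i, j, k} (3 * m - 1) (fill3 (2 * m) i j k P)"
    unfolding weighted_cut_line_weight[OF d q] S ..
  ultimately show ?thesis
    using fill3_nonmono_cost[OF d m fill3_filled[OF d m], of P] by linarith
qed

lemma core_cut_ge: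
  assumes d: "distinct [i, j, k]" and m: "1 \<le> m" and P: "nonopp P {i, j, k} (3 * m)"
  shows "12 * m \<le> core_cut m {i, j, k} P"
  using core_cut_ge_nonmono[OF d m P] nonmono_filled[OF fill3_nonopp[OF d m P] d m fill3_filled[OF d m]]
  by linarith

text \<open>As 0 does not occur on the sides, it may be replaced
    by any of the three corners.  Averaging over the three replacements
  leaves a third of the boundary of the zero region as a surplus.\<close>

lemma core_cut_all_free:
  assumes d: "distinct [i, j, k]" and m: "1 \<le> m" and P: "nonopp P {i, j, k} (3 * m)"
    and free: "\<And>p. p \<in> {i, j, k} \<Longrightarrow> side_free P {i, j, k} (3 * m) p"
  shows "\<exists>h. card {y \<in> lat {i, j, k} (3 * m - 1). zero_cell P {i, j, k} y} \<le> 3 * m * h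
     \<and> 36 * m + 4 * h \<le> 3 * core_cut m {i, j, k} P"
proof -
  let ?R = "{i, j, k}" and ?n = "3 * m - 1"
  have S: "Suc ?n = 3 * m" using m by simp
  have P': "nonopp P ?R (Suc ?n)" using P S by simp
  \<comment> \<open>A point labelled 0 is not on the free side \<open>x p = 0\<close>, so
    \<open>p\<close> is in its support.\<close>
  have nP: "nonopp (\<lambda>x. if P x = 0 then p else P x) ?R (3 * m)" if p: "p \<in> ?R" for p
  proof -
    have 1: "P x = 0 \<or> P x \<in> ?R \<and> 0 < x (P x)" if "x \<in> lat ?R (3 * m)" for x
      using P that unfolding nonopp_def by blast
    have 2: "0 < x p" if "x \<in> lat ?R (3 * m)" "P x = 0" for x
      using free[OF p] that by (auto simp: side_free_def)
    have "0 \<notin> ?R" "\<forall>q\<in>?R. P (vert (3 * m) q) = q" using P unfolding nonopp_def by blast+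
    moreover have "(if P x = 0 then p else P x) \<in> ?R \<and> 0 < x (if P x = 0 then p else P x)" if
        "x \<in> lat ?R (3 * m)" for x
      using 1[OF that] 2[OF that] p by (cases "P x = 0") simp_all
    moreover have "(if P (vert (3 * m) q) = 0 then p else P (vert (3 * m) q)) = q" if "q \<in> ?R" for q
      using P that unfolding nonopp_def by (metis (full_types))
    ultimately show ?thesis unfolding nonopp_def by simp
  qed
  define P0 where "P0 x = (if P x = 0 then 0 else 1::nat)" for x
  have sum: "(\<Sum>p\<in>?R. f p) = f i + f j + f k" for f :: "nat \<Rightarrow> nat" using d by (simp add: add_ac)
  have "core_cut m ?R (\<lambda>x. if P x = 0 then i else P x) + core_cut m ?R (\<lambda>x. if P x = 0 then j else P x)
    + core_cut m ?R (\<lambda>x. if P x = 0 then k else P x) + weighted_cut (line_weight (2 * m) ?n) ?R ?n P0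
        \<le> 3 * core_cut m ?R P"
    using weighted_cut_relabel[OF d P', of "line_weight (2 * m) ?n"] weighted_cut_relabel[OF d P', of
        "side_weight (\<lambda>t. m - t) ?n"]
    unfolding sum P0_def distrib_left by linarith
  then have 1: "36 * m + weighted_cut (line_weight (2 * m) ?n) ?R ?n P0 \<le> 3 * core_cut m ?R P"
    using core_cut_ge[OF d m nP[of i]] core_cut_ge[OF d m nP[of j]] core_cut_ge[OF d m nP[of k]] by simp
  define Z where "Z = {y \<in> lat ?R ?n. zero_cell P ?R y}"
  define H where "H a = {c. c < 2 * m \<and> (\<exists>x\<in>lat ?R (3 * m). P x = 0 \<and> x a = c)}" for a
  have finH: "finite (H a)" for a by (simp add: H_def)
  \<comment> \<open>Such a line runs between two free sides, so a zero on it forces two cuts on the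
    boundary of the zero region.\<close>
  have lineH: "2 * card (H c) \<le> (\<Sum>r<2*m. cuts (line P0 a b c (3 * m) r) (3 * m - r))"
    if dd: "distinct [a, b, c]" and R: "?R = {a, b, c}" for a b c
  proof -
    have "2 * card (H c) = (\<Sum>r\<in>H c. 2)" by simp
    also have "\<dots> \<le> (\<Sum>r\<in>H c. cuts (line P0 a b c (3 * m) r) (3 * m - r))"
    proof (rule sum_mono)
      fix r assume "r \<in> H c"
      then obtain x where x: "r < 2 * m" "x \<in> lat ?R (3 * m)" "P x = 0" "x c = r" by (auto simp: H_def)
      have xp: "x = pt a b c (x a) (x b) (x c)" "x a + x b + x c = 3 * m" using lat3_eq_pt[OF _ dd] x R by auto
      have "x b = 3 * m - r - x a" using xp x by simp
      then have L: "line P0 a b c (3 * m) r (x a) = 0" using xp x by (simp add: line_def P0_def)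
      have "pt a b c 0 (3 * m - r) r \<in> lat ?R (3 * m)" "pt a b c (3 * m - r) 0 r \<in> lat ?R (3 * m)"
        using x(1) pt_lat[OF dd] R by auto
      moreover have "side_free P ?R (3 * m) a" "side_free P ?R (3 * m) b" using free R by auto
      ultimately have "P (pt a b c 0 (3 * m - r) r) \<noteq> 0" "P (pt a b c (3 * m - r) 0 r) \<noteq> 0"
        using dd by (auto simp: side_free_def pt_apply)
      then have "line P0 a b c (3 * m) r 0 = 1" "line P0 a b c (3 * m) r (3 * m - r) = 1"
          by (simp_all add: line_def P0_def)
      then show "2 \<le> cuts (line P0 a b c (3 * m) r) (3 * m - r)"
        using L xp x by (intro cuts_two[of _ "x a"]) auto
    qed
    also have "\<dots> \<le> (\<Sum>r<2*m. cuts (line P0 a b c (3 * m) r) (3 * m - r))"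
      by (intro sum_mono2) (auto simp: H_def)
    finally show ?thesis .
  qed
  have "weighted_cut (line_weight (2 * m) ?n) ?R ?n P0 = 2 * line_cuts (2 * m) (3 * m) P0 i j k"
    using m by (simp add: weighted_cut_line_weight[OF d] S)
  moreover have "2 * card (H k) + 2 * card (H i) \<le> line_cuts (2 * m) (3 * m) P0 i j k"
    using lineH[of i j k] lineH[of j k i] d unfolding line_cuts_def sum.distrib by (simp add: insert_commute)
  ultimately have 2: "4 * (card (H k) + card (H i)) \<le> weighted_cut (line_weight (2 * m) ?n) ?R ?n P0"
    unfolding distrib_left by linarith
  \<comment> \<open>Two coordinates cannot both reach \<open>2 * m\<close>, so the rows of two
    directions cover all zero cells; a row has at most \<open>3 * m\<close> cells.\<close>
  have "Z \<subseteq> {y \<in> lat ?R ?n. y k \<in> H k} \<union> {y \<in> lat ?R ?n. y i \<in> H i}"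
  proof
    fix y assume "y \<in> Z"
    then have y: "y \<in> lat ?R ?n" "zero_cell P ?R y" by (auto simp: Z_def)
    have u: "up j y \<in> lat ?R (3 * m)" using up_lat[OF y(1), of j] S by simp
    have "P (up j y) = 0" using y(2) by (simp add: zero_cell_def)
    then have "up j y k < 2 * m \<Longrightarrow> y k \<in> H k" "up j y i < 2 * m \<Longrightarrow> y i \<in> H i"
      using u d unfolding H_def by (auto intro!: bexI[of _ "up j y"])
    moreover have "y k < 2 * m \<or> y i < 2 * m" using lat3_eq_pt[OF y(1) d] m by linarith
    ultimately show "y \<in> {y \<in> lat ?R ?n. y k \<in> H k} \<union> {y \<in> lat ?R ?n. y i \<in> H i}"
      using y(1) d by auto
  qed
  then have "card Z \<le> card ({y \<in> lat ?R ?n. y k \<in> H k} \<union> {y \<in> lat ?R ?n. y i \<in> H i})"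
    by (intro card_mono) (simp_all add: finite_lat)
  also have "\<dots> \<le> card {y \<in> lat ?R ?n. y k \<in> H k} + card {y \<in> lat ?R ?n. y i \<in> H i}"
    by (rule card_Un_le)
  also have "\<dots> \<le> 3 * m * (card (H k) + card (H i))"
    using card_row_le[OF d finH, of ?n k] card_row_le[of j k i, OF _ finH, of ?n i] d S
    by (simp add: insert_commute distrib_left)
  finally show ?thesis using 1 2 unfolding Z_def by (intro exI[of _ "card (H k) + card (H i)"]) linarith
qed

text \<open>Here \<open>h\<close> counts the rows that contain zero cells after filling. Each forces
  one more cell that is not monochromatic, worth 4, and accounts for at most \<open>3 * m\<close>
  zero cells.\<close>

lemma core_cut_two_free:
  assumes d: "distinct [i, j, k]" and m: "1 \<le> m" and P: "nonopp P {i, j, k} (3 * m)"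
    and free: "side_free P {i, j, k} (3 * m) i" "side_free P {i, j, k} (3 * m) j"
  shows "\<exists>h. card {y \<in> hexcells m {i, j, k}. zero_cell P {i, j, k} y} \<le> 3 * m * h + 3 * (m + 1)
     \<and> 12 * m + 4 * h \<le> core_cut m {i, j, k} P"
proof -
  let ?R = "{i, j, k}" and ?n = "3 * m - 1" and ?Q = "fill3 (2 * m) i j k P"
  have R0: "0 \<notin> ?R" using P unfolding nonopp_def by blast
  define Z' where "Z' = {y \<in> lat ?R ?n. zero_cell ?Q ?R y}"
  define C where "C = (\<lambda>y. y k) ` Z'"
  have "3 * m + card C \<le> card {y \<in> lat ?R ?n. \<not> monochromatic ?Q ?R y}"
    unfolding C_def Z'_def
    by (intro nonmono_two_free_sides fill3_nonopp d m P side_free_fill3 R0 free)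
  moreover have "card Z' \<le> 3 * m * card C"
  proof -
    have "finite C" by (simp add: C_def Z'_def finite_lat)
    then have "card {y \<in> lat ?R ?n. y k \<in> C} \<le> Suc ?n * card C" by (rule card_row_le[OF d])
    moreover have "card Z' \<le> card {y \<in> lat ?R ?n. y k \<in> C}"
      by (intro card_mono) (auto simp: finite_lat Z'_def C_def)
    ultimately show ?thesis using m by simp
  qed
  ultimately show ?thesis
    using card_hex_zero_cell[OF d m R0, of P] core_cut_ge_nonmono[OF d m P]
    unfolding Z'_def by (intro exI[of _ "card C"]) linarith
qed

text \<open>Rows below \<open>m\<close> are counted in the directions \<open>j\<close> and
  \<open>k\<close>. Each direction alone gains 4 per row, so their average gains 2 per row of either
  kind. Zero cells in none of these rows satisfy \<open>m \<le> y j\<close> and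
  \<open>m \<le> y k\<close>; there are at most \<open>m * (m + 1) / 2\<close> of them.\<close>

lemma core_cut_one_free:
  assumes d: "distinct [i, j, k]" and m: "1 \<le> m" and P: "nonopp P {i, j, k} (3 * m)"
    and free: "side_free P {i, j, k} (3 * m) i"
  shows "\<exists>h. 2 * card {y \<in> hexcells m {i, j, k}. zero_cell P {i, j, k} y} \<le> 6 * m * h + m * (m + 1) + 6 * (m + 1)
     \<and> 12 * m + 2 * h \<le> core_cut m {i, j, k} P"
proof -
  let ?R = "{i, j, k}" and ?n = "3 * m - 1" and ?Q = "fill3 (2 * m) i j k P"
  have R0: "0 \<notin> ?R" using P unfolding nonopp_def by blast
  have d': "distinct [i, k, j]" and R': "{i, k, j} = ?R" using d by auto
  define Z' where "Z' = {y \<in> lat ?R ?n. zero_cell ?Q ?R y}"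
  define C where "C a = (\<lambda>y. y a) ` {y \<in> lat ?R ?n. zero_cell ?Q ?R y \<and> y a < m}" for a
  have 1: "3 * m + card (C k) \<le> card {y \<in> lat ?R ?n. \<not> monochromatic ?Q ?R y}"
    unfolding C_def
    by (intro nonmono_one_free_side fill3_nonopp fill3_filled d m P side_free_fill3 R0 free)
  have 2: "3 * m + card (C j) \<le> card {y \<in> lat ?R ?n. \<not> monochromatic ?Q ?R y}"
    using nonmono_one_free_side[of ?Q i k j m] fill3_nonopp[OF d m P] fill3_filled[OF d m, of P]
      side_free_fill3[OF d m R0 free] d' m unfolding R' C_def by blast
  define B where "B = {y \<in> lat ?R ?n. m \<le> y j \<and> m \<le> y k}"
  have finC: "finite (C a)" for a by (simp add: C_def finite_lat)
  have Ck: "card {y \<in> lat ?R ?n. y k \<in> C k} \<le> 3 * m * card (C k)"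
    using card_row_le[OF d finC, of ?n k] m by simp
  have Cj: "card {y \<in> lat ?R ?n. y j \<in> C j} \<le> 3 * m * card (C j)"
    using card_row_le[OF d' finC, of ?n j] m unfolding R' by simp
  have B: "2 * card B \<le> m * (m + 1)"
  proof -
    have e: "?n = (2 * m - 1) + m" using m by simp
    have inj: "inj_on (\<lambda>y. y(k := y k - m)) B"
    proof (rule inj_onI)
      fix x y assume xy: "x \<in> B" "y \<in> B" "x(k := x k - m) = y(k := y k - m)"
      then have "x l = y l" if "l \<noteq> k" for l using that by (metis fun_upd_apply)
      moreover have "x k = y k" using xy
          by (metis (mono_tags, lifting) B_def fun_upd_same le_add_diff_inverse mem_Collect_eq)
      ultimately show "x = y" by (metis ext)
    qed
    have "(\<lambda>y. y(k := y k - m)) ` B \<subseteq> {y \<in> lat ?R (2 * m - 1). m \<le> y j}"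
    proof safe
      fix y assume "y \<in> B"
      then have y: "y \<in> lat ?R ?n" "m \<le> y j" "m \<le> y k" by (auto simp: B_def)
      show "y(k := y k - m) \<in> lat ?R (2 * m - 1)"
        using sum_upd[of ?R k y "y k - m"] y m by (auto simp: lat_def)
      show "m \<le> (y(k := y k - m)) j" using y d by simp
    qed
    then have "card B \<le> card {y \<in> lat ?R (2 * m - 1). m \<le> y j}"
      using inj by (intro card_inj_on_le) (auto simp: finite_lat)
    also have "\<dots> = card (lat ?R (m - 1))"
    proof -
      have e2: "2 * m - 1 = (m - 1) + m" using m by simp
      show ?thesis unfolding e2 by (rule card_lat_shift) auto
    qed
    finally show ?thesis using card_lat3[OF d, of "m - 1"] m by simp
  qed
  have "Z' \<subseteq> B \<union> ({y \<in> lat ?R ?n. y k \<in> C k} \<union> {y \<in> lat ?R ?n. y j \<in> C j})"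
    by (auto simp: Z'_def B_def C_def not_le)
  then have "card Z' \<le> card (B \<union> ({y \<in> lat ?R ?n. y k \<in> C k} \<union> {y \<in> lat ?R ?n. y j \<in> C j}))"
    by (intro card_mono) (simp_all add: finite_lat B_def)
  also have "\<dots> \<le> card B + (card {y \<in> lat ?R ?n. y k \<in> C k} + card {y \<in> lat ?R ?n. y j \<in> C j})"
    by (meson card_Un_le add_le_cancel_left order_trans)
  finally have Z': "2 * card Z' \<le> m * (m + 1) + 6 * m * (card (C k) + card (C j))"
    using B Ck Cj by (simp add: distrib_left)
  then show ?thesis
    using 1 2 card_hex_zero_cell[OF d m R0, of P] core_cut_ge_nonmono[OF d m P]
    unfolding Z'_def by (intro exI[of _ "card (C k) + card (C j)"] conjI, linarith) (unfold distrib_left, linarith)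
qed

definition nonzero_cells :: "((nat \<Rightarrow> nat) \<Rightarrow> nat) \<Rightarrow> nat set \<Rightarrow> nat \<Rightarrow> nat" where
  "nonzero_cells P S n = card {y \<in> lat S n. \<not> zero_cell P S y}"

text \<open>The three regions near the corners and the \<open>27 * N^2\<close> or more hexagon cells
  are disjoint, so no nonzero cell is charged twice.\<close>

lemma corners_gain:
  assumes d: "distinct [i, j, k]" and N: "1 \<le> N" and P: "nonopp P {i, j, k} (9 * N)"
  shows "12 * N\<^sup>2 + 8 * (27 * N\<^sup>2 - card {y \<in> hexcells (3 * N) {i, j, k}. zero_cell P {i, j, k} y})
    \<le> weighted_cut (side_weight (\<lambda>t. N\<^sup>2 - t\<^sup>2) (9 * N - 1)) {i, j, k} (9 * N - 1) P
        + weighted_cut (corner_weight N (9 * N - 1)) {i, j, k} (9 * N - 1) P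
      + 8 * nonzero_cells P {i, j, k} (9 * N - 1)"
proof -
  let ?R = "{i, j, k}" and ?n = "9 * N - 1"
  have S: "Suc ?n = 9 * N" and NS: "N \<le> Suc ?n" using N by simp_all
  have Pv: "P (vert (9 * N) p) = p" "p \<noteq> 0" if "p \<in> ?R" for p
    using P that unfolding nonopp_def by blast+
  define X where "X p = {y \<in> lat ?R ?n. 9 * N - N \<le> y p \<and> \<not> zero_cell P ?R y}" for p
  define Y where "Y = {y \<in> hexcells (3 * N) ?R. \<not> zero_cell P ?R y}"
  have R: "{j, k, i} = ?R" "{k, i, j} = ?R" by auto
  have "2 * N\<^sup>2 \<le> side_cuts_from (\<lambda>t. N\<^sup>2 - t\<^sup>2) (9 * N) P i j k + corner_cuts N (9 * N) P j k i + 4 * card (X i)"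
    using corner_gain[OF d N, of "9 * N" P] Pv N by (simp add: X_def)
  moreover have "2 * N\<^sup>2 \<le> side_cuts_from (\<lambda>t. N\<^sup>2 - t\<^sup>2) (9 * N) P j k i + corner_cuts N (9 * N) P k i j
      + 4 * card (X j)"
    using corner_gain[of j k i, OF _ N, of "9 * N" P] Pv N d unfolding R by (simp add: X_def)
  moreover have "2 * N\<^sup>2 \<le> side_cuts_from (\<lambda>t. N\<^sup>2 - t\<^sup>2) (9 * N) P k i j + corner_cuts N (9 * N) P i j k
      + 4 * card (X k)"
    using corner_gain[of k i j, OF _ N, of "9 * N" P] Pv N d unfolding R by (simp add: X_def)
  moreover have "card (X i) + card (X j) + card (X k) + card Y \<le> nonzero_cells P ?R ?n"
  proof -
    have fin: "finite (X p)" "finite Y" for p by (auto simp: X_def Y_def hexcells_def finite_lat)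
    have s: "y i + y j + y k = ?n" if "y \<in> lat ?R ?n" for y using lat3_eq_pt[OF that d] by simp
    have "X i \<inter> X j = {}" "(X i \<union> X j) \<inter> X k = {}" "(X i \<union> X j \<union> X k) \<inter> Y = {}"
      using s N by (fastforce simp: X_def Y_def hexcells_def)+
    then have "card (X i) + card (X j) + card (X k) + card Y = card (X i \<union> X j \<union> X k \<union> Y)"
      using fin by (simp add: card_Un_disjoint)
    also have "\<dots> \<le> nonzero_cells P ?R ?n"
      unfolding nonzero_cells_def by (intro card_mono) (auto simp: X_def Y_def hexcells_def finite_lat)
    finally show ?thesis .
  qed
  moreover have "27 * N\<^sup>2 - card {y \<in> hexcells (3 * N) ?R. zero_cell P ?R y} \<le> card Y"
  proof -
    have fin: "finite (hexcells (3 * N) ?R)" by (simp add: hexcells_def finite_lat)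
    have "Y = hexcells (3 * N) ?R - {y \<in> hexcells (3 * N) ?R. zero_cell P ?R y}" by (auto simp: Y_def)
    then have "card Y = card (hexcells (3 * N) ?R) - card {y \<in> hexcells (3 * N) ?R. zero_cell P ?R y}"
      using fin by (simp add: card_Diff_subset)
    then show ?thesis using card_hexcells[OF d, of "3 * N"] N by (simp add: power_mult_distrib)
  qed
  moreover have "weighted_cut (side_weight (\<lambda>t. N\<^sup>2 - t\<^sup>2) ?n) ?R ?n P
     = 2 * (side_cuts_from (\<lambda>t. N\<^sup>2 - t\<^sup>2) (9 * N) P i j k
         + side_cuts_from (\<lambda>t. N\<^sup>2 - t\<^sup>2) (9 * N) P j k i + side_cuts_from (\<lambda>t. N\<^sup>2 - t\<^sup>2) (9 * N) P k i j)"
    unfolding weighted_cut_side_weight[OF d] S ..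
  moreover have "weighted_cut (corner_weight N ?n) ?R ?n P = 2 * (corner_cuts N (9 * N) P i j k
      + corner_cuts N (9 * N) P j k i + corner_cuts N (9 * N) P k i j)"
    unfolding weighted_cut_corner_weight[OF d NS] S ..
  ultimately show ?thesis unfolding distrib_left by linarith
qed

section \<open>The face weight and the tetrahedron\<close>

text \<open>Up to the common factor \<open>n = 9 N\<close>, this is \<open>f = 0.53648\<close> times the lines \<open>x\<^sub>k
    = c\<close> with \<open>c < 2n/3\<close> and the tapers, plus
  \<open>0.0208 n\<close> on each side edge (\<^term>\<open>side_weight (\<lambda>_. 1)\<close> has the value 2 there), plus a correction within distance
  \<open>n/9\<close> of the corners.  The tetrahedron gets \<open>\<delta>/n = 0.0048/N\<close> per edge for \<open>\<delta>
      = 0.0432\<close>.  The numbers make the estimates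
  below tight both without zeros on the sides and with zeros on all three sides.\<close>

definition face_weight :: "nat \<Rightarrow> nat \<Rightarrow> nat \<Rightarrow> real" where
  "face_weight N a b = 0.53648 * (real (line_weight (6 * N) (9 * N - 1) a b)
      + real (side_weight (\<lambda>t. 3 * N - t) (9 * N - 1) a b))
    + 0.0936 * real N * real (side_weight (\<lambda>_. 1) (9 * N - 1) a b)
    + 0.0036 / real N * (real (side_weight (\<lambda>t. N\<^sup>2 - t\<^sup>2) (9 * N - 1) a b)
        + real (corner_weight N (9 * N - 1) a b))"

lemma weighted_cut_real: "weighted_cut (\<lambda>a b. real (w a b)) S n P = real (weighted_cut w S n P)"
  by (simp add: weighted_cut_def)

lemma weighted_cut_linear:
  fixes w w' :: "nat \<Rightarrow> nat \<Rightarrow> real"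
  shows "weighted_cut (\<lambda>a b. w a b + w' a b) S n P = weighted_cut w S n P + weighted_cut w' S n P"
    "weighted_cut (\<lambda>a b. x * w a b) S n P = x * weighted_cut w S n P"
  by (simp_all only: weighted_cut_def distrib_right sum.distrib sum_distrib_left mult.assoc)

lemma weighted_cut_face_weight:
  "weighted_cut (face_weight N) S (9 * N - 1) P = 0.53648 * real (core_cut (3 * N) S P)
    + 0.0936 * real N * real (weighted_cut (side_weight (\<lambda>_. 1) (9 * N - 1)) S (9 * N - 1) P)
    + 0.0036 / real N * real (weighted_cut (side_weight (\<lambda>t. N\<^sup>2 - t\<^sup>2) (9 * N - 1)) S (9 * N - 1) P
        + weighted_cut (corner_weight N (9 * N - 1)) S (9 * N - 1) P)"
  unfolding face_weight_def weighted_cut_linear weighted_cut_real by (simp add: mult.assoc[symmetric])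

lemma face_weight_nonneg: "0 \<le> face_weight N a b"
  by (simp add: face_weight_def)

lemma real_diff_le: "real a - real b \<le> real (a - b)"
  by (cases "b \<le> a") (auto simp: of_nat_diff)


text \<open>The assumptions \<open>side\<close> order the corners so that only the number of free
  sides matters. In units of \<open>N\<close>, three free sides give
  \<open>36 * 0.53648 + 12 * 0.0936 + 40.5 * 0.0288\<close> and no free side gives
  \<open>36 * 0.53648 + 24 * 0.0936 + 12 * 0.0036\<close>; both equal
  \<open>21.60288\<close>.\<close>

lemma tri_bound_aux:
  assumes d: "distinct [i, j, k]" and N: "10 \<le> N" and P: "nonopp P {i, j, k} (9 * N)"
    and side: "side_free P {i, j, k} (9 * N) j \<Longrightarrow> side_free P {i, j, k} (9 * N) i"
      "side_free P {i, j, k} (9 * N) k \<Longrightarrow> side_free P {i, j, k} (9 * N) j"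
  shows "21.60288 * real N \<le> weighted_cut (face_weight N) {i, j, k} (9 * N - 1) P
      + 0.0288 / real N * real (nonzero_cells P {i, j, k} (9 * N - 1))"
proof -
  let ?R = "{i, j, k}" and ?n = "9 * N - 1"
  define G where "G = real (core_cut (3 * N) ?R P)"
  define S where "S = real (weighted_cut (side_weight (\<lambda>_. 1) ?n) ?R ?n P)"
  define D where "D = real (weighted_cut (side_weight (\<lambda>t. N\<^sup>2 - t\<^sup>2) ?n) ?R ?n P
      + weighted_cut (corner_weight N ?n) ?R ?n P)"
  define L where "L = real (nonzero_cells P ?R ?n)"
  define Z where "Z = real (card {y \<in> hexcells (3 * N) ?R. zero_cell P ?R y})"
  define f where "f p = (of_bool (\<not> side_free P ?R (9 * N) p) :: real)" for p
  have Npos: "0 < real N" "10 \<le> real N" using N by auto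
  have m: "1 \<le> 3 * N" using N by simp
  have n9: "3 * (3 * N) = 9 * N" "Suc ?n = 9 * N" using N by simp_all
  have P3: "nonopp P ?R (3 * (3 * N))" using P n9 by simp
  have G0: "36 * real N \<le> G"
    using core_cut_ge[OF d m P3] unfolding G_def by linarith
  have "real (2 * (3 + of_bool (\<not> side_free P ?R (9 * N) i) + of_bool (\<not> side_free P ?R (9 * N) j)
      + of_bool (\<not> side_free P ?R (9 * N) k)))
      \<le> real (side_cuts_from (\<lambda>_. 1) (9 * N) P i j k + side_cuts_from (\<lambda>_. 1) (9 * N) P j k i
          + side_cuts_from (\<lambda>_. 1) (9 * N) P k i j)"
    unfolding of_nat_le_iff by (rule side_cuts_from_one[OF d P])
  then have S0: "12 + 4 * f i + 4 * f j + 4 * f k \<le> S"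
    unfolding S_def weighted_cut_side_weight[OF d] n9 f_def by simp
  have D0: "0 \<le> D" by (simp add: D_def)
  have "12 * N\<^sup>2 + 8 * (27 * N\<^sup>2 - card {y \<in> hexcells (3 * N) ?R. zero_cell P ?R y})
      \<le> weighted_cut (side_weight (\<lambda>t. N\<^sup>2 - t\<^sup>2) ?n) ?R ?n P + weighted_cut (corner_weight N ?n) ?R ?n P
          + 8 * nonzero_cells P ?R ?n"
    by (rule corners_gain[OF d _ P]) (use N in simp)
  then have "real (12 * N\<^sup>2 + 8 * (27 * N\<^sup>2 - card {y \<in> hexcells (3 * N) ?R. zero_cell P ?R y}))
      \<le> real (weighted_cut (side_weight (\<lambda>t. N\<^sup>2 - t\<^sup>2) ?n) ?R ?n P
          + weighted_cut (corner_weight N ?n) ?R ?n P + 8 * nonzero_cells P ?R ?n)"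
    unfolding of_nat_le_iff .
  then have c: "real (12 * N\<^sup>2 + 8 * (27 * N\<^sup>2 - card {y \<in> hexcells (3 * N) ?R. zero_cell P ?R y})) \<le> D + 8 * L"
    unfolding D_def L_def of_nat_add of_nat_mult of_nat_numeral .
  have r: "27 * (real N)\<^sup>2 - Z \<le> real (27 * N\<^sup>2 - card {y \<in> hexcells (3 * N) ?R. zero_cell P ?R y})"
    using real_diff_le[of "27 * N\<^sup>2"] unfolding Z_def by simp
  have c': "12 * (real N)\<^sup>2 + 8 * real (27 * N\<^sup>2 - card {y \<in> hexcells (3 * N) ?R. zero_cell P ?R y}) \<le> D + 8 * L"
    using c unfolding of_nat_add of_nat_mult of_nat_numeral of_nat_power .
  then have DL: "228 * (real N)\<^sup>2 \<le> D + 8 * L + 8 * Z" using r by linarith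
  have DL12: "12 * (real N)\<^sup>2 \<le> D + 8 * L"
    using c' by linarith
  have T: "weighted_cut (face_weight N) ?R ?n P = 0.53648 * G + 0.0936 * real N * S + 0.0036 / real N * D"
    unfolding G_def S_def D_def by (rule weighted_cut_face_weight)
  define n2 where "n2 = real N * real N"
  define GN where "GN = G * real N"
  define SN where "SN = S * n2"
  have n2: "(real N)\<^sup>2 = n2" "10 * real N \<le> n2"
    using Npos by (simp_all add: n2_def power2_eq_square)
  have n2pos: "0 \<le> n2" by (simp add: n2_def)
  \<comment> \<open>This is the claim multiplied by \<open>100000 * N\<close>.\<close>
  have goal: ?thesis if "2160288 * n2 \<le> 53648 * GN + 9360 * SN + 360 * D + 2880 * L"
    unfolding T L_def[symmetric] using that Npos by (simp add: n2_def GN_def SN_def field_simps)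
  have Sm: "s * n2 \<le> SN" if "s \<le> S" for s
    unfolding SN_def using that n2pos by (rule mult_right_mono)
  have Gm: "a * n2 + b * (real N * h) \<le> GN" if "a * real N + b * h \<le> G" for a b h
  proof -
    have "(a * real N + b * h) * real N \<le> GN" unfolding GN_def using that Npos by (intro mult_right_mono) auto
    then show ?thesis by (simp add: n2_def algebra_simps)
  qed
  consider "side_free P ?R (9 * N) k" | "side_free P ?R (9 * N) j" "\<not> side_free P ?R (9 * N) k"
    | "side_free P ?R (9 * N) i" "\<not> side_free P ?R (9 * N) j" "\<not> side_free P ?R (9 * N) k"
    | "\<not> side_free P ?R (9 * N) i" "\<not> side_free P ?R (9 * N) j" "\<not> side_free P ?R (9 * N) k"
    by blast
  then show ?thesis
  proof cases
    case 1
    then have free: "side_free P ?R (3 * (3 * N)) p" if "p \<in> ?R" for p using side that n9 by auto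
    obtain h where h: "card {y \<in> lat ?R (3 * (3 * N) - 1). zero_cell P ?R y} \<le> 3 * (3 * N) * h"
      "36 * (3 * N) + 4 * h \<le> 3 * core_cut (3 * N) ?R P"
      using core_cut_all_free[OF d m P3 free] by blast
    have fin: "finite (lat ?R ?n)" by (simp add: finite_lat)
    have "{y \<in> lat ?R ?n. \<not> zero_cell P ?R y} = lat ?R ?n - {y \<in> lat ?R ?n. zero_cell P ?R y}" by auto
    then have "real (nonzero_cells P ?R ?n) \<ge> real (card (lat ?R ?n)) - real (card {y \<in> lat ?R ?n.
        zero_cell P ?R y})"
      unfolding nonzero_cells_def using fin real_diff_le by (simp add: card_Diff_subset)
    moreover have "2 * card (lat ?R ?n) = 9 * N * (9 * N + 1)"
      using card_lat3[OF d, of ?n] N by simp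
    then have "real (2 * card (lat ?R ?n)) = real (9 * N * (9 * N + 1))" by (simp only:)
    then have "2 * real (card (lat ?R ?n)) = 81 * n2 + 9 * real N" by (simp add: n2_def algebra_simps)
    moreover have "real (card {y \<in> lat ?R ?n. zero_cell P ?R y}) \<le> 9 * (real N * real h)"
    proof -
      have "card {y \<in> lat ?R ?n. zero_cell P ?R y} \<le> 9 * N * h" using h(1) unfolding n9 by simp
      then have "real (card {y \<in> lat ?R ?n. zero_cell P ?R y}) \<le> real (9 * N * h)" unfolding of_nat_le_iff .
      then show ?thesis by simp
    qed
    ultimately have L: "81 * n2 + 9 * real N \<le> 2 * L + 18 * (real N * real h)" unfolding L_def by linarith
    have "real (36 * (3 * N) + 4 * h) \<le> real (3 * core_cut (3 * N) ?R P)" using h(2) unfolding of_nat_le_iff .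
    then have "36 * real N + 4 / 3 * real h \<le> G" unfolding G_def by simp
    from Gm[OF this] have Gh: "36 * n2 + 4 / 3 * (real N * real h) \<le> GN" .
    show ?thesis
    proof (rule goal)
      have "0 \<le> real N * real h" by simp
      moreover have "f i = 0" "f j = 0" "f k = 0" using 1 side by (auto simp: f_def)
      then have s: "12 \<le> S" using S0 by simp
      ultimately show "2160288 * n2 \<le> 53648 * GN + 9360 * SN + 360 * D + 2880 * L"
        using Sm[OF s] Gh L D0 Npos by linarith
    qed
  next
    case 2
    then have free: "side_free P ?R (3 * (3 * N)) i" "side_free P ?R (3 * (3 * N)) j" using side n9 by auto
    obtain h where h: "card {y \<in> hexcells (3 * N) ?R. zero_cell P ?R y} \<le> 3 * (3 * N) * h + 3 * (3 * N + 1)"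
      "12 * (3 * N) + 4 * h \<le> core_cut (3 * N) ?R P"
      using core_cut_two_free[OF d m P3 free] by blast
    have "real (card {y \<in> hexcells (3 * N) ?R. zero_cell P ?R y}) \<le> real (3 * (3 * N) * h + 3 * (3 * N + 1))"
      using h(1) by (simp only: of_nat_le_iff)
    \<comment> \<open>The leading terms leave a surplus of \<open>2880 * n2\<close> against the loss
      \<open>2880 * Z\<close>. The part with \<open>h\<close> is covered by \<open>Gh\<close>, and
      \<open>9 * N + 3 \<le> N^2\<close> holds from \<open>N = 10\<close> on.\<close>
    then have Z: "Z \<le> 9 * (real N * real h) + 9 * real N + 3" unfolding Z_def by simp
    have "36 * real N + 4 * real h \<le> G" using h(2) unfolding G_def by linarith
    from Gm[OF this] have Gh: "36 * n2 + 4 * (real N * real h) \<le> GN" .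
    show ?thesis
    proof (rule goal)
      have "0 \<le> real N * real h" by simp
      moreover have "f i = 0" "f j = 0" "f k = 1" using 2 side by (auto simp: f_def)
      then have s: "16 \<le> S" using S0 by simp
      ultimately show "2160288 * n2 \<le> 53648 * GN + 9360 * SN + 360 * D + 2880 * L"
        using Sm[OF s] Gh DL[unfolded n2] Z Npos n2(2) by linarith
    qed
  next
    case 3
    then have free: "side_free P ?R (3 * (3 * N)) i" using n9 by auto
    obtain h where h: "2 * card {y \<in> hexcells (3 * N) ?R. zero_cell P ?R y} \<le> 6 * (3 * N) * h
        + 3 * N * (3 * N + 1) + 6 * (3 * N + 1)"
      "12 * (3 * N) + 2 * h \<le> core_cut (3 * N) ?R P"
      using core_cut_one_free[OF d m P3 free] by blast
    have "real (2 * card {y \<in> hexcells (3 * N) ?R. zero_cell P ?R y}) \<le> real (6 * (3 * N) * h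
        + 3 * N * (3 * N + 1) + 6 * (3 * N + 1))"
      using h(1) by (simp only: of_nat_le_iff)
    then have Z: "2 * Z \<le> 18 * (real N * real h) + 9 * n2 + 21 * real N + 6"
      unfolding Z_def by (simp add: n2_def algebra_simps)
    have "36 * real N + 2 * real h \<le> G" using h(2) unfolding G_def by linarith
    from Gm[OF this] have Gh: "36 * n2 + 2 * (real N * real h) \<le> GN" .
    show ?thesis
    proof (rule goal)
      have "0 \<le> real N * real h" by simp
      moreover have "f i = 0" "f j = 1" "f k = 1" using 3 by (auto simp: f_def)
      then have s: "20 \<le> S" using S0 by simp
      ultimately show "2160288 * n2 \<le> 53648 * GN + 9360 * SN + 360 * D + 2880 * L"
        using Sm[OF s] Gh DL[unfolded n2] Z Npos n2(2) by linarith
    qed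
  next
    case 4
    show ?thesis
    proof (rule goal)
      have "f i = 1" "f j = 1" "f k = 1" using 4 by (auto simp: f_def)
      then have s: "24 \<le> S" using S0 by simp
      show "2160288 * n2 \<le> 53648 * GN + 9360 * SN + 360 * D + 2880 * L"
        using Sm[OF s] Gm[of 36 0 0] G0 DL12[unfolded n2] Npos by linarith
    qed
  qed
qed

lemma tri_bound:
  assumes "card R = 3" and N: "10 \<le> N" and P: "nonopp P R (9 * N)"
  shows "21.60288 * real N \<le> weighted_cut (face_weight N) R (9 * N - 1) P
      + 0.0288 / real N * real (nonzero_cells P R (9 * N - 1))"
proof -
  obtain i j k where R: "R = {i, j, k}" and d: "distinct [i, j, k]"
    using assms(1) by (auto simp: card_Suc_eq numeral_3_eq_3)
  define F where "F p = side_free P R (9 * N) p" for p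
  have aux: ?thesis if "distinct [a, b, c]" "{a, b, c} = R" "F b \<longrightarrow> F a" "F c \<longrightarrow> F b" for a b c
    using tri_bound_aux[of a b c N P] that N P unfolding F_def by auto
  have "(F i \<longrightarrow> F j) \<and> (F j \<longrightarrow> F k) \<or> (F i \<longrightarrow> F k) \<and> (F k \<longrightarrow> F j) \<or> (F j \<longrightarrow> F i) \<and> (F i \<longrightarrow> F k) \<or>
    (F j \<longrightarrow> F k) \<and> (F k \<longrightarrow> F i) \<or> (F k \<longrightarrow> F i) \<and> (F i \<longrightarrow> F j) \<or> (F k \<longrightarrow> F j) \<and> (F j \<longrightarrow> F i)" by blast
  then show ?thesis
    using aux[of k j i] aux[of j k i] aux[of k i j] aux[of i k j] aux[of j i k] aux[of i j k] d
    unfolding R by (auto simp: insert_commute)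
qed

lemma nonopp_face:
  assumes "nonopp P S n" "h \<in> S"
  shows "nonopp P (S - {h}) n"
proof -
  have "P x = 0 \<or> P x \<in> S - {h} \<and> 0 < x (P x)" if x: "x \<in> lat (S - {h}) n" for x
  proof -
    have "x \<in> lat S n" using x lat_mono[of "S - {h}" S n] assms by (auto simp: nonopp_def)
    then have "P x = 0 \<or> P x \<in> S \<and> 0 < x (P x)" using assms by (auto simp: nonopp_def)
    moreover have "x h = 0" using x by (auto simp: lat_def)
    ultimately show ?thesis by auto
  qed
  with assms show ?thesis by (auto simp: nonopp_def)
qed

lemma sum_pairs4:
  fixes T :: "nat \<Rightarrow> nat \<Rightarrow> 'a::comm_monoid_add"
  assumes "distinct [i, j, k, h]"
  shows "(\<Sum>p\<in>{i, j, k, h}. \<Sum>q\<in>{i, j, k, h} - {p}. T p q)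
    = (T i j + (T i k + T i h)) + ((T j i + (T j k + T j h)) + ((T k i + (T k j + T k h)) + (T h i
        + (T h j + T h k))))"
proof -
  have "{i, j, k, h} - {i} = {j, k, h}" "{i, j, k, h} - {j} = {i, k, h}" "{i, j, k, h} - {k} = {i, j, h}"
    "{i, j, k, h} - {h} = {i, j, k}" using assms by auto
  then show ?thesis using assms by simp
qed

text \<open>All zero cells are moved towards the face opposite to \<open>h\<close>; only those on this face get stuck.\<close>

lemma tetra_bound:
  assumes d: "distinct [i, j, k, h]" and P: "nonopp P {i, j, k, h} (n + 2)"
  shows "6 * nonzero_cells P {i, j, k} (n + 1) \<le> weighted_cut (\<lambda>_ _. 1) {i, j, k, h} (n + 1) P"
proof -
  let ?S = "{i, j, k, h}" and ?R = "{i, j, k}"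
  define B where "B = {y \<in> lat ?R (n + 1). zero_cell P ?R y}"
  have "card (lat ?S (n + 1)) + card ({} :: (nat \<Rightarrow> nat) set)
      \<le> card {y \<in> lat ?S (n + 1). \<not> monochromatic P ?S y} + card (lat ?S n) + card B"
  proof (rule nonmono_count[where dir = "\<lambda>_. h"])
    show "y \<in> B" if "y \<in> lat ?S (n + 1)" "zero_cell P ?S y" "y h = 0" for y
    proof -
      have "?S = insert h ?R" by auto
      then have "y \<in> lat ?R (n + 1)" using lat_insert_zero[of ?R h "n + 1"] that d by auto
      then show ?thesis using that by (auto simp: B_def zero_cell_def)
    qed
  qed (use P d in \<open>auto simp: B_def finite_lat\<close>)
  moreover have "card (lat ?S (n + 1)) = card (lat ?S n) + card (lat ?R (n + 1))"
  proof -
    have "?S = insert h ?R" by auto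
    then show ?thesis using card_lat_Suc[of ?R h n] d by simp
  qed
  moreover have "card (lat ?R (n + 1)) = nonzero_cells P ?R (n + 1) + card B"
  proof -
    have "lat ?R (n + 1) = {y \<in> lat ?R (n + 1). \<not> zero_cell P ?R y} \<union> B" by (auto simp: B_def)
    moreover have "card ({y \<in> lat ?R (n + 1). \<not> zero_cell P ?R y} \<union> B) = card {y \<in> lat ?R (n
        + 1). \<not> zero_cell P ?R y} + card B"
      by (rule card_Un_disjoint) (auto simp: B_def finite_lat)
    ultimately show ?thesis unfolding nonzero_cells_def by simp
  qed
  ultimately have 1: "nonzero_cells P ?R (n + 1) \<le> card {y \<in> lat ?S (n + 1). \<not> monochromatic P ?S y}" by simp
  define f where "f y = (\<Sum>p\<in>?S. \<Sum>q\<in>?S - {p}. (1::nat) * of_bool (P (up p y) \<noteq> P (up q y)))" for y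
  \<comment> \<open>Splitting four vertices into at least two classes cuts at least three of the six
    edges, each counted in both orders.\<close>
  have "6 \<le> f y" if y: "\<not> monochromatic P ?S y" for y
  proof -
    have "P (up i y) \<noteq> P (up j y) \<or> P (up i y) \<noteq> P (up k y) \<or> P (up i y) \<noteq> P (up h y)"
      using y by (auto simp: monochromatic_def)
    then show ?thesis unfolding f_def sum_pairs4[OF d] by (auto simp: of_bool_def)
  qed
  then have "6 * card {y \<in> lat ?S (n + 1). \<not> monochromatic P ?S y} \<le> (\<Sum>y\<in>{y \<in> lat ?S (n
      + 1). \<not> monochromatic P ?S y}. f y)"
    using sum_bounded_below[of "{y \<in> lat ?S (n + 1). \<not> monochromatic P ?S y}" 6 f] by (simp add: mult.commute)
  also have "\<dots> \<le> (\<Sum>y\<in>lat ?S (n + 1). f y)"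
    by (intro sum_mono2) (auto simp: finite_lat)
  finally show ?thesis using 1 by (simp add: weighted_cut_def f_def)
qed

text \<open>The tetrahedral grid pays for the nonzero cells that \<open>tri_bound\<close> charges to
  the face: \<open>0.0288 = 6 * 0.0048\<close>, with the 6 from \<open>tetra_bound\<close>.\<close>

lemma tetra_face_bound:
  assumes S: "card S = 4" "h \<in> S" and N: "10 \<le> N" and P: "nonopp P S (9 * N)"
  shows "21.60288 * real N \<le> weighted_cut (face_weight N) (S - {h}) (9 * N - 1) P
      + 0.0048 / real N * weighted_cut (\<lambda>_ _. 1) S (9 * N - 1) P"
proof -
  have c3: "card (S - {h}) = 3" using S by simp
  then obtain i j k where R: "S - {h} = {i, j, k}" and d: "distinct [i, j, k]"
    by (auto simp: card_Suc_eq numeral_3_eq_3)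
  have S': "S = {i, j, k, h}" "distinct [i, j, k, h]" using R d S(2) by auto
  have n: "9 * N = (9 * N - 2) + 2" "9 * N - 1 = (9 * N - 2) + 1" using N by auto
  have "6 * nonzero_cells P (S - {h}) (9 * N - 1) \<le> weighted_cut (\<lambda>_ _. 1) S (9 * N - 1) P"
    using tetra_bound[OF S'(2), of P "9 * N - 2"] P n unfolding R unfolding S'(1) by simp
  then have "real (6 * nonzero_cells P (S - {h}) (9 * N - 1)) \<le> weighted_cut (\<lambda>_ _. 1) S (9 * N - 1) P"
    using weighted_cut_real[of "\<lambda>_ _. 1" S "9 * N - 1" P] by simp
  then have "0.0048 / real N * real (6 * nonzero_cells P (S - {h}) (9 * N - 1))
      \<le> 0.0048 / real N * weighted_cut (\<lambda>_ _. 1) S (9 * N - 1) P"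
    by (intro mult_left_mono) auto
  then show ?thesis using tri_bound[OF c3 N nonopp_face[OF P S(2)]] by simp
qed

section \<open>Total weights\<close>

definition total_weight :: "(nat \<Rightarrow> nat \<Rightarrow> 'a::semiring_1) \<Rightarrow> nat set \<Rightarrow> nat \<Rightarrow> 'a" where
  "total_weight w S n = (\<Sum>y\<in>lat S n. \<Sum>p\<in>S. \<Sum>q\<in>S - {p}. w (y p) (y q))"

text \<open>The total weight is the cost of a labelling that cuts every edge.\<close>

lemma rainbow:
  fixes y :: "nat \<Rightarrow> nat"
  assumes d: "distinct [i, j, k]" and pq: "p \<in> {i, j, k}" "q \<in> {i, j, k}" "p \<noteq> q"
  defines "P \<equiv> \<lambda>x. (x i + 2 * x j) mod 3"
  shows "P (up p y) \<noteq> P (up q y)"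
proof -
  have "P (up i y) = Suc (P y) mod 3" "P (up j y) = (P y + 2) mod 3" "P (up k y) = P y mod 3"
    using d by (auto simp: P_def mod_simps)
  moreover have "P y < 3" by (simp add: P_def)
  then have "P y = 0 \<or> P y = 1 \<or> P y = 2" by auto
  ultimately show ?thesis using pq d by auto
qed

lemma total_weight_eq_weighted_cut:
  assumes d: "distinct [i, j, k]"
  shows "total_weight w {i, j, k} n = weighted_cut w {i, j, k} n (\<lambda>x. (x i + 2 * x j) mod 3)"
  unfolding total_weight_def weighted_cut_def
proof (intro sum.cong refl)
  fix y p q assume "p \<in> {i, j, k}" "q \<in> {i, j, k} - {p}"
  with rainbow[OF d, of p q y]
  show "w (y p) (y q) = w (y p) (y q) * of_bool ((up p y i + 2 * up p y j) mod 3 \<noteq> (up q y i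
      + 2 * up q y j) mod 3)"
    by auto
qed

lemma line_rainbow:
  assumes d: "distinct [i, j, k]" and abc: "distinct [a, b, c]" "{a, b, c} = {i, j, k}" and t: "e + t < n"
  shows "line (\<lambda>x. (x i + 2 * x j) mod 3) a b c n e t \<noteq> line (\<lambda>x. (x i + 2 * x j) mod 3) a b c n e (Suc t)"
proof -
  obtain u where u: "n = e + t + Suc u" using less_imp_Suc_add[OF t] by auto
  have n1: "n - e - t = Suc u" "n - e - Suc t = u" using u by auto
  have "b \<in> {i, j, k}" "a \<in> {i, j, k}" "b \<noteq> a" using abc by auto
  from rainbow[OF d this, of "pt a b c t u e"]
  show ?thesis unfolding line_def n1 pt_apply[OF abc(1)] pt_upd[OF abc(1)] .
qed

lemma sum_down: "2 * (\<Sum>c<q. n - c) + q * q = q * (2 * n + 1)" if "q \<le> n" for q n :: nat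
  using that by (induction q) (auto simp: algebra_simps)

lemma total_weight_values:
  assumes d: "distinct [i, j, k]" and N: "1 \<le> N"
  shows "total_weight (line_weight (6 * N) (9 * N - 1)) {i, j, k} (9 * N - 1) = 216 * N\<^sup>2 + 18 * N"
    "total_weight (side_weight (\<lambda>t. 3 * N - t) (9 * N - 1)) {i, j, k} (9 * N - 1) = 54 * N\<^sup>2 + 18 * N"
    "total_weight (side_weight (\<lambda>_. 1) (9 * N - 1)) {i, j, k} (9 * N - 1) = 108 * N"
    "total_weight (side_weight (\<lambda>t. N\<^sup>2 - t\<^sup>2) (9 * N - 1)) {i, j, k} (9 * N - 1)
        + total_weight (corner_weight N (9 * N - 1)) {i, j, k} (9 * N - 1)
      = 12 * N ^ 3 + 12 * N\<^sup>2"
proof -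
  let ?n = "9 * N - 1" and ?P = "\<lambda>x. (x i + 2 * x j) mod 3" and ?R = "{i, j, k}"
  have S: "Suc ?n = 9 * N" using N by simp
  have w: "wcuts g (line ?P a b c (9 * N) e) L = (\<Sum>t<L. g t)"
    if "distinct [a, b, c]" "{a, b, c} = ?R" "L \<le> 9 * N - e" for a b c e L g
    unfolding wcuts_def using line_rainbow[OF d that(1,2)] that(3) by (intro sum.cong) auto
  have R: "{i, j, k} = ?R" "{j, k, i} = ?R" "{k, i, j} = ?R" "{j, i, k} = ?R" "{k, j, i} = ?R" "{i, k, j}
      = ?R" by auto
  have dd: "distinct [j, k, i]" "distinct [k, i, j]" "distinct [j, i, k]" "distinct [k, j, i]" "distinct [i, k, j]"
    using d by auto
  note ws = w[OF d R(1)] w[OF dd(1) R(2)] w[OF dd(2) R(3)] w[OF dd(3) R(4)] w[OF dd(4) R(5)] w[OF dd(5) R(6)]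
  have side: "total_weight (side_weight g ?n) ?R ?n = 12 * (\<Sum>t<9 * N. g t)" for g
    unfolding total_weight_eq_weighted_cut[OF d] weighted_cut_side_weight[OF d] S side_cuts_from_def
        by (simp add: ws)
  have q: "6 * N \<le> Suc ?n" "N \<le> Suc ?n" using N by auto
  have "total_weight (line_weight (6 * N) ?n) ?R ?n = 6 * (\<Sum>c<6 * N. 9 * N - c)"
  proof -
    have "line_cuts (6 * N) (9 * N) ?P i j k = (\<Sum>c<6 * N. 3 * (9 * N - c))"
      unfolding line_cuts_def by (intro sum.cong refl) (simp add: ws)
    then show ?thesis
      unfolding total_weight_eq_weighted_cut[OF d] weighted_cut_line_weight[OF d q(1)] S
          by (simp only: sum_distrib_left[symmetric])
  qed
  moreover have "2 * (\<Sum>c<6 * N. 9 * N - c) + 6 * N * (6 * N) = 6 * N * (2 * (9 * N) + 1)"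
    by (rule sum_down) simp
  ultimately show "total_weight (line_weight (6 * N) ?n) ?R ?n = 216 * N\<^sup>2 + 18 * N"
      by (simp add: power2_eq_square algebra_simps)
  have cut: "(\<Sum>t<9 * N. g t) = (\<Sum>t<q. g t)" if "\<And>t. q \<le> t \<Longrightarrow> g t = 0" "q \<le> 9 * N" for g :: "nat \<Rightarrow> nat" and q
    using that by (intro sum.mono_neutral_right) (auto simp: not_less)
  have "(\<Sum>t<9 * N. 3 * N - t) = (\<Sum>t<3 * N. 3 * N - t)" by (rule cut) auto
  moreover have "2 * (\<Sum>c<3 * N. 3 * N - c) + 3 * N * (3 * N) = 3 * N * (2 * (3 * N) + 1)"
    by (rule sum_down) simp
  ultimately show "total_weight (side_weight (\<lambda>t. 3 * N - t) ?n) ?R ?n = 54 * N\<^sup>2 + 18 * N"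
    unfolding side by (simp add: power2_eq_square algebra_simps)
  show "total_weight (side_weight (\<lambda>_. 1) ?n) ?R ?n = 108 * N" unfolding side by simp
  have trunc: "(\<Sum>t<9 * N. N\<^sup>2 - t\<^sup>2) = (\<Sum>t<N. N\<^sup>2 - t\<^sup>2)" by (rule cut) (auto simp: power_mono)
  have sq: "6 * (\<Sum>t<q. N\<^sup>2 - t\<^sup>2) + 2 * q ^ 3 + q = 6 * q * N\<^sup>2 + 3 * q\<^sup>2" if "q \<le> N" for q
    using that
  proof (induction q)
    case (Suc q)
    then have "q\<^sup>2 \<le> N\<^sup>2" by (intro power_mono) auto
    then obtain u where "N\<^sup>2 = q\<^sup>2 + u" using le_Suc_ex by blast
    then show ?case using Suc by (simp add: power2_eq_square power3_eq_cube algebra_simps)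
  qed simp
  have A: "6 * (\<Sum>t<9 * N. N\<^sup>2 - t\<^sup>2) + N = 4 * N ^ 3 + 3 * N\<^sup>2"
  proof -
    have "6 * N * N\<^sup>2 = 6 * N ^ 3" by (simp add: power2_eq_square power3_eq_cube)
    with sq[of N] trunc show ?thesis by linarith
  qed
  have "total_weight (corner_weight N ?n) ?R ?n = 6 * (\<Sum>s=1..N. 2 * s * s)"
    unfolding total_weight_eq_weighted_cut[OF d] weighted_cut_corner_weight[OF d q(2)] S corner_cuts_def
        using N by (simp add: ws)
  moreover have "6 * (\<Sum>s=1..M. 2 * s * s) = 4 * M ^ 3 + 6 * M\<^sup>2 + 2 * M" for M :: nat
    by (induction M) (auto simp: power2_eq_square power3_eq_cube algebra_simps)
  ultimately have B: "total_weight (corner_weight N ?n) ?R ?n = 4 * N ^ 3 + 6 * N\<^sup>2 + 2 * N" by simp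
  show "total_weight (side_weight (\<lambda>t. N\<^sup>2 - t\<^sup>2) ?n) ?R ?n + total_weight (corner_weight N ?n) ?R ?n
      = 12 * N ^ 3 + 12 * N\<^sup>2"
    unfolding side B using A by simp
qed

lemma total_weight_real: "total_weight (\<lambda>a b. real (w a b)) S n = real (total_weight w S n)"
  by (simp add: total_weight_def)

lemma total_weight_linear:
  fixes w w' :: "nat \<Rightarrow> nat \<Rightarrow> real"
  shows "total_weight (\<lambda>a b. w a b + w' a b) S n = total_weight w S n + total_weight w' S n"
    "total_weight (\<lambda>a b. x * w a b) S n = x * total_weight w S n"
  by (simp_all only: total_weight_def distrib_right sum.distrib sum_distrib_left mult.assoc)

lemma total_weight_face_weight:
  assumes "card R = 3" and N: "1 \<le> N"
  shows "total_weight (face_weight N) R (9 * N - 1) = 155.0016 * (real N)\<^sup>2 + 19.35648 * real N"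
proof -
  obtain i j k where R: "R = {i, j, k}" and d: "distinct [i, j, k]"
    using assms(1) by (auto simp: card_Suc_eq numeral_3_eq_3)
  note v = total_weight_values[OF d N]
  have "total_weight (face_weight N) R (9 * N - 1) = 0.53648 * (real (216 * N\<^sup>2 + 18 * N)
      + real (54 * N\<^sup>2 + 18 * N))
     + 0.0936 * real N * real (108 * N) + 0.0036 / real N * real (12 * N ^ 3 + 12 * N\<^sup>2)"
    unfolding face_weight_def total_weight_linear total_weight_real R v(1-3) v(4)[symmetric] of_nat_add by simp
  also have "0.0036 / real N * real (12 * N ^ 3 + 12 * N\<^sup>2) = 0.0432 * (real N)\<^sup>2 + 0.0432 * real N"
    using N by (simp add: field_simps power2_eq_square power3_eq_cube)
  finally show ?thesis by (simp add: power2_eq_square field_simps)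
qed

lemma total_weight_tetra:
  assumes "card S = 4" and N: "1 \<le> N"
  shows "0.0048 / real N * total_weight (\<lambda>_ _. 1) S (9 * N - 1) \<le> 6.9984 * (real N)\<^sup>2 + 2.5056 * real N"
proof -
  obtain i j k h where S: "S = {i, j, k, h}" and d: "distinct [i, j, k, h]"
    using assms(1) by (auto simp: card_Suc_eq numeral_eq_Suc)
  have "total_weight (\<lambda>_ _. 1 :: real) S (9 * N - 1) = 12 * real (card (lat S (9 * N - 1)))"
    unfolding total_weight_def S sum_pairs4[OF d] by simp
  moreover have "6 * card (lat S (9 * N - 1)) = 9 * N * (9 * N + 1) * (9 * N + 2)"
    using card_lat4[OF d, of "9 * N - 1"] N by (simp add: S)
  then have "real (6 * card (lat S (9 * N - 1))) = real (9 * N * (9 * N + 1) * (9 * N + 2))" by (simp only:)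
  then have "6 * real (card (lat S (9 * N - 1))) = 9 * real N * (9 * real N + 1) * (9 * real N + 2)"
    unfolding of_nat_mult of_nat_add of_nat_numeral of_nat_1 .
  ultimately have "total_weight (\<lambda>_ _. 1 :: real) S (9 * N - 1) = 2 * (9 * real N * (9 * real N
      + 1) * (9 * real N + 2))" by argo
  then have "0.0048 / real N * total_weight (\<lambda>_ _. 1) S (9 * N - 1) = 0.0864 * (9 * real N + 1) * (9 * real N + 2)"
    using N by (simp add: field_simps)
  also have "\<dots> \<le> 6.9984 * (real N)\<^sup>2 + 2.5056 * real N"
    using N by (simp add: power2_eq_square algebra_simps)
  finally show ?thesis .
qed

section \<open>From labellings to multiway cuts\<close>

lemma l1_dist_triangle: "l1_dist k x z \<le> l1_dist k x y + l1_dist k y z"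
  unfolding l1_dist_def sum.distrib[symmetric] by (intro sum_mono) linarith

lemma l1_dist_path: "l1_dist k (f 0) (f n) \<le> (\<Sum>t<n. l1_dist k (f t) (f (Suc t)))"
proof (induction n)
  case (Suc n)
  then show ?case using l1_dist_triangle[of k "f 0" "f (Suc n)" "f n"] by simp
qed (simp add: l1_dist_def)

text \<open>The copies overlap and list each edge in both orders, whereas an instance has one weight
  per vertex pair. So \<open>w\<close> adds up all indices with the same pair, and costs can be
  computed as sums over indices.\<close>

locale edge_family =
  fixes I :: "'i set" and a b :: "'i \<Rightarrow> nat" and c :: "'i \<Rightarrow> real" and V :: "nat set" and K :: nat and t ::
      "nat \<Rightarrow> nat"
  assumes finI: "finite I" and c_nonneg: "\<And>\<tau>. \<tau> \<in> I \<Longrightarrow> 0 \<le> c \<tau>"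
    and ends: "\<And>\<tau>. \<tau> \<in> I \<Longrightarrow> a \<tau> \<in> V \<and> b \<tau> \<in> V \<and> a \<tau> \<noteq> b \<tau>"
    and finV: "finite V" and K: "1 \<le> K" and t: "inj_on t {1..K}" "t ` {1..K} \<subseteq> V"
begin

definition E :: "nat set set" where "E = (\<lambda>\<tau>. {a \<tau>, b \<tau>}) ` I"

definition w :: "nat set \<Rightarrow> real" where "w e = (\<Sum>\<tau>\<in>{\<tau> \<in> I. {a \<tau>, b \<tau>} = e}. c \<tau>)"

lemma instance_ok: "multiway_cut_instance V E w K t"
  unfolding multiway_cut_instance_def
  using finV K t ends c_nonneg by (auto simp: E_def w_def intro!: sum_nonneg)

lemma sum_E: "(\<Sum>e\<in>{e \<in> E. Q e}. w e * f e) = (\<Sum>\<tau>\<in>{\<tau> \<in> I. Q {a \<tau>, b \<tau>}}. c \<tau> * f {a \<tau>, b \<tau>})"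
proof -
  have "(\<Sum>e\<in>{e \<in> E. Q e}. w e * f e) = (\<Sum>e\<in>{e \<in> E. Q e}. \<Sum>\<tau>\<in>{\<tau> \<in> {\<tau> \<in> I. Q {a \<tau>, b \<tau>}}. {a \<tau>, b \<tau>}
      = e}. c \<tau> * f {a \<tau>, b \<tau>})"
    unfolding w_def sum_distrib_right by (intro sum.cong) auto
  also have "\<dots> = (\<Sum>\<tau>\<in>{\<tau> \<in> I. Q {a \<tau>, b \<tau>}}. c \<tau> * f {a \<tau>, b \<tau>})"
    using finI by (intro sum.group) (auto simp: E_def)
  finally show ?thesis .
qed

lemma ckr_value_eq: "ckr_value E w K x = 1/2 * (\<Sum>\<tau>\<in>I. c \<tau> * l1_dist K (x (a \<tau>)) (x (b \<tau>)))"
  using sum_E[where Q = "\<lambda>_. True" and f = "edge_length K x"] by (simp add: ckr_value_def edge_length_insert)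

lemma ckr_opt_le:
  assumes "ckr_feasible V K t x"
  shows "ckr_opt V E w K t \<le> ckr_value E w K x"
  unfolding ckr_opt_def
proof (rule cInf_lower)
  show "bdd_below (ckr_value E w K ` {x. ckr_feasible V K t x})"
    using ckr_value_nonneg[OF instance_ok] by (intro bdd_belowI[of _ 0]) auto
qed (use assms in auto)

lemma ckr_opt_ge:
  assumes "\<And>x. ckr_feasible V K t x \<Longrightarrow> z \<le> ckr_value E w K x"
  shows "z \<le> ckr_opt V E w K t"
  unfolding ckr_opt_def
  using ckr_feasible_exists[OF instance_ok] assms by (intro cInf_greatest) auto

text \<open>Labelling each vertex with the index of the terminal in its part turns a partition into
  a labelling, and an edge with two labels joins two parts.\<close>

lemma integral_opt_ge:
  assumes lab: "\<And>lab. \<lbrakk>\<And>v. v \<in> V \<Longrightarrow> lab v \<in> {1..K}; \<And>i. i \<in> {1..K} \<Longrightarrow> lab (t i) = i\<rbrakk>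
     \<Longrightarrow> z \<le> (\<Sum>\<tau>\<in>I. c \<tau> * of_bool (lab (a \<tau>) \<noteq> (lab (b \<tau>) :: nat)))"
  shows "z \<le> integral_opt V E w K t"
proof -
  have "z \<le> cut_weight E w P" if P: "multiway_cut V K t P" for P
  proof -
    have part: "partition_on V P" and uniq: "\<And>A. A \<in> P \<Longrightarrow> \<exists>!s. s \<in> A \<inter> t ` {1..K}"
      using P by (auto simp: multiway_cut_def)
    have same: "A = B" if "A \<in> P" "B \<in> P" "v \<in> A" "v \<in> B" for A B v
      using partition_onD2[OF part] that by (auto simp: disjoint_def)
    define lab where "lab v = (SOME i. i \<in> {1..K} \<and> (\<exists>A\<in>P. v \<in> A \<and> t i \<in> A))" for v
    have labv: "lab v \<in> {1..K} \<and> (\<exists>A\<in>P. v \<in> A \<and> t (lab v) \<in> A)" if "v \<in> V" for v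
    proof -
      have "v \<in> \<Union>P" using partition_onD1[OF part] that by simp
      then obtain A where A: "A \<in> P" "v \<in> A" by blast
      then obtain i where "i \<in> {1..K}" "t i \<in> A" using uniq[OF A(1)] by blast
      with A have "\<exists>i. i \<in> {1..K} \<and> (\<exists>A\<in>P. v \<in> A \<and> t i \<in> A)" by blast
      from someI_ex[OF this] show ?thesis unfolding lab_def .
    qed
    have "lab (t i) = i" if i: "i \<in> {1..K}" for i
    proof -
      have "t i \<in> V" using t i by auto
      then obtain A where A: "A \<in> P" "t i \<in> A" "t (lab (t i)) \<in> A" "lab (t i) \<in> {1..K}" using labv by blast
      then have "t (lab (t i)) = t i" using uniq[OF A(1)] i by blast
      then show ?thesis using inj_onD[OF t(1)] A(4) i by blast
    qed
    then have "z \<le> (\<Sum>\<tau>\<in>I. c \<tau> * of_bool (lab (a \<tau>) \<noteq> lab (b \<tau>)))"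
      using labv by (intro lab) auto
    also have "\<dots> \<le> (\<Sum>\<tau>\<in>I. if {a \<tau>, b \<tau>} \<in> cut_edges E P then c \<tau> else 0)"
    proof (rule sum_mono)
      fix \<tau> assume \<tau>: "\<tau> \<in> I"
      show "c \<tau> * of_bool (lab (a \<tau>) \<noteq> lab (b \<tau>)) \<le> (if {a \<tau>, b \<tau>} \<in> cut_edges E P then c \<tau> else 0)"
      proof (cases "lab (a \<tau>) = lab (b \<tau>)")
        case False
        have "a \<tau> \<in> \<Union>P" "b \<tau> \<in> \<Union>P" using ends[OF \<tau>] partition_onD1[OF part] by simp_all
        then obtain A B where AB: "A \<in> P" "a \<tau> \<in> A" "B \<in> P" "b \<tau> \<in> B" by blast
        have "A \<noteq> B"
        proof
          assume "A = B"
          then have "(\<exists>A\<in>P. a \<tau> \<in> A \<and> t i \<in> A) \<longleftrightarrow> (\<exists>A\<in>P. b \<tau> \<in> A \<and> t i \<in> A)" for i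
            using AB same by blast
          then have "lab (a \<tau>) = lab (b \<tau>)" by (simp add: lab_def)
          with False show False ..
        qed
        then have "{a \<tau>, b \<tau>} \<in> cut_edges E P" using AB \<tau> unfolding cut_edges_def E_def by blast
        then show ?thesis using c_nonneg[OF \<tau>] by simp
      qed (use c_nonneg[OF \<tau>] in simp)
    qed
    also have "\<dots> = (\<Sum>\<tau>\<in>{\<tau> \<in> I. {a \<tau>, b \<tau>} \<in> cut_edges E P}. c \<tau>)"
      using finI by (subst sum.inter_filter) auto
    also have "\<dots> = (\<Sum>e\<in>{e \<in> E. e \<in> cut_edges E P}. w e)"
      using sum_E[where Q = "\<lambda>e. e \<in> cut_edges E P" and f = "\<lambda>_. 1"] by simp
    also have "\<dots> = cut_weight E w P"
      unfolding cut_weight_def by (intro sum.cong) (auto simp: cut_edges_def)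
    finally show ?thesis .
  qed
  then show ?thesis
    unfolding integral_opt_def using multiway_cut_exists[OF instance_ok] by (intro cInf_greatest) auto
qed

end

section \<open>One copy per tetrahedron and face, and the bad tetrahedra\<close>

text \<open>Only the face opposite to \<open>h\<close> carries the face weight. The instance sums
  over all \<open>h\<close> in \<open>S\<close>, so no face has to be singled out and both bounds
  are multiplied by 4.\<close>

definition tetra_weight :: "nat \<Rightarrow> nat set \<Rightarrow> nat \<Rightarrow> (nat \<Rightarrow> nat) \<Rightarrow> nat \<Rightarrow> nat \<Rightarrow> real" where
  "tetra_weight N S h y p q = 0.0048 / real N + (if y h = 0 \<and> p \<noteq> h \<and> q \<noteq> h then face_weight N (y p) (y q) else 0)"

lemma sum_tetra_weight:
  assumes S: "finite S" "h \<in> S"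
  shows "(\<Sum>y\<in>lat S n. \<Sum>p\<in>S. \<Sum>q\<in>S - {p}. tetra_weight N S h y p q * f y p q)
    = (\<Sum>y\<in>lat (S - {h}) n. \<Sum>p\<in>S - {h}. \<Sum>q\<in>S - {h} - {p}. face_weight N (y p) (y q) * f y p q)
      + 0.0048 / real N * (\<Sum>y\<in>lat S n. \<Sum>p\<in>S. \<Sum>q\<in>S - {p}. f y p q)"
proof -
  let ?g = "\<lambda>y p q. (if y h = 0 \<and> p \<noteq> h \<and> q \<noteq> h then face_weight N (y p) (y q) * f y p q else 0)"
  have ins: "insert h (S - {h}) = S" using S by auto
  have "(\<Sum>y\<in>lat S n. \<Sum>p\<in>S. \<Sum>q\<in>S - {p}. tetra_weight N S h y p q * f y p q)
    = (\<Sum>y\<in>lat S n. \<Sum>p\<in>S. \<Sum>q\<in>S - {p}. ?g y p q + 0.0048 / real N * f y p q)"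
    unfolding tetra_weight_def by (intro sum.cong refl) (simp add: algebra_simps)
  also have "\<dots> = (\<Sum>y\<in>lat S n. \<Sum>p\<in>S. \<Sum>q\<in>S - {p}. ?g y p q)
     + 0.0048 / real N * (\<Sum>y\<in>lat S n. \<Sum>p\<in>S. \<Sum>q\<in>S - {p}. f y p q)"
    by (simp only: sum.distrib sum_distrib_left)
  also have "(\<Sum>y\<in>lat S n. \<Sum>p\<in>S. \<Sum>q\<in>S - {p}. ?g y p q) = (\<Sum>y\<in>lat (S - {h}) n. \<Sum>p\<in>S. \<Sum>q\<in>S - {p}. ?g y p q)"
  proof (rule sum.mono_neutral_right)
    show "lat (S - {h}) n \<subseteq> lat S n" by (rule lat_mono) (use S in auto)
    show "\<forall>y\<in>lat S n - lat (S - {h}) n. (\<Sum>p\<in>S. \<Sum>q\<in>S - {p}. ?g y p q) = 0"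
    proof
      fix y assume y: "y \<in> lat S n - lat (S - {h}) n"
      have face: "{x \<in> lat S n. x h = 0} = lat (S - {h}) n"
        using lat_insert_zero[of "S - {h}" h n, unfolded ins] S by simp
      have "y h \<noteq> 0" using y unfolding face[symmetric] by simp
      then show "(\<Sum>p\<in>S. \<Sum>q\<in>S - {p}. ?g y p q) = 0" by simp
    qed
  qed (use S finite_lat in auto)
  also have "\<dots> = (\<Sum>y\<in>lat (S - {h}) n. \<Sum>p\<in>S - {h}. \<Sum>q\<in>S - {h} - {p}. face_weight N (y p) (y q) * f y p q)"
  proof (rule sum.cong[OF refl])
    fix y assume "y \<in> lat (S - {h}) n"
    then have yh: "y h = 0" by (auto simp: lat_def)
    have "(\<Sum>p\<in>S. \<Sum>q\<in>S - {p}. ?g y p q) = (\<Sum>p\<in>S - {h}. \<Sum>q\<in>S - {p}. ?g y p q)"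
      using S by (intro sum.mono_neutral_right) auto
    also have "\<dots> = (\<Sum>p\<in>S - {h}. \<Sum>q\<in>S - {h} - {p}. ?g y p q)"
      using S by (intro sum.cong[OF refl] sum.mono_neutral_right) auto
    also have "\<dots> = (\<Sum>p\<in>S - {h}. \<Sum>q\<in>S - {h} - {p}. face_weight N (y p) (y q) * f y p q)"
      using yh by (intro sum.cong refl) auto
    finally show "(\<Sum>p\<in>S. \<Sum>q\<in>S - {p}. ?g y p q)
        = (\<Sum>p\<in>S - {h}. \<Sum>q\<in>S - {h} - {p}. face_weight N (y p) (y q) * f y p q)" .
  qed
  finally show ?thesis .
qed

definition bad_tetra :: "((nat \<Rightarrow> nat) \<Rightarrow> nat) \<Rightarrow> nat \<Rightarrow> nat set \<Rightarrow> bool" where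
  "bad_tetra P n S \<longleftrightarrow> (\<exists>x\<in>lat S n. P x \<in> S \<and> x (P x) = 0)"

text \<open>A bad \<open>S\<close> is recovered from a point \<open>x\<close> and the face \<open>S - {P x}\<close> that contains it, so bad sets are
    rarer by a factor
  of order \<open>card A\<close> than all 4-sets.\<close>

lemma card_bad_tetra:
  assumes A: "finite A"
  shows "2 * card {S. S \<subseteq> A \<and> card S = 4 \<and> bad_tetra P n S} \<le> (card A choose 3) * ((n + 1) * (n + 2))"
proof -
  define X where "X S = (SOME x. x \<in> lat S n \<and> P x \<in> S \<and> x (P x) = 0)" for S
  have X: "X S \<in> lat S n" "P (X S) \<in> S" "X S (P (X S)) = 0" if "bad_tetra P n S" for S
    using someI_ex[of "\<lambda>x. x \<in> lat S n \<and> P x \<in> S \<and> x (P x) = 0"] that unfolding bad_tetra_def X_def by blast+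
  define B where "B = {S. S \<subseteq> A \<and> card S = 4 \<and> bad_tetra P n S}"
  define F where "F = {R. R \<subseteq> A \<and> card R = 3}"
  have finF: "finite F" using A by (simp add: F_def)
  have finR: "finite R" if "R \<in> F" for R using that A finite_subset by (auto simp: F_def)
  have "card B \<le> card (SIGMA R:F. lat R n)"
  proof (rule card_inj_on_le[of "\<lambda>S. (S - {P (X S)}, X S)"])
    show "inj_on (\<lambda>S. (S - {P (X S)}, X S)) B"
    proof (rule inj_onI)
      fix S S' assume "S \<in> B" "S' \<in> B" "(S - {P (X S)}, X S) = (S' - {P (X S')}, X S')"
      then have e: "S - {P (X S)} = S' - {P (X S')}" "X S = X S'" and b: "bad_tetra P n S" "bad_tetra P n S'"
        by (auto simp: B_def)
      from e(1) X(2)[OF b(1)] X(2)[OF b(2)] show "S = S'" unfolding e(2) by blast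
    qed
    show "(\<lambda>S. (S - {P (X S)}, X S)) ` B \<subseteq> (SIGMA R:F. lat R n)"
    proof safe
      fix S assume "S \<in> B"
      then have S: "S \<subseteq> A" "card S = 4" "bad_tetra P n S" by (auto simp: B_def)
      note X = X[OF S(3)]
      have fS: "finite S" using S(1) A finite_subset by blast
      show "S - {P (X S)} \<in> F" using S X(2) by (auto simp: F_def)
      have "insert (P (X S)) (S - {P (X S)}) = S" using X(2) by auto
      then show "X S \<in> lat (S - {P (X S)}) n"
        using lat_insert_zero[of "S - {P (X S)}" "P (X S)" n] fS X by auto
    qed
    show "finite (SIGMA R:F. lat R n)" using finF finR finite_lat by blast
  qed
  also have "\<dots> = (\<Sum>R\<in>F. card (lat R n))" using finF finR finite_lat by (intro card_SigmaI) auto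
  finally have "2 * card B \<le> (\<Sum>R\<in>F. 2 * card (lat R n))" unfolding sum_distrib_left[symmetric] by simp
  also have "\<dots> = (\<Sum>R\<in>F. (n + 1) * (n + 2))"
  proof (rule sum.cong[OF refl])
    fix R assume "R \<in> F"
    then obtain i j k where "R = {i, j, k}" "distinct [i, j, k]" by (auto simp: F_def card_Suc_eq numeral_3_eq_3)
    then show "2 * card (lat R n) = (n + 1) * (n + 2)" using card_lat3 by simp
  qed
  also have "\<dots> = (card A choose 3) * ((n + 1) * (n + 2))" using n_subsets[OF A, of 3] by (simp add: F_def)
  finally show ?thesis by (simp add: B_def)
qed

section \<open>The instance\<close>

lemma tetra_weight_ge: "0.0048 / real N \<le> tetra_weight N S h y p q"
  by (simp add: tetra_weight_def face_weight_nonneg)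

lemma tetra_weight_nonneg: "0 \<le> tetra_weight N S h y p q"
  by (rule order_trans[OF _ tetra_weight_ge]) simp

text \<open>Merging all labels outside \<open>S\<close> into 0 can only remove cuts, and on a good
  \<open>S\<close> the result satisfies \<open>nonopp\<close>.\<close>

lemma good_tetra_cost:
  assumes S: "card S = 4" "0 \<notin> S" and N: "10 \<le> N" and h: "h \<in> S"
    and good: "\<not> bad_tetra P (9 * N) S" and vert: "\<And>i. i \<in> S \<Longrightarrow> P (vert (9 * N) i) = i"
  shows "21.60288 * real N
      \<le> (\<Sum>y\<in>lat S (9 * N - 1). \<Sum>p\<in>S. \<Sum>q\<in>S - {p}. tetra_weight N S h y p q * of_bool (P (up p y) \<noteq> P (up q y)))"
proof -
  define P' where "P' x = (if P x \<in> S then P x else 0)" for x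
  have fin: "finite S" using S by (simp add: card_ge_0_finite)
  have "nonopp P' S (9 * N)"
    unfolding nonopp_def
  proof (intro conjI ballI)
    fix x assume "x \<in> lat S (9 * N)"
    then show "P' x = 0 \<or> P' x \<in> S \<and> 0 < x (P' x)"
      using good unfolding bad_tetra_def P'_def by auto
  qed (use fin S vert in \<open>auto simp: P'_def\<close>)
  from tetra_face_bound[OF S(1) h N this]
  have "21.60288 * real N
      \<le> (\<Sum>y\<in>lat S (9 * N - 1). \<Sum>p\<in>S. \<Sum>q\<in>S - {p}. tetra_weight N S h y p q * of_bool (P' (up p y) \<noteq> P' (up q y)))"
    unfolding sum_tetra_weight[OF fin h] weighted_cut_def by simp
  also have "\<dots> \<le> (\<Sum>y\<in>lat S (9 * N - 1). \<Sum>p\<in>S. \<Sum>q\<in>S - {p}. tetra_weight N S h y p q * of_bool (P (up p y)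
      \<noteq> P (up q y)))"
    by (intro sum_mono mult_left_mono tetra_weight_nonneg) (auto simp: P'_def)
  finally show ?thesis .
qed

text \<open>The constants of the weights are scaled so that the leading terms
  \<open>155.0016 + 6.9984\<close> give \<open>162 = 9 * 18\<close>. Division by
  \<open>9 * N\<close> leaves \<open>18 * N\<close>, and
  \<open>21.60288 / 18 = 1.20016\<close>.\<close>

lemma tetra_weight_sum_le:
  assumes S: "card S = 4" and N: "1 \<le> N" and h: "h \<in> S"
  shows "(\<Sum>y\<in>lat S (9 * N - 1). \<Sum>p\<in>S. \<Sum>q\<in>S - {p}. tetra_weight N S h y p q) \<le> 162 * (real N)\<^sup>2 + 22.5 * real N"
proof -
  have fin: "finite S" using S by (simp add: card_ge_0_finite)
  have "(\<Sum>y\<in>lat S (9 * N - 1). \<Sum>p\<in>S. \<Sum>q\<in>S - {p}. tetra_weight N S h y p q)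
    = total_weight (face_weight N) (S - {h}) (9 * N - 1) + 0.0048 / real N * total_weight (\<lambda>_ _. 1) S (9 * N - 1)"
    using sum_tetra_weight[OF fin h, where f = "\<lambda>_ _ _. 1"] unfolding total_weight_def mult_1_right .
  also have "\<dots> \<le> (155.0016 * (real N)\<^sup>2 + 19.35648 * real N) + (6.9984 * (real N)\<^sup>2 + 2.5056 * real N)"
    using total_weight_face_weight[of "S - {h}" N] total_weight_tetra[OF S N] S N h by (intro add_mono) simp_all
  also have "\<dots> \<le> 162 * (real N)\<^sup>2 + 22.5 * real N" by simp
  finally show ?thesis .
qed

lemma gap_instance:
  assumes N: "10 \<le> N" and K4: "4 \<le> K"
  shows "\<exists>(V :: nat set) E w t. multiway_cut_instance V E w K t \<and> 0 < ckr_opt V E w K t \<and>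
    ckr_opt V E w K t \<le> real (K choose 4) * (4 * (18 * real N + 2.5)) \<and>
    (real (K choose 4) - real (K choose 3) * (real ((9 * N + 1) * (9 * N + 2)) / 2)) * (4 * (21.60288 * real N))
      \<le> integral_opt V E w K t"
proof -
  let ?n = "9 * N" and ?m = "9 * N - 1"
  have Sm: "Suc ?m = ?n" using N by simp
  define A where "A = {1..K}"
  define F where "F = {S. S \<subseteq> A \<and> card S = 4}"
  have finA: "finite A" and cardA: "card A = K" by (auto simp: A_def)
  have finF: "finite F" using finA by (simp add: F_def)
  have FD: "finite S" "card S = 4" "S \<subseteq> A" "0 \<notin> S" if "S \<in> F" for S
    using that finA finite_subset by (auto simp: F_def A_def)
  have cardF: "card F = K choose 4" using n_subsets[OF finA, of 4] by (simp add: F_def cardA)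
  \<comment> \<open>Points in several simplices occur once in this union, so a single labelling has
    to serve all \<open>S\<close> in \<open>F\<close>.\<close>
  define U where "U = (\<Union>S\<in>F. lat S ?n)"
  have finU: "finite U" using finF FD finite_lat by (auto simp: U_def)
  obtain g :: "(nat \<Rightarrow> nat) \<Rightarrow> nat" where g: "inj_on g U"
    using finite_imp_inj_to_nat_seg[OF finU] by blast
  define t where "t i = g (vert ?n i)" for i
  define V where "V = g ` U"
  define I where "I = (SIGMA S:F. SIGMA h:S. SIGMA y:lat S ?m. SIGMA p:S. S - {p})"
  define a where "a = (\<lambda>(S :: nat set, h :: nat, y, p, q :: nat). g (up p y))"
  define b where "b = (\<lambda>(S :: nat set, h :: nat, y, p :: nat, q). g (up q y))"
  define c where "c = (\<lambda>(S, h, y, p, q). tetra_weight N S h y p q)"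
  have finI: "finite I"
    unfolding I_def using finF FD(1) finite_lat by (intro finite_SigmaI) auto
  have sumI: "(\<Sum>\<tau>\<in>I. case \<tau> of (S, h, y, p, q) \<Rightarrow> G S h y p q)
      = (\<Sum>S\<in>F. \<Sum>h\<in>S. \<Sum>y\<in>lat S ?m. \<Sum>p\<in>S. \<Sum>q\<in>S - {p}. G S h y p q)" for G :: "_ \<Rightarrow> _ \<Rightarrow> _ \<Rightarrow> _ \<Rightarrow> _ \<Rightarrow> real"
  proof -
    have "(\<Sum>S\<in>F. \<Sum>h\<in>S. \<Sum>y\<in>lat S ?m. \<Sum>p\<in>S. \<Sum>q\<in>S - {p}. G S h y p q)
      = (\<Sum>S\<in>F. \<Sum>h\<in>S. \<Sum>y\<in>lat S ?m. \<Sum>(p, q)\<in>(SIGMA p:S. S - {p}). G S h y p q)"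
      using FD(1) by (intro sum.cong[OF refl] sum.Sigma) auto
    also have "\<dots> = (\<Sum>S\<in>F. \<Sum>h\<in>S. \<Sum>(y, p, q)\<in>(SIGMA y:lat S ?m. SIGMA p:S. S - {p}). G S h y p q)"
      using FD(1) finite_lat by (intro sum.cong[OF refl] sum.Sigma) auto
    also have "\<dots> = (\<Sum>S\<in>F. \<Sum>(h, y, p, q)\<in>(SIGMA h:S. SIGMA y:lat S ?m. SIGMA p:S. S - {p}). G S h y p q)"
      using FD(1) finite_lat by (intro sum.cong[OF refl] sum.Sigma) auto
    also have "\<dots> = (\<Sum>(S, h, y, p, q)\<in>I. G S h y p q)"
      unfolding I_def using finF FD(1) finite_lat by (intro sum.Sigma) auto
    finally show ?thesis by simp
  qed
  have up_U: "up p y \<in> U" if "S \<in> F" "y \<in> lat S ?m" "p \<in> S" for S y p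
    using up_lat[OF that(2) FD(1)[OF that(1)] that(3)] that(1) unfolding U_def Sm by blast
  have cover: "\<exists>S\<in>F. i \<in> S" if i: "i \<in> A" for i
  proof -
    have "3 \<le> card (A - {i})" using i K4 cardA finA by simp
    then obtain R where R: "R \<subseteq> A - {i}" "card R = 3" "finite R" by (rule obtain_subset_with_card_n)
    moreover have "i \<notin> R" using R by blast
    ultimately have "insert i R \<in> F" using i by (auto simp: F_def)
    then show ?thesis by blast
  qed
  have vert_U: "vert ?n i \<in> U" if "i \<in> A" for i
    using cover[OF that] vert_lat FD(1) unfolding U_def by blast
  interpret edge_family I a b c V K t
  proof
    show "finite I" by (rule finI)
    show "0 \<le> c \<tau>" for \<tau> by (auto simp: c_def tetra_weight_nonneg split: prod.splits)
    show "finite V" using finU by (simp add: V_def)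
    show "1 \<le> K" using K4 by simp
    show "inj_on t {1..K}"
    proof (rule inj_onI)
      fix i j assume ij: "i \<in> {1..K}" "j \<in> {1..K}" "t i = t j"
      then have "vert ?n i = vert ?n j"
        using inj_onD[OF g, of "vert ?n i" "vert ?n j"] vert_U by (simp add: t_def A_def)
      then have "vert ?n i i = vert ?n j i" by simp
      then show "i = j" using N by (auto simp: vert_def split: if_splits)
    qed
    show "t ` {1..K} \<subseteq> V" using vert_U by (auto simp: t_def V_def A_def)
    show "a \<tau> \<in> V \<and> b \<tau> \<in> V \<and> a \<tau> \<noteq> b \<tau>" if "\<tau> \<in> I" for \<tau>
    proof -
      obtain S h y p q where \<tau>1: "\<tau> = (S, h, y, p, q)" by (cases \<tau>)
      then have \<tau>: "\<tau> = (S, h, y, p, q)" "S \<in> F" "y \<in> lat S ?m" "p \<in> S" "q \<in> S" "p \<noteq> q"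
        using \<open>\<tau> \<in> I\<close> by (auto simp: I_def)
      have "up p y p \<noteq> up q y p" using \<tau> by simp
      then have "up p y \<noteq> up q y" by metis
      moreover have "up p y \<in> U" "up q y \<in> U" using up_U \<tau> by blast+
      ultimately show ?thesis using inj_onD[OF g] \<tau>(1) by (auto simp: a_def b_def V_def)
    qed
  qed
  have lower: "(real (K choose 4) - real (K choose 3) * (real ((?n + 1) * (?n
      + 2)) / 2)) * (4 * (21.60288 * real N)) \<le> integral_opt V E w K t"
  proof (rule integral_opt_ge)
    fix lab assume lab: "\<And>v. v \<in> V \<Longrightarrow> lab v \<in> {1..K}" "\<And>i. i \<in> {1..K} \<Longrightarrow> lab (t i) = (i :: nat)"
    define P where "P x = lab (g x)" for x
    define X where "X S
        = (\<Sum>h\<in>S. \<Sum>y\<in>lat S ?m. \<Sum>p\<in>S. \<Sum>q\<in>S - {p}. tetra_weight N S h y p q * of_bool (P (up p y)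
        \<noteq> P (up q y)))" for S
    define B where "B = {S \<in> F. bad_tetra P ?n S}"
    have B: "B \<subseteq> F" "2 * card B \<le> (K choose 3) * ((?n + 1) * (?n + 2))"
      using card_bad_tetra[OF finA, of P ?n] by (auto simp: B_def F_def cardA)
    have "real (2 * card B) \<le> real ((K choose 3) * ((?n + 1) * (?n + 2)))" using B(2) by (simp only: of_nat_le_iff)
    then have B2: "real (card B) \<le> real (K choose 3) * (real ((?n + 1) * (?n + 2)) / 2)"
      unfolding of_nat_mult by simp
    have X0: "0 \<le> X S" for S unfolding X_def by (intro sum_nonneg mult_nonneg_nonneg tetra_weight_nonneg) auto
    have Xg: "4 * (21.60288 * real N) \<le> X S" if S: "S \<in> F - B" for S
    proof -
      have "(\<Sum>h\<in>S. 21.60288 * real N) \<le> X S"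
        unfolding X_def
      proof (intro sum_mono good_tetra_cost)
        show "P (vert ?n i) = i" if "i \<in> S" for i
          using lab(2)[of i] that FD(3)[of S] S by (auto simp: P_def t_def A_def)
      qed (use S FD N in \<open>auto simp: B_def\<close>)
      then show ?thesis using FD(2)[of S] S by simp
    qed
    have "(real (K choose 4) - real (K choose 3) * (real ((?n + 1) * (?n + 2)) / 2)) * (4 * (21.60288 * real N))
      \<le> (real (card F) - real (card B)) * (4 * (21.60288 * real N))"
      using B2 cardF by (intro mult_right_mono) auto
    also have "real (card F) - real (card B) = real (card (F - B))"
      using B(1) finF by (simp add: card_Diff_subset finite_subset card_mono of_nat_diff)
    also have "real (card (F - B)) * (4 * (21.60288 * real N)) = (\<Sum>S\<in>F - B. 4 * (21.60288 * real N))" by simp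
    also have "\<dots> \<le> (\<Sum>S\<in>F - B. X S)" by (intro sum_mono Xg)
    also have "\<dots> \<le> (\<Sum>S\<in>F. X S)" using finF X0 by (intro sum_mono2) auto
    also have "\<dots> = (\<Sum>\<tau>\<in>I. c \<tau> * of_bool (lab (a \<tau>) \<noteq> lab (b \<tau>)))"
      unfolding X_def P_def sumI[symmetric] by (intro sum.cong) (auto simp: a_def b_def c_def)
    finally show "(real (K choose 4) - real (K choose 3) * (real ((?n + 1) * (?n
        + 2)) / 2)) * (4 * (21.60288 * real N))
      \<le> (\<Sum>\<tau>\<in>I. c \<tau> * of_bool (lab (a \<tau>) \<noteq> lab (b \<tau>)))" .
  qed
  have upper: "ckr_opt V E w K t \<le> real (K choose 4) * (4 * (18 * real N + 2.5))"
  proof -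
    define x where "x v l = real (the_inv_into U g v l) / real ?n" for v l
    have xg: "x (g u) l = real (u l) / real ?n" if "u \<in> U" for u l
      using that by (simp add: x_def the_inv_into_f_f[OF g])
    have "ckr_feasible V K t x"
      unfolding ckr_feasible_def
    proof (intro conjI ballI)
      fix v assume "v \<in> V"
      then obtain u S where u: "v = g u" "u \<in> U" "S \<in> F" "u \<in> lat S ?n" by (auto simp: V_def U_def)
      have "sum u {1..K} = sum u S"
        using FD(3)[OF u(3)] u(4) by (intro sum.mono_neutral_right) (auto simp: A_def lat_def)
      then have s: "sum u {1..K} = ?n" using u(4) by (simp add: lat_def)
      have "(\<Sum>l=1..K. x v l) = real (sum u {1..K}) / real ?n"
        unfolding u(1) by (simp add: xg[OF u(2)] sum_divide_distrib)
      then have "(\<Sum>l=1..K. x v l) = 1" unfolding s using N by simp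
      moreover have "x v l \<in> {0..1}" for l
        using lat_le[OF u(4) FD(1)[OF u(3)], of l] N unfolding u(1) xg[OF u(2)] by (simp add: field_simps)
      ultimately show "x v \<in> simplex K" by (simp add: simplex_def)
    next
      fix i j assume "i \<in> {1..K}" "j \<in> {1..K}"
      then show "x (t i) j = unit_vec i j"
        using xg[OF vert_U, of i j] N by (simp add: t_def A_def vert_def unit_vec_def)
    qed
    then have "ckr_opt V E w K t \<le> ckr_value E w K x" by (rule ckr_opt_le)
    \<comment> \<open>The ends of an edge differ by \<open>1 / n\<close> in exactly the two
      coordinates \<open>p\<close> and \<open>q\<close>.\<close>
    also have "ckr_value E w K x = 1/2 * (\<Sum>\<tau>\<in>I. c \<tau> * (2 / real ?n))"
      unfolding ckr_value_eq
    proof (intro arg_cong[where f = "\<lambda>z. 1/2 * z"] sum.cong refl)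
      fix \<tau> assume "\<tau> \<in> I"
      obtain S h y p q where \<tau>1: "\<tau> = (S, h, y, p, q)" by (cases \<tau>)
      then have \<tau>: "\<tau> = (S, h, y, p, q)" "S \<in> F" "y \<in> lat S ?m" "p \<in> S" "q \<in> S" "p \<noteq> q"
        using \<open>\<tau> \<in> I\<close> by (auto simp: I_def)
      have U: "up p y \<in> U" "up q y \<in> U" using up_U \<tau> by blast+
      have pq: "p \<in> {1..K}" "q \<in> {1..K}" using \<tau>(4,5) FD(3)[OF \<tau>(2)] by (auto simp: A_def)
      have "l1_dist K (x (g (up p y))) (x (g (up q y))) = (\<Sum>l=1..K. of_bool (l = p) / real ?n
          + of_bool (l = q) / real ?n)"
        unfolding l1_dist_def xg[OF U(1)] xg[OF U(2)]
        using \<tau>(6) by (intro sum.cong) (auto simp: diff_divide_distrib[symmetric])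
      also have "\<dots> = 2 / real ?n"
        using pq by (simp add: sum.distrib sum_divide_distrib[symmetric])
      finally show "c \<tau> * l1_dist K (x (a \<tau>)) (x (b \<tau>)) = c \<tau> * (2 / real ?n)"
        by (simp add: \<tau>(1) a_def b_def)
    qed
    also have "\<dots> = (\<Sum>\<tau>\<in>I. c \<tau>) / real ?n" by (simp add: sum_divide_distrib sum_distrib_left)
    also have "(\<Sum>\<tau>\<in>I. c \<tau>) = (\<Sum>S\<in>F. \<Sum>h\<in>S. \<Sum>y\<in>lat S ?m. \<Sum>p\<in>S. \<Sum>q\<in>S - {p}. tetra_weight N S h y p q)"
      unfolding sumI[symmetric] c_def ..
    also have "\<dots> \<le> (\<Sum>S\<in>F. \<Sum>h\<in>S. 162 * (real N)\<^sup>2 + 22.5 * real N)"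
      using FD(2) N by (intro sum_mono tetra_weight_sum_le) auto
    also have "\<dots> = (\<Sum>S\<in>F. 4 * (162 * (real N)\<^sup>2 + 22.5 * real N))"
      using FD(2) by (intro sum.cong) simp_all
    also have "\<dots> = real (K choose 4) * (4 * (162 * (real N)\<^sup>2 + 22.5 * real N))" by (simp add: cardF)
    finally have "ckr_opt V E w K t \<le> real (K choose 4) * (4 * (162 * (real N)\<^sup>2 + 22.5 * real N)) / real ?n"
      using N by (simp add: divide_right_mono)
    also have "\<dots> = real (K choose 4) * (4 * (18 * real N + 2.5))"
      using N by (simp add: field_simps power2_eq_square)
    finally show ?thesis .
  qed
  \<comment> \<open>Along the side from terminal 2 to terminal 1 the first coordinate rises from 0
    to 1, and each edge weighs at least \<open>0.0048 / N\<close>; the factor \<open>1/2\<close> in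
    \<open>ckr_value\<close> gives \<open>0.0024 / N\<close>.\<close>
  have pos: "0.0024 / real N \<le> ckr_opt V E w K t"
  proof (rule ckr_opt_ge)
    fix x assume x: "ckr_feasible V K t x"
    define S where "S = {1, 2, 3, 4 :: nat}"
    have S: "S \<in> F" using K4 by (auto simp: S_def F_def A_def)
    define u where "u s = pt 1 2 3 s (?n - s) 0" for s
    define \<tau> where "\<tau> s = (S, 1 :: nat, pt 1 2 3 s (?m - s) 0, 1 :: nat, 2 :: nat)" for s
    have "pt 1 2 3 s (?m - s) 0 \<in> lat S ?m" if "s < ?n" for s
    proof -
      have "pt 1 2 3 s (?m - s) 0 \<in> lat {1, 2, 3} ?m" using that by (simp add: pt_lat)
      then show ?thesis using lat_mono[of "{1, 2, 3}" S ?m] by (auto simp: S_def)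
    qed
    then have \<tau>I: "\<tau> ` {..<?n} \<subseteq> I" using S by (auto simp: \<tau>_def I_def S_def)
    have inj: "inj_on \<tau> {..<?n}"
    proof (rule inj_onI)
      fix s s' assume "\<tau> s = \<tau> s'"
      then have "pt 1 2 3 s (?m - s) 0 1 = pt 1 2 3 s' (?m - s') 0 1" by (simp add: \<tau>_def)
      then show "s = s'" by (simp add: pt_def)
    qed
    have ab: "a (\<tau> s) = g (u (Suc s))" "b (\<tau> s) = g (u s)" if "s < ?n" for s
    proof -
      have "Suc (?m - s) = ?n - s" "?m - s = ?n - Suc s" using that by auto
      then show "a (\<tau> s) = g (u (Suc s))" "b (\<tau> s) = g (u s)"
        unfolding a_def b_def \<tau>_def u_def by (simp_all add: pt_apply pt_upd)
    qed
    have l1s: "l1_dist K y z = l1_dist K z y" for y z by (simp add: l1_dist_def abs_minus_commute)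
    have "vert ?n 2 = u 0" "vert ?n 1 = u ?n" by (auto simp: u_def vert_def pt_def fun_eq_iff)
    moreover have "x (t 2) 1 = unit_vec 2 1" "x (t 1) 1 = unit_vec 1 1"
      using x K4 unfolding ckr_feasible_def by auto
    ultimately have ends: "x (g (u 0)) 1 = 0" "x (g (u ?n)) 1 = 1"
      by (simp_all add: t_def unit_vec_def)
    have "1 = \<bar>x (g (u 0)) 1 - x (g (u ?n)) 1\<bar>" using ends by simp
    also have "\<dots> \<le> l1_dist K (x (g (u 0))) (x (g (u ?n)))"
      unfolding l1_dist_def using K4 by (intro member_le_sum) auto
    also have "\<dots> \<le> (\<Sum>s<?n. l1_dist K (x (g (u s))) (x (g (u (Suc s)))))"
      by (rule l1_dist_path)
    finally have "0.0048 / real N * 1 \<le> 0.0048 / real N * (\<Sum>s<?n. l1_dist K (x (g (u s))) (x (g (u (Suc s)))))"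
      by (intro mult_left_mono) auto
    also have "\<dots> \<le> (\<Sum>s<?n. c (\<tau> s) * l1_dist K (x (a (\<tau> s))) (x (b (\<tau> s))))"
      unfolding sum_distrib_left
    proof (rule sum_mono)
      fix s assume "s \<in> {..<?n}"
      then have "l1_dist K (x (a (\<tau> s))) (x (b (\<tau> s))) = l1_dist K (x (g (u s))) (x (g (u (Suc s))))"
        using ab l1s by simp
      moreover have "0.0048 / real N \<le> c (\<tau> s)" unfolding c_def \<tau>_def using tetra_weight_ge by simp
      ultimately show "0.0048 / real N * l1_dist K (x (g (u s))) (x (g (u (Suc s))))
          \<le> c (\<tau> s) * l1_dist K (x (a (\<tau> s))) (x (b (\<tau> s)))"
        by (intro mult_mono) (auto simp: l1_dist_def sum_nonneg c_nonneg \<tau>_def c_def tetra_weight_nonneg)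
    qed
    also have "\<dots> = (\<Sum>\<tau>\<in>\<tau> ` {..<?n}. c \<tau> * l1_dist K (x (a \<tau>)) (x (b \<tau>)))"
      using inj by (simp add: sum.reindex)
    also have "\<dots> \<le> (\<Sum>\<tau>\<in>I. c \<tau> * l1_dist K (x (a \<tau>)) (x (b \<tau>)))"
      using \<tau>I finI c_nonneg by (intro sum_mono2) (auto simp: l1_dist_def intro!: mult_nonneg_nonneg sum_nonneg)
    finally show "0.0024 / real N \<le> ckr_value E w K x"
      unfolding ckr_value_eq by simp
  qed
  have "0 < 0.0024 / real N" using N by simp
  with pos have "0 < ckr_opt V E w K t" by linarith
  with instance_ok upper lower show ?thesis by blast
qed

lemma choose_4_eq: "(K choose 3) * (K - 3) = 4 * (K choose 4)"
  using binomial_absorb_comp[of K 3] times_binomial_minus1_eq[of 4 K] by (simp add: numeral_eq_Suc algebra_simps)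

theorem theorem1:
  fixes \<epsilon> :: real
  assumes "\<epsilon> > 0"
  shows "\<exists>(V :: nat set) E w k t.
           multiway_cut_instance V E w k t \<and>
           ckr_opt V E w k t > 0 \<and>
           integrality_gap V E w k t \<ge> 1.20016 - \<epsilon>"
proof -
  define N where "N = max 10 (nat \<lceil>2 / \<epsilon>\<rceil>)"
  have N: "10 \<le> N" by (simp add: N_def)
  have "2 / \<epsilon> \<le> real N" unfolding N_def by linarith
  then have eN: "2 \<le> \<epsilon> * real N" using assms by (simp add: field_simps)
  define c where "c = (9 * N + 1) * (9 * N + 2)"
  \<comment> \<open>With \<open>K - 3 = 2 * c * N\<close>, the bound on the number of bad sets
    becomes exactly \<open>(K choose 4) / N\<close>.\<close>
  define K where "K = 3 + 2 * c * N"
  have K: "4 \<le> K" using N by (simp add: K_def c_def)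
  obtain V :: "nat set" and E w t where inst: "multiway_cut_instance V E w K t" "0 < ckr_opt V E w K t"
    and up: "ckr_opt V E w K t \<le> real (K choose 4) * (4 * (18 * real N + 2.5))"
    and lo: "(real (K choose 4) - real (K choose 3) * (real c / 2)) * (4 * (21.60288 * real N))
        \<le> integral_opt V E w K t"
    using gap_instance[OF N K] unfolding c_def by blast
  define b where "b = real (K choose 4)"
  have bpos: "0 < b" using K by (simp add: b_def)
  have "(K choose 3) * (2 * c * N) = 4 * (K choose 4)" using choose_4_eq[of K] by (simp add: K_def)
  then have "real ((K choose 3) * (2 * c * N)) = real (4 * (K choose 4))" by (simp only:)
  then have "real (K choose 3) * (real c / 2) * real N = b" by (simp add: b_def mult_ac)
  then have bad: "real (K choose 3) * (real c / 2) = b / real N" using N by (simp add: field_simps)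
  have "1.20016 - \<epsilon> \<le> (1 - 1 / real N) * (21.60288 * real N) / (18 * real N + 2.5)"
  proof -
    \<comment> \<open>As \<open>\<epsilon> * N\<close> is at least 2, the term
      \<open>18 * (\<epsilon> * N)\<close> is at least 36, more than the lower-order terms
      \<open>3.0004 + 21.60288\<close>.\<close>
    have "(1.20016 - \<epsilon>) * (18 * real N + 2.5) \<le> 21.60288 * real N - 21.60288"
    proof -
      have "(1.20016 - \<epsilon>) * (18 * real N + 2.5) = 21.60288 * real N + 3.0004 - 18 * (\<epsilon> * real N) - 2.5 * \<epsilon>"
        by (simp add: field_simps)
      then show ?thesis using eN assms by simp
    qed
    also have "\<dots> = (1 - 1 / real N) * (21.60288 * real N)" using N by (simp add: field_simps)
    finally show ?thesis using N by (subst pos_le_divide_eq) auto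
  qed
  also have "\<dots> = (b - b / real N) * (4 * (21.60288 * real N)) / (b * (4 * (18 * real N + 2.5)))"
  proof -
    have "(b - b / real N) * (4 * x) = (4 * b) * ((1 - 1 / real N) * x)" "b * (4 * x) = (4 * b) * x" for x
      by (simp_all add: algebra_simps)
    then show ?thesis using bpos by (simp only: mult_divide_mult_cancel_left)
  qed
  also have "\<dots> \<le> integral_opt V E w K t / (b * (4 * (18 * real N + 2.5)))"
    using lo bpos unfolding bad b_def[symmetric] by (intro divide_right_mono) auto
  also have "\<dots> \<le> integral_opt V E w K t / ckr_opt V E w K t"
  proof (rule divide_left_mono)
    have "0 \<le> (b - b / real N) * (4 * (21.60288 * real N))"
      using bpos N by (simp add: field_simps)
    then show "0 \<le> integral_opt V E w K t" using lo unfolding bad b_def[symmetric] by linarith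
    show "ckr_opt V E w K t \<le> b * (4 * (18 * real N + 2.5))" using up by (simp add: b_def)
    show "0 < b * (4 * (18 * real N + 2.5)) * ckr_opt V E w K t" using bpos inst(2) by (simp add: add_pos_pos)
  qed
  finally have "1.20016 - \<epsilon> \<le> integrality_gap V E w K t" by (simp add: integrality_gap_def)
  with inst show ?thesis by blast
qed

end
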